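(* Let $B$ be a standard Brownian motion started at $0$ and $t>0$. The $\zeta$-function $\zeta_B$ of $B$ on the interval $[0,t]$ admits a meromorphic extension to the whole complex plane. Furthermore it is exactly equal to $$\zeta_B(p)=\frac{4(2^p-3)}{\sqrt\pi}\left(\frac t2\right)^{p/2}\Gamma\!\left(\frac{p+1}2\right)\zeta(p-1)$$ for all $p$, and it has a unique simple pole at $p=2$, of residue $t$.
   Context: $\zeta$ is the Riemann zeta function. For a continuous process $X$ and $\varepsilon>0$, put $S_0^\varepsilon=T_0^\varepsilon=0$ and $T_{i+1}^\varepsilon=\inf\{u\ge S_i^\varepsilon:\sup_{[S_i^\varepsilon,u]}X-X_u>\varepsilon\}$, $S_{i+1}^\varepsilon=\inf\{u\ge T_{i+1}^\varepsilon:X_u-\inf_{[T_{i+1}^\varepsilon,u]}X>\varepsilon\}$. With $R_t=\sup_{[0,t]}X-\inf_{[0,t]}X$, $N_t^\varepsilon=\mathbf{1}_{\{R_t\ge\varepsilon\}}+\max\{k\ge0:S_k^\varepsilon\le t\}$ is the number of bars of length $\ge\varepsilon$ in the $H_0$ superlevel-set barcode of $X|_{[0,t]}$ (infinite bar given length $R_t$). The $\zeta$-function of $X$ on $[0,t]$ is $\zeta_X(p)=\mathbb{E}[\mathrm{Pers}_p^p(X)]=p\int_0^\infty\varepsilon^{p-1}\,\mathbb{E}[N_t^\varepsilon]\,d\varepsilon$ for $p$ in the vertical strip where the integral converges (here $\mathrm{Re}(p)>2$), where $\mathrm{Pers}_p^p(X)$ is the sum of the $p$-th powers of the bar lengths.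 *)

theory Defs
  imports "HOL-Probability.Probability" "HOL-Complex_Analysis.Complex_Analysis"
begin

section \<open>The Riemann zeta function\<close>

text \<open>
  The unique holomorphic continuation of the Dirichlet series to the complex plane without
  the point 1; the value at the pole 1 is set to 0, so that the description is unique.
\<close>

definition riemann_zeta :: "complex \<Rightarrow> complex" where
  "riemann_zeta = (THE f. f holomorphic_on (- {1}) \<and>
      (\<forall>s. Re s > 1 \<longrightarrow> (\<lambda>n. of_nat (Suc n) powr (- s)) sums f s) \<and> f 1 = 0)"


section \<open>Brownian motion\<close>

text \<open>
  Only times \<open>t \<ge> 0\<close> are constrained. The path properties are required almost surely.
\<close>

locale standard_brownian_motion = prob_space M for M :: "'a measure" +
  fixes B :: "real \<Rightarrow> 'a \<Rightarrow> real"
  assumes measurable_B: "\<And>t. t \<ge> 0 \<Longrightarrow> B t \<in> borel_measurable M"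
    and start: "AE \<omega> in M. B 0 \<omega> = 0"
    and independent_increments:
      "\<And>(n::nat) (\<tau> :: nat \<Rightarrow> real). 0 \<le> \<tau> 0 \<Longrightarrow> mono \<tau> \<Longrightarrow>
         indep_vars (\<lambda>_. borel) (\<lambda>i \<omega>. B (\<tau> (Suc i)) \<omega> - B (\<tau> i) \<omega>) {..<n}"
    and normal_increments:
      "\<And>s t. 0 \<le> s \<Longrightarrow> s < t \<Longrightarrow>
         distributed M lborel (\<lambda>\<omega>. B t \<omega> - B s \<omega>) (normal_density 0 (sqrt (t - s)))"
    and continuous_paths: "AE \<omega> in M. continuous_on {0..} (\<lambda>t. B t \<omega>)"


section \<open>Counting bars\<close>

text \<open>
  Below, \<open>x\<close> is a single path. Times are extended reals; the infimum of the empty set is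
  \<open>\<infinity>\<close>, and both functions map \<open>\<infinity>\<close> to \<open>\<infinity>\<close>.
\<close>

definition drop_time :: "(real \<Rightarrow> real) \<Rightarrow> real \<Rightarrow> ereal \<Rightarrow> ereal" where
  "drop_time x \<epsilon> a = Inf (ereal ` {u. a \<le> ereal u \<and>
      Sup (x ` {r. a \<le> ereal r \<and> r \<le> u}) - x u > \<epsilon>})"

definition rise_time :: "(real \<Rightarrow> real) \<Rightarrow> real \<Rightarrow> ereal \<Rightarrow> ereal" where
  "rise_time x \<epsilon> a = Inf (ereal ` {u. a \<le> ereal u \<and>
      x u - Inf (x ` {r. a \<le> ereal r \<and> r \<le> u}) > \<epsilon>})"

fun T_time :: "(real \<Rightarrow> real) \<Rightarrow> real \<Rightarrow> nat \<Rightarrow> ereal"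
  and S_time :: "(real \<Rightarrow> real) \<Rightarrow> real \<Rightarrow> nat \<Rightarrow> ereal" where
  "T_time x \<epsilon> 0 = 0"
| "T_time x \<epsilon> (Suc i) = drop_time x \<epsilon> (S_time x \<epsilon> i)"
| "S_time x \<epsilon> 0 = 0"
| "S_time x \<epsilon> (Suc i) = rise_time x \<epsilon> (T_time x \<epsilon> (Suc i))"

definition path_range :: "(real \<Rightarrow> real) \<Rightarrow> real \<Rightarrow> real" where
  "path_range x t = Sup (x ` {0..t}) - Inf (x ` {0..t})"

text \<open>
  For a continuous path and \<open>\<epsilon> > 0\<close> the set under the maximum is finite, and it contains 0
  if \<open>t \<ge> 0\<close>. The value is the number of bars of length at least \<open>\<epsilon>\<close> in the degree 0
  superlevel-set barcode of the path on \<open>{0..t}\<close>.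
\<close>

definition num_bars :: "(real \<Rightarrow> real) \<Rightarrow> real \<Rightarrow> real \<Rightarrow> nat" where
  "num_bars x t \<epsilon> = of_bool (path_range x t \<ge> \<epsilon>) + Max {k. S_time x \<epsilon> k \<le> ereal t}"


section \<open>The zeta function of a process\<close>

text \<open>
  The expectation is taken in \<open>[0, \<infinity>]\<close>. It is insensitive to the behaviour of \<open>X\<close> on a null set
  of discontinuous paths, even if \<open>num_bars\<close> is not measurable there.
\<close>

definition expected_num_bars ::
  "'a measure \<Rightarrow> (real \<Rightarrow> 'a \<Rightarrow> real) \<Rightarrow> real \<Rightarrow> real \<Rightarrow> ennreal" where
  "expected_num_bars M X t \<epsilon> = (\<integral>\<^sup>+ \<omega>. of_nat (num_bars (\<lambda>s. X s \<omega>) t \<epsilon>) \<partial>M)"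

definition process_zeta_integrand ::
  "'a measure \<Rightarrow> (real \<Rightarrow> 'a \<Rightarrow> real) \<Rightarrow> real \<Rightarrow> complex \<Rightarrow> real \<Rightarrow> complex" where
  "process_zeta_integrand M X t p \<epsilon> =
     of_real \<epsilon> powr (p - 1) * of_real (enn2real (expected_num_bars M X t \<epsilon>))"

text \<open>
  Absolute convergence of the integral defining the zeta function. Finiteness of the expectations
  is demanded separately because \<open>enn2real\<close> maps \<open>\<infinity>\<close> to 0.
\<close>

definition process_zeta_converges ::
  "'a measure \<Rightarrow> (real \<Rightarrow> 'a \<Rightarrow> real) \<Rightarrow> real \<Rightarrow> complex \<Rightarrow> bool" where
  "process_zeta_converges M X t p \<longleftrightarrow>
     (\<forall>\<epsilon>>0. expected_num_bars M X t \<epsilon> < \<infinity>) \<and>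
     set_integrable lborel {0<..} (process_zeta_integrand M X t p)"

text \<open>
  The expectation of the sum of the \<open>p\<close>-th powers of the bar lengths, in its layer-cake form.
  Meaningful only where \<open>process_zeta_converges\<close> holds.
\<close>

definition process_zeta ::
  "'a measure \<Rightarrow> (real \<Rightarrow> 'a \<Rightarrow> real) \<Rightarrow> real \<Rightarrow> complex \<Rightarrow> complex" where
  "process_zeta M X t p = p * (LINT \<epsilon>:{0<..}|lborel. process_zeta_integrand M X t p \<epsilon>)"

end

theory Submission
  imports Defs
begin

text \<open>
  Count swings: drops and rises by more than \<open>\<epsilon>\<close>, in alternation. If \<open>K\<close> is the number of swings of
  the path up to time \<open>t\<close> (starting with a drop) and \<open>K'\<close> that of its negative, then \<open>K div 2\<close> is the
  number of completed rises, and exactly one of \<open>K\<close>, \<open>K'\<close> is odd if the range exceeds \<open>\<epsilon>\<close>, neither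
  otherwise. As Brownian motion is symmetric, the expected number of bars is
  \<open>2 E[(K + 1) div 2] - E[K div 2]\<close>.

  Both expectations are of the form \<open>E[\<phi>(W\<^sub>t)]\<close> for explicit even step functions \<open>\<phi>\<close>: the heat flows
  \<open>u\<close> of these functions are even in the distance \<open>y\<close> to the running extremum, and the values at
  \<open>y = \<epsilon>\<close> and, after the swing, at \<open>y = 0\<close> fit together, so that swings counted so far plus \<open>u\<close> is a
  martingale. On a time grid it is a supermartingale, and after a slight shift of the parameters a
  submartingale up to a negligible error, because \<open>u\<close> increases with \<open>y\<close>. Letting the mesh
  tend to 0 gives \<open>E[N] = \<Sum>\<^sub>m c\<^sub>m P(\<bar>W\<^sub>t\<bar> \<ge> m \<epsilon>)\<close> with \<open>c\<^sub>m = 4 m\<close> for odd and \<open>c\<^sub>m = - 2 m\<close> for even \<open>m\<close>.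
  The Mellin transform of this series is an absolute moment of \<open>W\<^sub>t\<close> times \<open>\<Sum>\<^sub>m c\<^sub>m m\<^sup>-\<^sup>p\<close>, which is
  a multiple of \<open>\<zeta>(p - 1)\<close>.

  The zeta function is continued by splitting \<open>\<Gamma>(s) \<zeta>(s) = \<integral> x\<^sup>s\<^sup>-\<^sup>1 / (e\<^sup>x - 1) dx\<close> at 1 and expanding
  the integrand in a Taylor series near 0.
\<close>

section \<open>Swings of a sequence\<close>

text \<open>The step functions are forced. The distance to the running extremum behaves like a
  Brownian motion reflected at 0, and evenness of the heat flow encodes the reflection. At distance
  \<epsilon> the flow must equal the reward of the swing plus the flow of the other parity at 0. As
  the Gaussian is symmetric, it suffices that the initial functions satisfy phi_b(\<epsilon> + z) +
  phi_b(\<epsilon> - z) = 2 ([b odd] + phi_{b+1}(z)). Starting from phi_b = 0 for |z| < \<epsilon>,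
  this recursion produces jumps of height 2 m at |z| = m \<epsilon>, for the m with the parity of b.
  Swings end at random times. On a fixed grid, independence of increments replaces the strong Markov
  property; the price is clipping and overshoot, whose effect has a known sign by monotonicity in
  |y|. Swings are defined by a strict inequality and the range condition by a weak one. Grid counts
  at thresholds \<epsilon>' < \<epsilon> and \<epsilon> bracket the number of bars, and the gap
  closes because the limit is continuous in the threshold.\<close>

text \<open>
  The state consists of the number of completed swings and of the distance of the current value from
  the extremum since the last swing: the maximum if that number is even, the minimum if it is odd.
\<close>

definition swing_step :: "real \<Rightarrow> nat \<times> real \<Rightarrow> real \<Rightarrow> nat \<times> real" where
  "swing_step \<epsilon> s \<xi> = (let y = max (snd s - (- 1) ^ fst s * \<xi>) 0
     in if y > \<epsilon> then (Suc (fst s), 0) else (fst s, y))"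

primrec swing_state :: "real \<Rightarrow> (nat \<Rightarrow> real) \<Rightarrow> nat \<Rightarrow> nat \<times> real" where
  "swing_state \<epsilon> x 0 = (0, 0)"
| "swing_state \<epsilon> x (Suc n) = swing_step \<epsilon> (swing_state \<epsilon> x n) (x (Suc n) - x n)"

lemma swing_state_bounds:
  assumes "\<epsilon> \<ge> 0"
  shows "0 \<le> snd (swing_state \<epsilon> x n) \<and> snd (swing_state \<epsilon> x n) \<le> \<epsilon>"
  using assms by (induction n) (auto simp: swing_step_def Let_def)

lemma swing_count_mono: "m \<le> n \<Longrightarrow> fst (swing_state \<epsilon> x m) \<le> fst (swing_state \<epsilon> x n)"
  by (induction n rule: dec_induct) (auto simp: swing_step_def Let_def)

text \<open>Between swings each step subtracts the signed increment, and clipping at 0 can only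
  enlarge the result; so the distance dominates the telescoped move since any earlier index.\<close>

lemma swing_state_ge:
  assumes "m \<le> n" "fst (swing_state \<epsilon> x n) = fst (swing_state \<epsilon> x m)" "\<epsilon> \<ge> 0"
  shows "snd (swing_state \<epsilon> x n) \<ge> (- 1) ^ fst (swing_state \<epsilon> x m) * (x m - x n)"
  using assms
proof (induction n rule: dec_induct)
  case base
  then show ?case using swing_state_bounds by auto
next
  case (step n)
  have "fst (swing_state \<epsilon> x m) \<le> fst (swing_state \<epsilon> x n)"
       "fst (swing_state \<epsilon> x n) \<le> fst (swing_state \<epsilon> x (Suc n))"
    using step(1) by (auto intro!: swing_count_mono simp del: swing_state.simps)
  with step have eq: "fst (swing_state \<epsilon> x n) = fst (swing_state \<epsilon> x m)"
    by linarith
  with step have "snd (swing_state \<epsilon> x n) \<ge> (- 1) ^ fst (swing_state \<epsilon> x m) * (x m - x n)"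
    by auto
  moreover have "snd (swing_state \<epsilon> x (Suc n)) \<ge>
      snd (swing_state \<epsilon> x n) - (- 1) ^ fst (swing_state \<epsilon> x m) * (x (Suc n) - x n)"
    using step.prems eq by (auto simp: swing_step_def Let_def split: if_splits)
  ultimately show ?case by (simp add: algebra_simps)
qed

text \<open>If the count stayed at \<open>k\<close>, \<open>swing_state_ge\<close> would push the
  distance above \<epsilon>, which no state allows. The form with \<open>k \<le>\<close> suits an
  induction that matches the swings of a path one by one with those of its grid samples.\<close>

lemma swing_count_Suc:
  assumes "m \<le> n" "(- 1) ^ k * (x m - x n) > \<epsilon>" "k \<le> fst (swing_state \<epsilon> x m)" "\<epsilon> \<ge> 0"
  shows "Suc k \<le> fst (swing_state \<epsilon> x n)"
proof (rule ccontr)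
  assume "\<not> ?thesis"
  moreover have "fst (swing_state \<epsilon> x m) \<le> fst (swing_state \<epsilon> x n)"
    using assms(1) by (rule swing_count_mono)
  ultimately have "fst (swing_state \<epsilon> x n) = fst (swing_state \<epsilon> x m)" "fst (swing_state \<epsilon> x m) = k"
    using assms(3) by linarith+
  with swing_state_ge[OF assms(1) this(1) assms(4)] assms(2) swing_state_bounds[OF assms(4), of x n]
  show False by simp
qed

text \<open>
  Once the range exceeds \<open>\<epsilon>\<close>, the states of \<open>x\<close> and of \<open>- x\<close> agree except that one of the two
  paths is waiting for a drop and the other one for a rise.
\<close>

lemma swing_state_reflect:
  assumes "\<epsilon> \<ge> 0"
  shows "of_bool (\<exists>i\<le>n. \<exists>j\<le>n. x i - x j > \<epsilon>) =
    fst (swing_state \<epsilon> x n) mod 2 + fst (swing_state \<epsilon> (\<lambda>i. - x i) n) mod 2"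
proof -
  let ?a = "swing_state \<epsilon> x" and ?b = "swing_state \<epsilon> (\<lambda>i. - x i)"
  \<comment> \<open>Two phases. While the range is at most \<epsilon>, the two distances measure the
    gaps to the maximum and minimum so far, both attained. Once it exceeds \<epsilon>, the distances
    coincide and the parities differ, and this persists because the two signs are opposite.\<close>
  define small where "small n \<longleftrightarrow> fst (?a n) = 0 \<and> fst (?b n) = 0 \<and>
     (\<forall>i\<le>n. x i \<le> x n + snd (?a n)) \<and> (\<forall>i\<le>n. x n - snd (?b n) \<le> x i) \<and>
     (\<exists>i\<le>n. x i = x n + snd (?a n)) \<and> (\<exists>i\<le>n. x i = x n - snd (?b n)) \<and>
     snd (?a n) + snd (?b n) \<le> \<epsilon>" for n
  define large where "large n \<longleftrightarrow> (\<exists>i\<le>n. \<exists>j\<le>n. x i - x j > \<epsilon>) \<and> snd (?a n) = snd (?b n) \<and>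
     odd (fst (?a n)) \<noteq> odd (fst (?b n))" for n
  have sgn: "(- 1) ^ l = - ((- 1) ^ k :: real)" if "odd k \<noteq> odd l" for k l :: nat
    using that by (cases "even k") auto
  have "small n \<or> large n" for n
  proof (induction n)
    case 0
    then show ?case using assms by (simp add: small_def)
  next
    case (Suc n)
    show ?case
    proof (cases "small n")
      case True
      define \<xi> where "\<xi> = x (Suc n) - x n"
      define y z where "y = snd (?a n)" and "z = snd (?b n)"
      have fst0: "fst (?a n) = 0" "fst (?b n) = 0" using True by (auto simp: small_def)
      define y' z' where "y' = max (y - \<xi>) 0" and "z' = max (z + \<xi>) 0"
      have x': "x (Suc n) = x n + \<xi>" by (simp add: \<xi>_def)
      have A: "?a (Suc n) = (if y' > \<epsilon> then (1, 0) else (0, y'))"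
        using fst0 by (simp add: swing_step_def Let_def y'_def y_def \<xi>_def)
      have B: "?b (Suc n) = (if z' > \<epsilon> then (1, 0) else (0, z'))"
        using fst0 by (simp add: swing_step_def Let_def z'_def z_def \<xi>_def algebra_simps)
      have le: "\<forall>i\<le>n. x i \<le> x n + y" "\<forall>i\<le>n. x n - z \<le> x i" "y + z \<le> \<epsilon>"
        and ex: "\<exists>i\<le>n. x i = x n + y" "\<exists>i\<le>n. x i = x n - z"
        using True by (auto simp: small_def y_def z_def)
      have yz: "y \<ge> 0" "z \<ge> 0" using swing_state_bounds[OF assms] by (auto simp: y_def z_def)
      have le': "\<forall>i\<le>Suc n. x i \<le> x (Suc n) + y'" "\<forall>i\<le>Suc n. x (Suc n) - z' \<le> x i"
        using le x' by (fastforce simp: le_Suc_eq y'_def z'_def max_def)+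
      have ex1: "\<exists>i\<le>Suc n. x i = x (Suc n) + y'"
      proof (cases "y \<ge> \<xi>")
        case True
        then have "x (Suc n) + y' = x n + y" by (simp add: y'_def x')
        then show ?thesis using ex(1) by (metis le_SucI)
      qed (auto simp: y'_def)
      have ex2: "\<exists>i\<le>Suc n. x i = x (Suc n) - z'"
      proof (cases "z + \<xi> \<ge> 0")
        case True
        then have "x (Suc n) - z' = x n - z" by (simp add: z'_def x')
        then show ?thesis using ex(2) by (metis le_SucI)
      qed (auto simp: z'_def)
      show ?thesis
      proof (cases "y' + z' \<le> \<epsilon>")
        case True
        moreover have "y' \<ge> 0" "z' \<ge> 0" by (auto simp: y'_def z'_def)
        ultimately have "\<not> y' > \<epsilon>" "\<not> z' > \<epsilon>" by linarith+
        then have "?a (Suc n) = (0, y')" "?b (Suc n) = (0, z')" using A B by auto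
        then have "small (Suc n)" using le' ex1 ex2 True unfolding small_def
          by (simp del: swing_state.simps)
        then show ?thesis ..
      next
        case False
        have big: "\<exists>i\<le>Suc n. \<exists>j\<le>Suc n. x i - x j > \<epsilon>"
          using ex1 ex2 False by (smt (verit))
        \<comment> \<open>If neither distance were clipped, their sum would still be
          \<open>y + z \<le> \<epsilon>\<close>. So the new value is a new extremum: one distance is
          0 and the other path has just swung and been reset to 0.\<close>
        have "y' = 0 \<and> z' > \<epsilon> \<or> z' = 0 \<and> y' > \<epsilon>"
          using False le(3) yz by (auto simp: y'_def z'_def max_def split: if_splits)
        then have "large (Suc n)" using big A B assms unfolding large_def
          by (auto simp del: swing_state.simps)
        then show ?thesis ..
      qed
    next
      case False
      with Suc have "large n" by blast
      then have l: "\<exists>i\<le>n. \<exists>j\<le>n. x i - x j > \<epsilon>" "snd (?a n) = snd (?b n)"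
        "odd (fst (?a n)) \<noteq> odd (fst (?b n))" by (auto simp: large_def)
      have "(- 1) ^ fst (?b n) = - ((- 1) ^ fst (?a n) :: real)" using sgn l(3) by blast
      then have "snd (?b n) - (- 1) ^ fst (?b n) * (- x (Suc n) - - x n)
        = snd (?a n) - (- 1) ^ fst (?a n) * (x (Suc n) - x n)"
        using l(2) by (simp add: algebra_simps)
      then have "snd (?a (Suc n)) = snd (?b (Suc n))" "odd (fst (?a (Suc n))) \<noteq> odd (fst (?b (Suc n)))"
        using l(3) by (auto simp: swing_step_def Let_def)
      moreover have "\<exists>i\<le>Suc n. \<exists>j\<le>Suc n. x i - x j > \<epsilon>" using l(1) le_SucI by blast
      ultimately show ?thesis unfolding large_def by blast
    qed
  qed
  then consider "small n" | "large n" by blast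
  then show ?thesis
  proof cases
    case 1
    have "x i - x j \<le> \<epsilon>" if "i \<le> n" "j \<le> n" for i j
      using 1 that unfolding small_def by (smt (verit))
    then have "\<not> (\<exists>i\<le>n. \<exists>j\<le>n. x i - x j > \<epsilon>)" by (meson not_le)
    then show ?thesis using 1 by (simp add: small_def)
  next
    case 2
    then show ?thesis unfolding large_def
      by (cases "even (fst (?a n))") (auto simp: odd_iff_mod_2_eq_one)
  qed
qed

section \<open>Level functions\<close>

text \<open>
  \<open>level b j\<close> is \<open>2 \<Sum> m\<close>, summed over the \<open>m \<le> j\<close> with the parity of \<open>b\<close>.
\<close>

definition level :: "nat \<Rightarrow> nat \<Rightarrow> nat" where
  "level b j = (if even b then 2 * (j div 2) * (j div 2 + 1) else 2 * ((j + 1) div 2)\<^sup>2)"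

lemma level_0 [simp]: "level b 0 = 0" by (auto simp: level_def)

lemma level_Suc: "level b (Suc j) = level b j + (if even (b + Suc j) then 2 * Suc j else 0)"
  by (cases "even b"; cases "even j")
     (auto simp: level_def power2_eq_square elim!: evenE oddE)

lemma level_cong: "even b = even c \<Longrightarrow> level b = level c"
  by (auto simp: level_def fun_eq_iff)

lemma level_mono: "i \<le> j \<Longrightarrow> level b i \<le> level b j"
  by (rule lift_Suc_mono_le[of "level b"]) (auto simp: level_Suc)

text \<open>Recursion behind the boundary condition: for z in the band between j \<epsilon> and (j +
  1) \<epsilon>, \<epsilon> + z lies in band j + 1 and |\<epsilon> - z| in band j - 1, or in band 0
  if j = 0, just as truncated subtraction says. The summand \<open>b mod 2\<close> is the reward of
  the swing.\<close>

lemma level_average: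
  "level b (Suc j) + level b (j - 1) = 2 * (b mod 2 + level (Suc b) j)"
  by (cases j; cases "even b"; cases "even j")
     (auto simp: level_def power2_eq_square parity_cases elim!: evenE oddE)

lemma level_bound: "level b j \<le> (j + 1)\<^sup>2"
  by (cases "even b"; cases "even j")
     (auto simp: level_def power2_eq_square elim!: evenE oddE)

definition levf :: "real \<Rightarrow> nat \<Rightarrow> real \<Rightarrow> ennreal" where
  "levf \<epsilon> b z = of_nat (level b (nat \<lfloor>\<bar>z\<bar> / \<epsilon>\<rfloor>))"

lemma levf_measurable [measurable]: "levf \<epsilon> b \<in> borel_measurable borel"
  unfolding levf_def by measurable

lemma levf_minus [simp]: "levf \<epsilon> b (- z) = levf \<epsilon> b z"
  by (simp add: levf_def)

lemma levf_cong: "even b = even c \<Longrightarrow> levf \<epsilon> b = levf \<epsilon> c"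
  using level_cong[of b c] by (simp add: levf_def fun_eq_iff)

lemma levf_mono: "\<epsilon> > 0 \<Longrightarrow> \<bar>y\<bar> \<le> \<bar>z\<bar> \<Longrightarrow> levf \<epsilon> b y \<le> levf \<epsilon> b z"
  unfolding levf_def by (intro of_nat_mono level_mono nat_mono floor_mono divide_right_mono) auto

lemma levf_eq_0: "\<epsilon> > 0 \<Longrightarrow> \<bar>z\<bar> < \<epsilon> \<Longrightarrow> levf \<epsilon> b z = 0"
proof -
  assume "\<epsilon> > 0" "\<bar>z\<bar> < \<epsilon>"
  then have "\<lfloor>\<bar>z\<bar> / \<epsilon>\<rfloor> = 0" by (simp add: floor_eq_iff)
  then show ?thesis by (simp add: levf_def)
qed

lemma levf_ge_1:
  assumes "\<epsilon> > 0" "\<bar>z\<bar> \<ge> \<epsilon>" shows "levf \<epsilon> 1 z \<ge> 1"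
proof -
  have "\<lfloor>\<bar>z\<bar> / \<epsilon>\<rfloor> \<ge> 1" using assms by (simp add: le_floor_iff)
  then have "level 1 1 \<le> level 1 (nat \<lfloor>\<bar>z\<bar> / \<epsilon>\<rfloor>)" by (intro level_mono) linarith
  then have "1 \<le> level 1 (nat \<lfloor>\<bar>z\<bar> / \<epsilon>\<rfloor>)" by (simp add: level_def)
  then show ?thesis unfolding levf_def by (metis of_nat_1 of_nat_mono)
qed

text \<open>The floor jumps at multiples of \<epsilon>; for odd \<open>b\<close> the identity does
  break at z = 0, where both arguments sit on the edge of band 1. The excluded points are a null
  set, invisible to Gaussian averages.\<close>

lemma levf_average:
  assumes "\<epsilon> > 0" "z / \<epsilon> \<notin> \<int>"
  shows "levf \<epsilon> b (\<epsilon> + z) + levf \<epsilon> b (\<epsilon> - z) = 2 * (of_nat (b mod 2) + levf \<epsilon> (Suc b) z)"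
proof -
  have pos: "levf \<epsilon> b (\<epsilon> + z) + levf \<epsilon> b (\<epsilon> - z) = 2 * (of_nat (b mod 2) + levf \<epsilon> (Suc b) z)"
    if "z \<ge> 0" "z / \<epsilon> \<notin> \<int>" for z
  proof -
    define j where "j = nat \<lfloor>z / \<epsilon>\<rfloor>"
    have j: "\<lfloor>z / \<epsilon>\<rfloor> = int j" using that assms by (simp add: j_def)
    have "real_of_int \<lfloor>z / \<epsilon>\<rfloor> \<noteq> z / \<epsilon>" using that by (metis Ints_of_int)
    then have jj: "j < z / \<epsilon>" "z / \<epsilon> < j + 1"
      using of_int_floor_le[of "z/\<epsilon>"] floor_correct[of "z/\<epsilon>"] unfolding j by auto
    have "\<lfloor>\<bar>\<epsilon> + z\<bar> / \<epsilon>\<rfloor> = int (Suc j)"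
      using that assms jj by (simp add: floor_eq_iff add_divide_distrib)
    then have "nat \<lfloor>\<bar>\<epsilon> + z\<bar> / \<epsilon>\<rfloor> = Suc j" by (simp only: nat_int)
    moreover have "nat \<lfloor>\<bar>\<epsilon> - z\<bar> / \<epsilon>\<rfloor> = j - 1"
    proof (cases j)
      case 0
      then have "z < \<epsilon>" using jj assms by (simp add: field_simps)
      then have "\<bar>\<epsilon> - z\<bar> / \<epsilon> = 1 - z / \<epsilon>" using assms by (simp add: field_simps)
      then have "\<lfloor>\<bar>\<epsilon> - z\<bar> / \<epsilon>\<rfloor> = 0" using jj 0 by (simp add: floor_eq_iff)
      then show ?thesis using 0 by simp
    next
      case (Suc i)
      then have "z > \<epsilon>" using jj assms by (auto simp: field_simps) (smt (verit) mult_less_0_iff of_nat_0_le_iff mult_nonneg_nonneg)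
      then have "\<bar>\<epsilon> - z\<bar> / \<epsilon> = z / \<epsilon> - 1" using assms by (simp add: field_simps)
      then have "\<lfloor>\<bar>\<epsilon> - z\<bar> / \<epsilon>\<rfloor> = int i" using j Suc by simp
      then show ?thesis using Suc by simp
    qed
    moreover have "nat \<lfloor>\<bar>z\<bar> / \<epsilon>\<rfloor> = j" using that by (simp add: j_def)
    ultimately have "levf \<epsilon> b (\<epsilon> + z) + levf \<epsilon> b (\<epsilon> - z) = of_nat (level b (Suc j) + level b (j - 1))"
      "levf \<epsilon> (Suc b) z = of_nat (level (Suc b) j)"
      by (simp_all add: levf_def)
    then show ?thesis by (simp only: level_average of_nat_mult of_nat_add of_nat_numeral)
  qed
  show ?thesis
  proof (cases "z \<ge> 0")
    case True
    then show ?thesis using pos assms by blast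
  next
    case False
    have "- z / \<epsilon> \<notin> \<int>" using assms(2) by (metis Ints_minus minus_divide_left minus_minus)
    then show ?thesis using pos[of "- z"] False by (simp add: add.commute)
  qed
qed

lemma levf_bound:
  assumes "\<epsilon> > 0"
  shows "levf \<epsilon> b z \<le> ennreal ((\<bar>z\<bar> / \<epsilon> + 1)\<^sup>2)"
proof -
  define j where "j = nat \<lfloor>\<bar>z\<bar> / \<epsilon>\<rfloor>"
  have "real j \<le> \<bar>z\<bar> / \<epsilon>" using assms by (simp add: j_def)
  then have "real ((j + 1)\<^sup>2) \<le> (\<bar>z\<bar> / \<epsilon> + 1)\<^sup>2" by (auto intro!: power_mono)
  moreover have "real (level b j) \<le> real ((j + 1)\<^sup>2)" using level_bound of_nat_mono by blast
  ultimately have "real (level b j) \<le> (\<bar>z\<bar> / \<epsilon> + 1)\<^sup>2" by linarith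
  then show ?thesis unfolding levf_def j_def
    by (metis ennreal_of_nat_eq_real_of_nat ennreal_leI)
qed

section \<open>Gaussian expectations of the level functions\<close>

definition gauss_exp :: "real \<Rightarrow> (real \<Rightarrow> ennreal) \<Rightarrow> ennreal" where
  "gauss_exp s g = (\<integral>\<^sup>+z. ennreal (normal_density 0 s z) * g z \<partial>lborel)"

lemma gauss_exp_mono: "(\<And>z. f z \<le> g z) \<Longrightarrow> gauss_exp s f \<le> gauss_exp s g"
  unfolding gauss_exp_def by (intro nn_integral_mono mult_left_mono) auto

lemma gauss_exp_cong_AE:
  assumes "AE z in lborel. f z = g z" shows "gauss_exp s f = gauss_exp s g"
  unfolding gauss_exp_def by (rule nn_integral_cong_AE) (use assms in auto)

lemma gauss_exp_add:
  assumes [measurable]: "f \<in> borel_measurable borel" "g \<in> borel_measurable borel"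
  shows "gauss_exp s (\<lambda>z. f z + g z) = gauss_exp s f + gauss_exp s g"
  unfolding gauss_exp_def by (simp add: distrib_left nn_integral_add)

lemma gauss_exp_cmult:
  assumes [measurable]: "f \<in> borel_measurable borel"
  shows "gauss_exp s (\<lambda>z. c * f z) = c * gauss_exp s f"
  unfolding gauss_exp_def by (subst nn_integral_cmult[symmetric]) (auto simp: mult_ac)

lemma gauss_exp_const:
  assumes "s > 0" shows "gauss_exp s (\<lambda>z. c) = c"
proof -
  have "(\<integral>\<^sup>+z. ennreal (normal_density 0 s z) \<partial>lborel) = 1"
    using prob_space.emeasure_space_1[OF prob_space_normal_density[OF assms, of 0]]
    by (simp add: emeasure_density)
  then show ?thesis unfolding gauss_exp_def by (simp add: nn_integral_multc)
qed

lemma gauss_exp_minus: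
  assumes [measurable]: "g \<in> borel_measurable borel"
  shows "gauss_exp s (\<lambda>z. g (- z)) = gauss_exp s g"
  unfolding gauss_exp_def
  by (subst (2) nn_integral_real_affine[where c = "-1" and t = 0])
     (auto simp: normal_density_def)

lemma gauss_exp_shift:
  assumes [measurable]: "g \<in> borel_measurable borel"
  shows "gauss_exp s (\<lambda>z. g (y + z)) = (\<integral>\<^sup>+z. ennreal (normal_density 0 s (z - y)) * g z \<partial>lborel)"
  unfolding gauss_exp_def
  by (subst (2) nn_integral_real_affine[where c = 1 and t = y]) auto

lemma normal_density_le_iff_abs:
  assumes "\<bar>x\<bar> \<le> \<bar>y\<bar>" shows "normal_density 0 s y \<le> normal_density 0 s x"
proof -
  have "x\<^sup>2 \<le> y\<^sup>2" using assms by (simp add: abs_le_square_iff)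
  then show ?thesis unfolding normal_density_def by (auto intro!: divide_right_mono mult_left_mono)
qed

text \<open>
  Reflection at the midpoint \<open>m\<close> of \<open>y\<close> and \<open>y'\<close> exchanges the two Gaussian weights; the claim then
  holds pointwise after symmetrization, by the rearrangement inequality.
\<close>

lemma gauss_exp_mono_shift:
  assumes [measurable]: "g \<in> borel_measurable borel"
    and g: "\<And>u v. \<bar>u\<bar> \<le> \<bar>v\<bar> \<Longrightarrow> g u \<le> g v" and y: "0 \<le> y" "y \<le> y'"
  shows "gauss_exp s (\<lambda>z. g (y + z)) \<le> gauss_exp s (\<lambda>z. g (y' + z))"
proof -
  define \<phi> where "\<phi> z = ennreal (normal_density 0 s z)" for z
  have [measurable]: "\<phi> \<in> borel_measurable borel" unfolding \<phi>_def by measurable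
  have \<phi>_minus: "\<phi> (- z) = \<phi> z" for z by (simp add: \<phi>_def normal_density_def)
  have \<phi>_mono: "\<phi> v \<le> \<phi> u" if "\<bar>u\<bar> \<le> \<bar>v\<bar>" for u v
    unfolding \<phi>_def using normal_density_le_iff_abs[OF that] by (simp add: ennreal_leI)
  have sym: "gauss_exp s (\<lambda>z. g (w + z)) + gauss_exp s (\<lambda>z. g (w + z)) =
      (\<integral>\<^sup>+z. \<phi> (z - w) * g z + \<phi> (z - w') * g (w + w' - z) \<partial>lborel)" for w w'
  proof -
    have "(\<integral>\<^sup>+z. \<phi> (z - w) * g z \<partial>lborel) = (\<integral>\<^sup>+z. \<phi> (w' - z) * g (w + w' - z) \<partial>lborel)"
      by (subst nn_integral_real_affine[where c = "-1" and t = "w + w'"]) auto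
    also have "\<dots> = (\<integral>\<^sup>+z. \<phi> (z - w') * g (w + w' - z) \<partial>lborel)"
      using \<phi>_minus[of "z - w'" for z] by simp
    finally have *: "(\<integral>\<^sup>+z. \<phi> (z - w) * g z \<partial>lborel) = \<dots>" .
    show ?thesis unfolding gauss_exp_shift[OF assms(1)] \<phi>_def[symmetric]
      by (subst nn_integral_add) (auto simp: *[symmetric])
  qed
  have rearr: "b * p + a * q \<le> a * p + b * q" if ba: "b \<le> a" and "q \<le> p" for a b p q :: ennreal
  proof -
    obtain c where c: "a = b + c" using diff_add_cancel_ennreal[OF ba] by (metis add.commute)
    have "c * q \<le> c * p" using that(2) by (rule mult_left_mono) simp
    then show ?thesis unfolding c by (simp add: distrib_right add_ac add_left_mono)
  qed
  have pt: "\<phi> (z - y) * g z + \<phi> (z - y') * g (y + y' - z) \<le>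
        \<phi> (z - y') * g z + \<phi> (z - y) * g (y' + y - z)" for z
  proof (cases "2 * z \<ge> y + y'")
    case True
    then have "\<phi> (z - y) \<le> \<phi> (z - y')" "g (y + y' - z) \<le> g z" using y by (auto intro!: \<phi>_mono g)
    then show ?thesis using rearr[of "\<phi> (z - y)" "\<phi> (z - y')" "g (y + y' - z)" "g z"]
      by (simp add: add.commute)
  next
    case False
    then have "\<phi> (z - y') \<le> \<phi> (z - y)" "g z \<le> g (y + y' - z)" using y by (auto intro!: \<phi>_mono g)
    then show ?thesis using rearr[of "\<phi> (z - y')" "\<phi> (z - y)" "g z" "g (y + y' - z)"]
      by (simp add: add.commute)
  qed
  have "gauss_exp s (\<lambda>z. g (y + z)) + gauss_exp s (\<lambda>z. g (y + z)) \<le>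
        gauss_exp s (\<lambda>z. g (y' + z)) + gauss_exp s (\<lambda>z. g (y' + z))"
    unfolding sym[of y y'] sym[of y' y] by (intro nn_integral_mono pt)
  then have "2 * gauss_exp s (\<lambda>z. g (y + z)) \<le> 2 * gauss_exp s (\<lambda>z. g (y' + z))"
    by (simp add: mult_2)
  then show ?thesis by (subst (asm) ennreal_mult_le_mult_iff) auto
qed

lemma gauss_exp_conv:
  assumes [measurable]: "g \<in> borel_measurable borel" and "\<sigma> > 0" "\<tau> > 0"
  shows "gauss_exp \<sigma> (\<lambda>w. gauss_exp \<tau> (\<lambda>z. g (w + z))) = gauss_exp (sqrt (\<sigma>\<^sup>2 + \<tau>\<^sup>2)) g"
proof -
  have "gauss_exp \<sigma> (\<lambda>w. gauss_exp \<tau> (\<lambda>z. g (w + z)))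
     = (\<integral>\<^sup>+w. \<integral>\<^sup>+z. ennreal (normal_density 0 \<sigma> w) * (ennreal (normal_density 0 \<tau> (z - w)) * g z) \<partial>lborel \<partial>lborel)"
    unfolding gauss_exp_shift[OF assms(1)] gauss_exp_def
    by (subst nn_integral_cmult) auto
  also have "\<dots> = (\<integral>\<^sup>+z. \<integral>\<^sup>+w. ennreal (normal_density 0 \<sigma> w) * (ennreal (normal_density 0 \<tau> (z - w)) * g z) \<partial>lborel \<partial>lborel)"
    by (rule lborel_pair.Fubini') auto
  also have "\<dots> = (\<integral>\<^sup>+z. (\<integral>\<^sup>+w. ennreal (normal_density 0 \<tau> (z - w) * normal_density 0 \<sigma> w) \<partial>lborel) * g z \<partial>lborel)"
    by (subst nn_integral_multc[symmetric]) (auto simp: ennreal_mult' mult_ac)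
  also have "\<dots> = gauss_exp (sqrt (\<sigma>\<^sup>2 + \<tau>\<^sup>2)) g"
    using fun_cong[OF conv_normal_density_zero_mean[OF assms(3,2)]]
    by (simp add: gauss_exp_def add.commute)
  finally show ?thesis .
qed

lemma gauss_exp_square:
  assumes "s > 0" shows "gauss_exp s (\<lambda>z. ennreal (z\<^sup>2)) = ennreal (s\<^sup>2)"
proof -
  have *: "has_bochner_integral lborel (\<lambda>x. normal_density 0 s x * x ^ 2) (s\<^sup>2)"
    using normal_moment_even[OF assms, of 0 1] by (simp add: fact_numeral)
  show ?thesis unfolding gauss_exp_def
    using * assms
    by (subst ennreal_mult[symmetric])
       (auto simp: has_bochner_integral_iff nn_integral_eq_integral)
qed

lemma gauss_exp_power4:
  assumes "s > 0" shows "gauss_exp s (\<lambda>z. ennreal (z ^ 4)) = ennreal (3 * s ^ 4)"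
proof -
  have *: "has_bochner_integral lborel (\<lambda>x. normal_density 0 s x * x ^ 4) (3 * s ^ 4)"
    using normal_moment_even[OF assms, of 0 2] assms by (simp add: fact_numeral field_simps)
  show ?thesis unfolding gauss_exp_def
    using * assms
    by (subst ennreal_mult[symmetric])
       (auto simp: has_bochner_integral_iff nn_integral_eq_integral)
qed

text \<open>
  For \<open>b = 0\<close> and \<open>b = 1\<close> this is the expected number of rises, respectively drops, completed within
  time \<open>r\<close>, for a Brownian motion that currently is \<open>y\<close> below its running maximum and is waiting for a drop.
\<close>

definition potential :: "real \<Rightarrow> nat \<Rightarrow> real \<Rightarrow> real \<Rightarrow> ennreal" where
  "potential \<epsilon> b r y = (if r = 0 then levf \<epsilon> b y else gauss_exp (sqrt r) (\<lambda>z. levf \<epsilon> b (y + z)))"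

lemma gauss_exp_measurable [measurable]:
  assumes [measurable]: "g \<in> borel_measurable borel"
  shows "(\<lambda>y. gauss_exp s (\<lambda>z. g (y + z))) \<in> borel_measurable borel"
  unfolding gauss_exp_def by measurable

lemma potential_measurable [measurable]: "potential \<epsilon> b r \<in> borel_measurable borel"
proof -
  have "potential \<epsilon> b r = (if r = 0 then levf \<epsilon> b else (\<lambda>y. gauss_exp (sqrt r) (\<lambda>z. levf \<epsilon> b (y + z))))"
    by (auto simp: potential_def fun_eq_iff)
  then show ?thesis by simp
qed

lemma potential_minus [simp]: "potential \<epsilon> b r (- y) = potential \<epsilon> b r y"
proof -
  have "levf \<epsilon> b (z - y) = levf \<epsilon> b (y - z)" for z
    using levf_minus[of \<epsilon> b "z - y"] by simp
  then show ?thesis using gauss_exp_minus[of "\<lambda>z. levf \<epsilon> b (y + z)" "sqrt r"]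
    by (simp add: potential_def)
qed

lemma potential_abs: "potential \<epsilon> b r \<bar>y\<bar> = potential \<epsilon> b r y"
  by (auto simp: abs_if)

text \<open>Evenness reduces the claim to nonnegative arguments, where the rearrangement inequality
  of \<open>gauss_exp_mono_shift\<close> applies. This gives clipping at the extremum and overshoot
  of the threshold a definite sign.\<close>

lemma potential_mono:
  assumes "\<epsilon> > 0" "\<bar>y\<bar> \<le> \<bar>y'\<bar>" shows "potential \<epsilon> b r y \<le> potential \<epsilon> b r y'"
proof (cases "r = 0")
  case False
  have "potential \<epsilon> b r \<bar>y\<bar> \<le> potential \<epsilon> b r \<bar>y'\<bar>" unfolding potential_def using False assms
    by (auto intro!: gauss_exp_mono_shift levf_mono)
  then show ?thesis by (simp add: potential_abs)
qed (auto simp: potential_def intro: levf_mono assms)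

text \<open>Semigroup property of the heat flow. Remaining time 0 is a separate case throughout,
  because \<open>normal_density\<close> with deviation 0 is the zero function.\<close>

lemma potential_step:
  assumes "h > 0" "r \<ge> 0"
  shows "gauss_exp (sqrt h) (\<lambda>z. potential \<epsilon> b r (y + z)) = potential \<epsilon> b (r + h) y"
proof (cases "r = 0")
  case False
  then have "gauss_exp (sqrt h) (\<lambda>z. potential \<epsilon> b r (y + z)) =
     gauss_exp (sqrt h) (\<lambda>w. gauss_exp (sqrt r) (\<lambda>z. levf \<epsilon> b (y + (w + z))))"
    by (simp add: potential_def add.assoc)
  also have "\<dots> = gauss_exp (sqrt (r + h)) (\<lambda>z. levf \<epsilon> b (y + z))"
    using False assms gauss_exp_conv[of "\<lambda>z. levf \<epsilon> b (y + z)" "sqrt h" "sqrt r"]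
    by (simp add: add.commute)
  finally show ?thesis using assms by (simp add: potential_def)
qed (use assms in \<open>simp add: potential_def\<close>)

lemma AE_divide_notin_Ints:
  fixes \<epsilon> :: real
  assumes "\<epsilon> > 0" shows "AE z in lborel. z / \<epsilon> \<notin> \<int>"
proof -
  have "countable ((\<lambda>k. of_int k * \<epsilon>) ` UNIV)" by simp
  moreover have "z \<in> (\<lambda>k. of_int k * \<epsilon>) ` UNIV" if "z / \<epsilon> \<in> \<int>" for z
    using that assms by (auto elim!: Ints_cases simp: field_simps)
  ultimately show ?thesis
    by (intro AE_I'[of "(\<lambda>k. of_int k * \<epsilon>) ` UNIV"] countable_imp_null_set_lborel) auto
qed

text \<open>Symmetry of the Gaussian replaces the level function at \<epsilon> + z by its average
  over \<epsilon> + z and \<epsilon> - z, to which \<open>levf_average\<close> applies almost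
  everywhere. A swing thus earns \<open>b mod 2\<close> and restarts at distance 0 with the other
  parity.\<close>

lemma potential_boundary:
  assumes "\<epsilon> > 0" "r > 0"
  shows "potential \<epsilon> b r \<epsilon> = of_nat (b mod 2) + potential \<epsilon> (Suc b) r 0"
proof -
  have ae: "AE z in lborel. z / \<epsilon> \<notin> \<int>" by (rule AE_divide_notin_Ints[OF assms(1)])
  have "2 * potential \<epsilon> b r \<epsilon> = gauss_exp (sqrt r) (\<lambda>z. levf \<epsilon> b (\<epsilon> + z)) + gauss_exp (sqrt r) (\<lambda>z. levf \<epsilon> b (\<epsilon> - z))"
    using assms gauss_exp_minus[of "\<lambda>z. levf \<epsilon> b (\<epsilon> + z)" "sqrt r"] by (simp add: potential_def mult_2)
  also have "\<dots> = gauss_exp (sqrt r) (\<lambda>z. levf \<epsilon> b (\<epsilon> + z) + levf \<epsilon> b (\<epsilon> - z))"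
    by (subst gauss_exp_add) auto
  also have "\<dots> = gauss_exp (sqrt r) (\<lambda>z. 2 * (of_nat (b mod 2) + levf \<epsilon> (Suc b) z))"
    using ae levf_average[OF assms(1)] by (intro gauss_exp_cong_AE) auto
  also have "\<dots> = 2 * (of_nat (b mod 2) + potential \<epsilon> (Suc b) r 0)"
    using assms by (simp add: gauss_exp_cmult gauss_exp_add gauss_exp_const potential_def)
  finally have "2 * potential \<epsilon> b r \<epsilon> = 2 * (of_nat (b mod 2) + potential \<epsilon> (Suc b) r 0)" .
  then show ?thesis by (subst (asm) ennreal_mult_cancel_left) auto
qed

lemma potential_bound:
  assumes "\<epsilon> > 0" "r \<ge> 0"
  shows "potential \<epsilon> b r y \<le> ennreal (4 * (y\<^sup>2 + r) / \<epsilon>\<^sup>2 + 2)"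
proof -
  have b: "levf \<epsilon> b z \<le> ennreal (2 * z\<^sup>2 / \<epsilon>\<^sup>2 + 2)" for z
  proof -
    have "(\<bar>z\<bar> / \<epsilon> + 1)\<^sup>2 \<le> 2 * (\<bar>z\<bar> / \<epsilon>)\<^sup>2 + 2"
      using sum_squares_bound[of "\<bar>z\<bar> / \<epsilon>" 1] by (simp add: power2_sum)
    then have "(\<bar>z\<bar> / \<epsilon> + 1)\<^sup>2 \<le> 2 * z\<^sup>2 / \<epsilon>\<^sup>2 + 2" by (simp add: power_divide)
    then show ?thesis by (intro order_trans[OF levf_bound[OF assms(1)]] ennreal_leI)
  qed
  show ?thesis
  proof (cases "r = 0")
    case True
    have "2 * y\<^sup>2 / \<epsilon>\<^sup>2 + 2 \<le> 4 * (y\<^sup>2 + r) / \<epsilon>\<^sup>2 + 2"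
      using True assms by (simp add: divide_right_mono)
    then show ?thesis using b[of y] True unfolding potential_def by (auto intro: order_trans ennreal_leI)
  next
    case False
    then have r: "r > 0" using assms by simp
    have "potential \<epsilon> b r y = gauss_exp (sqrt r) (\<lambda>z. levf \<epsilon> b (y + z))"
      using False by (simp add: potential_def)
    also have "\<dots> \<le> gauss_exp (sqrt r) (\<lambda>z. ennreal (4 * y\<^sup>2 / \<epsilon>\<^sup>2 + 2) + ennreal (4 / \<epsilon>\<^sup>2) * ennreal (z\<^sup>2))"
    proof (rule gauss_exp_mono)
      fix z
      have "(y + z)\<^sup>2 \<le> 2 * y\<^sup>2 + 2 * z\<^sup>2" using sum_squares_bound[of y z] by (simp add: power2_sum)
      then have "2 * (y + z)\<^sup>2 / \<epsilon>\<^sup>2 + 2 \<le> 2 * (2 * y\<^sup>2 + 2 * z\<^sup>2) / \<epsilon>\<^sup>2 + 2"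
        by (intro add_right_mono divide_right_mono) auto
      then have "2 * (y + z)\<^sup>2 / \<epsilon>\<^sup>2 + 2 \<le> (4 * y\<^sup>2 / \<epsilon>\<^sup>2 + 2) + 4 / \<epsilon>\<^sup>2 * z\<^sup>2"
        by (simp add: algebra_simps add_divide_distrib)
      then have "ennreal (2 * (y + z)\<^sup>2 / \<epsilon>\<^sup>2 + 2) \<le> ennreal (4 * y\<^sup>2 / \<epsilon>\<^sup>2 + 2) + ennreal (4 / \<epsilon>\<^sup>2) * ennreal (z\<^sup>2)"
        by (subst ennreal_mult[symmetric], simp, simp, subst ennreal_plus[symmetric])
           (auto intro!: ennreal_leI simp del: ennreal_plus)
      then show "levf \<epsilon> b (y + z) \<le> ennreal (4 * y\<^sup>2 / \<epsilon>\<^sup>2 + 2) + ennreal (4 / \<epsilon>\<^sup>2) * ennreal (z\<^sup>2)"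
        using b[of "y + z"] by (rule order_trans[rotated])
    qed
    also have "\<dots> = ennreal (4 * y\<^sup>2 / \<epsilon>\<^sup>2 + 2) + ennreal (4 / \<epsilon>\<^sup>2) * ennreal r"
      using r by (simp add: gauss_exp_add gauss_exp_cmult gauss_exp_const gauss_exp_square)
    also have "\<dots> = ennreal (4 * (y\<^sup>2 + r) / \<epsilon>\<^sup>2 + 2)"
      using r by (subst ennreal_mult[symmetric], simp, simp, subst ennreal_plus[symmetric])
        (auto simp: algebra_simps add_divide_distrib)
    finally show ?thesis .
  qed
qed

section \<open>Swings of a Gaussian random walk\<close>

text \<open>For \<open>r > 0\<close> this is the boundary identity with monotonicity. At
  \<open>r = 0\<close> nothing has been smoothed, but for odd parity the level function jumps from 0
  to 2 at \<epsilon>, across the reward 1, so the inequalities on either side of \<epsilon>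
  survive.\<close>

lemma potential_boundary_le:
  assumes "\<epsilon> > 0" "r \<ge> 0" "y \<ge> \<epsilon>"
  shows "of_nat (j mod 2) + potential \<epsilon> (Suc j) r 0 \<le> potential \<epsilon> j r y"
proof (cases "r = 0")
  case True
  have "potential \<epsilon> (Suc j) r 0 = 0" using True assms by (simp add: potential_def levf_eq_0)
  moreover have "of_nat (j mod 2) \<le> levf \<epsilon> j y"
  proof (cases "even j")
    case False
    then have "levf \<epsilon> j = levf \<epsilon> 1" by (intro levf_cong) simp
    then show ?thesis using False assms levf_ge_1[of \<epsilon> y] by (simp add: odd_iff_mod_2_eq_one)
  qed auto
  ultimately show ?thesis using True by (simp add: potential_def)
next
  case False
  then show ?thesis using assms potential_boundary[of \<epsilon> r j] potential_mono[of \<epsilon> \<epsilon> y j r] by simp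
qed

lemma potential_boundary_ge:
  assumes "\<epsilon> > 0" "r \<ge> 0" "\<bar>y\<bar> < \<epsilon>"
  shows "potential \<epsilon> j r y \<le> of_nat (j mod 2) + potential \<epsilon> (Suc j) r 0"
proof (cases "r = 0")
  case True
  then show ?thesis using assms by (simp add: potential_def levf_eq_0)
next
  case False
  then show ?thesis using assms potential_boundary[of \<epsilon> r j] potential_mono[of \<epsilon> y \<epsilon> j r] by simp
qed

lemma Suc_div_2_eq: "Suc j div 2 = j div 2 + j mod 2"
  by presburger

text \<open>The offset \<open>b\<close> selects what is counted: with k swings,
  \<open>(b + k) div 2\<close> is the number of rises for \<open>b = 0\<close> and of drops for
  \<open>b = 1\<close>. The shift \<open>d\<close> is 0 in the upper bound and \<delta> in the lower
  one.\<close>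

definition state_potential :: "real \<Rightarrow> real \<Rightarrow> nat \<Rightarrow> real \<Rightarrow> nat \<times> real \<Rightarrow> ennreal" where
  "state_potential \<epsilon> r b d s = of_nat ((b + fst s) div 2) + potential \<epsilon> (b + fst s) r (snd s + d)"

lemma state_potential_measurable [measurable]:
  "state_potential \<epsilon> r b d \<in> borel_measurable (count_space UNIV \<Otimes>\<^sub>M borel)"
proof -
  have "(\<lambda>p. (b + fst p, snd p + d)) \<in> count_space (UNIV :: nat set) \<Otimes>\<^sub>M borel
     \<rightarrow>\<^sub>M count_space UNIV \<Otimes>\<^sub>M (borel :: real measure)"
    by measurable
  moreover have "(\<lambda>(j, y). of_nat (j div 2) + potential \<epsilon> j r y) \<in> borel_measurable (count_space UNIV \<Otimes>\<^sub>M borel)"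
    by (intro measurable_pair_measure_countable1) auto
  ultimately show ?thesis
    using measurable_compose[of "\<lambda>p. (b + fst p, snd p + d)" _ _ "\<lambda>(j, y). of_nat (j div 2) + potential \<epsilon> j r y"]
    by (simp add: state_potential_def[abs_def])
qed

lemma swing_step_measurable [measurable]:
  "(\<lambda>p. swing_step \<epsilon> (fst p) (snd p)) \<in>
     (count_space UNIV \<Otimes>\<^sub>M borel) \<Otimes>\<^sub>M borel \<rightarrow>\<^sub>M count_space UNIV \<Otimes>\<^sub>M borel"
proof -
  have [measurable]: "(\<lambda>p :: (nat \<times> real) \<times> real. (- 1 :: real) ^ fst (fst p)) \<in>
      borel_measurable ((count_space UNIV \<Otimes>\<^sub>M borel) \<Otimes>\<^sub>M borel)"
    by (rule measurable_compose[of "\<lambda>p. fst (fst p)" _ "count_space UNIV" "\<lambda>k. (- 1) ^ k"]) auto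
  show ?thesis unfolding swing_step_def Let_def by measurable
qed

lemma gauss_exp_sign:
  assumes "g \<in> borel_measurable borel"
  shows "gauss_exp s (\<lambda>z. g (y - (- 1) ^ k * z)) = gauss_exp s (\<lambda>z. g (y + z))"
  using assms gauss_exp_minus[of "\<lambda>z. g (y + z)" s] by (cases "even k") auto

text \<open>The actual step is dominated pointwise by the flow at the unclipped distance
  \<open>w\<close>: clipping lowers |w|, and a swing at \<open>w > \<epsilon>\<close> gains no more
  than the flow there by \<open>potential_boundary_le\<close>. Averaging the unclipped version is
  exactly one step of the heat semigroup.\<close>

lemma state_potential_super:
  assumes "\<epsilon> > 0" "h > 0" "r \<ge> 0" "0 \<le> y" "y \<le> \<epsilon>"
  shows "gauss_exp (sqrt h) (\<lambda>z. state_potential \<epsilon> r b 0 (swing_step \<epsilon> (k, y) z))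
    \<le> state_potential \<epsilon> (r + h) b 0 (k, y)"
proof -
  have "state_potential \<epsilon> r b 0 (swing_step \<epsilon> (k, y) z) \<le>
      of_nat ((b + k) div 2) + potential \<epsilon> (b + k) r (y - (- 1) ^ k * z)" for z
  proof -
    define w where "w = y - (- 1) ^ k * z"
    show ?thesis
    proof (cases "max w 0 > \<epsilon>")
      case True
      then have "w \<ge> \<epsilon>" using assms by (simp add: max_def split: if_splits)
      then show ?thesis using True potential_boundary_le[OF assms(1,3), of w "b + k"]
        by (simp add: swing_step_def Let_def w_def[symmetric] state_potential_def Suc_div_2_eq add.assoc add_left_mono)
    next
      case False
      have "\<bar>max w 0\<bar> \<le> \<bar>w\<bar>" by simp
      then show ?thesis using False potential_mono[OF assms(1)]
        by (simp add: swing_step_def Let_def w_def[symmetric] state_potential_def add_left_mono)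
    qed
  qed
  then have "gauss_exp (sqrt h) (\<lambda>z. state_potential \<epsilon> r b 0 (swing_step \<epsilon> (k, y) z))
    \<le> gauss_exp (sqrt h) (\<lambda>z. of_nat ((b + k) div 2) + potential \<epsilon> (b + k) r (y - (- 1) ^ k * z))"
    by (rule gauss_exp_mono)
  also have "\<dots> = of_nat ((b + k) div 2) + gauss_exp (sqrt h) (\<lambda>z. potential \<epsilon> (b + k) r (y - (- 1) ^ k * z))"
    using assms by (subst gauss_exp_add) (auto simp: gauss_exp_const)
  also have "\<dots> = state_potential \<epsilon> (r + h) b 0 (k, y)"
    using assms by (subst gauss_exp_sign) (auto simp: potential_step state_potential_def)
  finally show ?thesis .
qed

text \<open>
  On a time grid the running maximum is too small and swings overshoot \<open>\<epsilon>\<close>. Shifting the state by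
  \<open>\<delta>\<close> and enlarging \<open>\<epsilon>\<close> to \<open>\<epsilon> + 3 \<delta>\<close> makes up for increments of size at most \<open>\<delta>\<close>; larger ones
  are covered by the fourth moment.
\<close>

lemma state_potential_sub:
  assumes "\<epsilon> > 0" "\<delta> > 0" "h > 0" "0 \<le> r" "r \<le> t" "0 \<le> y" "y \<le> \<epsilon>"
  defines "\<epsilon>' \<equiv> \<epsilon> + 3 * \<delta>"
  defines "C \<equiv> (10 + 4 * t / \<epsilon>'\<^sup>2) / \<delta> ^ 4 + 8 / (\<epsilon>'\<^sup>2 * \<delta>\<^sup>2)"
  shows "state_potential \<epsilon>' (r + h) b \<delta> (k, y) \<le>
     gauss_exp (sqrt h) (\<lambda>z. state_potential \<epsilon>' r b \<delta> (swing_step \<epsilon> (k, y) z))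
     + ennreal (3 * C * h\<^sup>2)"
proof -
  have e': "\<epsilon>' > 0" using assms by simp
  have C: "C \<ge> 0" using assms by (simp add: C_def)
  have pt: "of_nat ((b + k) div 2) + potential \<epsilon>' (b + k) r (y + \<delta> - (- 1) ^ k * z) \<le>
      state_potential \<epsilon>' r b \<delta> (swing_step \<epsilon> (k, y) z)
      + ennreal (C * z ^ 4)" for z
  proof (cases "\<bar>z\<bar> \<le> \<delta>")
    case True
    define w where "w = y - (- 1) ^ k * z"
    have w: "- \<delta> \<le> w" "w \<le> \<epsilon> + \<delta>" using True assms by (cases "even k"; auto simp: w_def)+
    have eq: "y + \<delta> - (- 1) ^ k * z = w + \<delta>" by (simp add: w_def)
    have "of_nat ((b + k) div 2) + potential \<epsilon>' (b + k) r (w + \<delta>) \<le>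
      state_potential \<epsilon>' r b \<delta> (swing_step \<epsilon> (k, y) z)"
    proof (cases "max w 0 > \<epsilon>")
      case True
      \<comment> \<open>Here \<open>w \<le> \<epsilon> + \<delta>\<close>, so the shifted distance
        is at most \<epsilon> + 2 \<delta>, strictly below \<epsilon>'. Overshooting therefore never
        passes the enlarged threshold, and strictness serves the unsmoothed case
        \<open>r = 0\<close>.\<close>
      have "potential \<epsilon>' (b + k) r (w + \<delta>) \<le> of_nat ((b + k) mod 2) + potential \<epsilon>' (Suc (b + k)) r 0"
        using w assms by (intro potential_boundary_ge e') auto
      also have "\<dots> \<le> of_nat ((b + k) mod 2) + potential \<epsilon>' (Suc (b + k)) r \<delta>"
        using e' by (intro add_left_mono potential_mono) auto
      finally show ?thesis using True
        by (simp add: swing_step_def Let_def w_def[symmetric] state_potential_def Suc_div_2_eq add.assoc add_left_mono)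
    next
      case False
      \<comment> \<open>The purpose of the shift: since \<open>w \<ge> - \<delta>\<close>, the value
        \<open>w + \<delta>\<close> is nonnegative and clipping \<open>w\<close> at 0 only increases
        it.\<close>
      have "\<bar>w + \<delta>\<bar> \<le> \<bar>max w 0 + \<delta>\<bar>" using w assms by (auto simp: max_def)
      then show ?thesis using False potential_mono[OF e']
        by (simp add: swing_step_def Let_def w_def[symmetric] state_potential_def add_left_mono)
    qed
    then show ?thesis unfolding eq by (rule order_trans) simp
  next
    case False
    have "(y + \<delta> - (- 1) ^ k * z)\<^sup>2 \<le> 2 * (y + \<delta>)\<^sup>2 + 2 * z\<^sup>2"
    proof -
      have "(u + v)\<^sup>2 \<le> 2 * u\<^sup>2 + 2 * v\<^sup>2" for u v :: real
        using sum_squares_bound[of u v] by (simp add: power2_sum)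
      from this[of "y + \<delta>" z] this[of "y + \<delta>" "- z"] show ?thesis by (cases "even k") auto
    qed
    also have "(y + \<delta>)\<^sup>2 \<le> \<epsilon>'\<^sup>2" using assms by (intro power_mono) auto
    finally have "4 * ((y + \<delta> - (- 1) ^ k * z)\<^sup>2 + r) / \<epsilon>'\<^sup>2 + 2 \<le> 4 * (2 * \<epsilon>'\<^sup>2 + 2 * z\<^sup>2 + t) / \<epsilon>'\<^sup>2 + 2"
      using assms by (intro add_right_mono divide_right_mono) auto
    also have "\<dots> = (10 + 4 * t / \<epsilon>'\<^sup>2) + 8 / \<epsilon>'\<^sup>2 * z\<^sup>2"
      using e' by (simp add: field_simps)
    \<comment> \<open>A large increment has |z| > \<delta>, so both 1 and z^2 are at most multiples
      of z^4. The constant C collects the resulting factors, and the Gaussian mean of z^4 is 3 h^2,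
      which is small even after summation over all steps.\<close>
    also have "\<dots> \<le> (10 + 4 * t / \<epsilon>'\<^sup>2) * (z ^ 4 / \<delta> ^ 4) + 8 / \<epsilon>'\<^sup>2 * (z ^ 4 / \<delta>\<^sup>2)"
    proof (intro add_mono mult_left_mono)
      have z2: "\<delta>\<^sup>2 \<le> z\<^sup>2" using False assms by (metis abs_le_square_iff abs_of_pos linear)
      have "(\<delta>\<^sup>2)\<^sup>2 \<le> (z\<^sup>2)\<^sup>2" by (rule power_mono[OF z2]) simp
      then have "1 \<le> z ^ 4 / \<delta> ^ 4" using assms by (simp add: field_simps flip: power_mult)
      then show "10 + 4 * t / \<epsilon>'\<^sup>2 \<le> (10 + 4 * t / \<epsilon>'\<^sup>2) * (z ^ 4 / \<delta> ^ 4)"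
        using assms mult_left_mono[of 1 "z ^ 4 / \<delta> ^ 4" "10 + 4 * t / \<epsilon>'\<^sup>2"] by simp
      have "z\<^sup>2 * \<delta>\<^sup>2 \<le> z\<^sup>2 * z\<^sup>2" using z2 by (intro mult_left_mono) auto
      then show "z\<^sup>2 \<le> z ^ 4 / \<delta>\<^sup>2" using assms by (simp add: field_simps power2_eq_square power4_eq_xxxx)
    qed auto
    also have "\<dots> = C * z ^ 4" by (simp add: C_def algebra_simps add_divide_distrib)
    finally have "potential \<epsilon>' (b + k) r (y + \<delta> - (- 1) ^ k * z) \<le> ennreal (C * z ^ 4)"
      using potential_bound[OF e' \<open>0 \<le> r\<close>, of "b + k" "y + \<delta> - (- 1) ^ k * z"]
      by (meson ennreal_leI order_trans)
    moreover have "(b + k) div 2 \<le> (b + fst (swing_step \<epsilon> (k, y) z)) div 2"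
      by (intro div_le_mono) (auto simp: swing_step_def Let_def)
    then have "of_nat ((b + k) div 2) \<le> state_potential \<epsilon>' r b \<delta> (swing_step \<epsilon> (k, y) z)"
      unfolding state_potential_def by (metis add_increasing2 of_nat_mono zero_le)
    ultimately show ?thesis by (rule add_mono[rotated])
  qed
  have [measurable]: "swing_step \<epsilon> (k, y) \<in> borel \<rightarrow>\<^sub>M count_space UNIV \<Otimes>\<^sub>M borel"
    using measurable_compose[OF _ swing_step_measurable, of "\<lambda>z. ((k, y), z)" borel \<epsilon>] by simp
  have [measurable]: "(\<lambda>z. state_potential \<epsilon>' r b \<delta> (swing_step \<epsilon> (k, y) z))
     \<in> borel_measurable borel"
    by (rule measurable_compose[OF _ state_potential_measurable]) measurable
  have "state_potential \<epsilon>' (r + h) b \<delta> (k, y) =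
      of_nat ((b + k) div 2) + gauss_exp (sqrt h) (\<lambda>z. potential \<epsilon>' (b + k) r (y + \<delta> - (- 1) ^ k * z))"
    using assms by (subst gauss_exp_sign) (auto simp: potential_step state_potential_def)
  also have "\<dots> = gauss_exp (sqrt h) (\<lambda>z. of_nat ((b + k) div 2) + potential \<epsilon>' (b + k) r (y + \<delta> - (- 1) ^ k * z))"
    using assms by (subst gauss_exp_add) (auto simp: gauss_exp_const)
  also have "\<dots> \<le> gauss_exp (sqrt h) (\<lambda>z. state_potential \<epsilon>' r b \<delta> (swing_step \<epsilon> (k, y) z)
      + ennreal C * ennreal (z ^ 4))"
    using pt C by (intro gauss_exp_mono) (simp add: ennreal_mult)
  also have "\<dots> = gauss_exp (sqrt h) (\<lambda>z. state_potential \<epsilon>' r b \<delta> (swing_step \<epsilon> (k, y) z))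
      + ennreal C * ennreal (3 * sqrt h ^ 4)"
    using assms by (subst gauss_exp_add) (auto simp: gauss_exp_cmult gauss_exp_power4)
  also have "sqrt h ^ 4 = h\<^sup>2" using assms power_mult[of "sqrt h" 2 2] by simp
  also have "ennreal C * ennreal (3 * h\<^sup>2) = ennreal (3 * C * h\<^sup>2)"
    using C by (subst ennreal_mult[symmetric]) (auto simp: mult_ac)
  finally show ?thesis .
qed

text \<open>Fubini in the form in which independence arrives: \<open>U\<close> and \<open>V\<close>
  are blocks of increments in product spaces, while \<open>F\<close> computes the present state from
  the past block and \<open>G\<close> extracts the next increment.\<close>

lemma (in prob_space) nn_integral_indep_gauss:
  assumes ind: "indep_var S U T V" and [measurable]: "F \<in> S \<rightarrow>\<^sub>M S'" "G \<in> borel_measurable T"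
    and Y: "distributed M lborel (\<lambda>w. G (V w)) (normal_density 0 s)"
    and [measurable]: "g \<in> borel_measurable (S' \<Otimes>\<^sub>M borel)"
  shows "(\<integral>\<^sup>+w. g (F (U w), G (V w)) \<partial>M) = (\<integral>\<^sup>+w. gauss_exp s (\<lambda>z. g (F (U w), z)) \<partial>M)"
proof -
  have [measurable]: "U \<in> M \<rightarrow>\<^sub>M S" "V \<in> M \<rightarrow>\<^sub>M T" using ind by (auto simp: indep_var_distribution_eq)
  interpret D: prob_space "distr M T V" by (rule prob_space_distr) simp
  have dY: "distr M borel (\<lambda>w. G (V w)) = density lborel (\<lambda>z. ennreal (normal_density 0 s z))"
    using distributed_distr_eq_density[OF Y] by (metis distr_cong sets_lborel)
  have "(\<integral>\<^sup>+w. g (F (U w), G (V w)) \<partial>M) =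
      (\<integral>\<^sup>+p. g (F (fst p), G (snd p)) \<partial>distr M (S \<Otimes>\<^sub>M T) (\<lambda>w. (U w, V w)))"
    by (subst nn_integral_distr) auto
  also have "\<dots> = (\<integral>\<^sup>+p. g (F (fst p), G (snd p)) \<partial>(distr M S U \<Otimes>\<^sub>M distr M T V))"
    using ind by (simp add: indep_var_distribution_eq)
  also have "\<dots> = (\<integral>\<^sup>+u. \<integral>\<^sup>+v. g (F u, G v) \<partial>distr M T V \<partial>distr M S U)"
    by (subst D.nn_integral_fst[symmetric]) auto
  also have "\<dots> = (\<integral>\<^sup>+w. \<integral>\<^sup>+v. g (F (U w), G v) \<partial>distr M T V \<partial>M)"
    by (subst nn_integral_distr) auto
  also have "\<dots> = (\<integral>\<^sup>+w. gauss_exp s (\<lambda>z. g (F (U w), z)) \<partial>M)"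
  proof (rule nn_integral_cong)
    fix w assume "w \<in> space M"
    then have "F (U w) \<in> space S'" by (meson assms(2) \<open>U \<in> M \<rightarrow>\<^sub>M S\<close> measurable_space)
    then have [measurable]: "(\<lambda>z. g (F (U w), z)) \<in> borel_measurable borel" by measurable
    have "(\<integral>\<^sup>+v. g (F (U w), G v) \<partial>distr M T V) = (\<integral>\<^sup>+z. g (F (U w), z) \<partial>distr M borel (\<lambda>w. G (V w)))"
      by (simp add: nn_integral_distr)
    also have "\<dots> = gauss_exp s (\<lambda>z. g (F (U w), z))"
      unfolding dY gauss_exp_def by (subst nn_integral_density) auto
    finally show "(\<integral>\<^sup>+v. g (F (U w), G v) \<partial>distr M T V) = gauss_exp s (\<lambda>z. g (F (U w), z))" .
  qed
  finally show ?thesis .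
qed

lemma swing_state_cong:
  "(\<And>i. i < n \<Longrightarrow> x (Suc i) - x i = x' (Suc i) - x' i) \<Longrightarrow> swing_state \<epsilon> x n = swing_state \<epsilon> x' n"
  by (induction n) auto

lemma swing_state_sum_measurable:
  assumes "m \<le> n"
  shows "(\<lambda>v. swing_state \<epsilon> (\<lambda>i. \<Sum>j<i. v j) m) \<in> (\<Pi>\<^sub>M i\<in>{..<n}. borel) \<rightarrow>\<^sub>M count_space UNIV \<Otimes>\<^sub>M borel"
  using assms
proof (induction m)
  case (Suc m)
  have [measurable]: "(\<lambda>v. v m) \<in> borel_measurable (\<Pi>\<^sub>M i\<in>{..<n}. (borel :: real measure))"
    using Suc.prems by (intro measurable_component_singleton) auto
  have [measurable]: "(\<lambda>v. swing_state \<epsilon> (\<lambda>i. \<Sum>j<i. v j) m) \<in> (\<Pi>\<^sub>M i\<in>{..<n}. borel) \<rightarrow>\<^sub>M count_space UNIV \<Otimes>\<^sub>M borel"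
    using Suc by simp
  have "(\<lambda>v. (swing_state \<epsilon> (\<lambda>i. \<Sum>j<i. v j) m, v m)) \<in>
      (\<Pi>\<^sub>M i\<in>{..<n}. borel) \<rightarrow>\<^sub>M (count_space UNIV \<Otimes>\<^sub>M borel) \<Otimes>\<^sub>M borel"
    by measurable
  from measurable_compose[OF this swing_step_measurable, of \<epsilon>] show ?case by simp
qed simp

section \<open>Martingale bounds for the swing count of a Gaussian walk\<close>

locale gaussian_walk = prob_space M for M :: "'a measure" +
  fixes X :: "nat \<Rightarrow> 'a \<Rightarrow> real" and h :: real and n :: nat
  assumes indep: "indep_vars (\<lambda>_. borel) (\<lambda>i w. X (Suc i) w - X i w) {..<n}"
    and normal: "\<And>i. i < n \<Longrightarrow>
      distributed M lborel (\<lambda>w. X (Suc i) w - X i w) (normal_density 0 (sqrt h))"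
    and h_pos: "h > 0"
begin

definition state :: "real \<Rightarrow> nat \<Rightarrow> 'a \<Rightarrow> nat \<times> real" where
  "state \<epsilon> m w = swing_state \<epsilon> (\<lambda>i. X i w) m"

text \<open>The state depends on the path only through its first \<open>m\<close> increments. This
  makes it a measurable function of a block of independent variables, hence independent of the next
  increment.\<close>

lemma state_eq_sum:
  "state \<epsilon> m w = swing_state \<epsilon> (\<lambda>i. \<Sum>j<i. (\<lambda>i\<in>{..<m}. X (Suc i) w - X i w) j) m"
  unfolding state_def by (rule swing_state_cong) auto

lemma state_measurable:
  assumes "m \<le> n" shows "state \<epsilon> m \<in> M \<rightarrow>\<^sub>M count_space UNIV \<Otimes>\<^sub>M borel"
proof -
  have "(\<lambda>w. \<lambda>i\<in>{..<m}. X (Suc i) w - X i w) \<in> M \<rightarrow>\<^sub>M (\<Pi>\<^sub>M i\<in>{..<m}. borel)"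
    using indep assms by (intro measurable_restrict) (auto simp: indep_vars_def)
  from measurable_compose[OF this swing_state_sum_measurable[of m m \<epsilon>]]
  show ?thesis unfolding state_eq_sum[abs_def] by simp
qed

lemma count_measurable [measurable]:
  assumes "m \<le> n" shows "(\<lambda>w. fst (state \<epsilon> m w)) \<in> M \<rightarrow>\<^sub>M count_space UNIV"
  using measurable_compose[OF state_measurable[OF assms] measurable_fst] .

lemma nn_integral_state_Suc:
  assumes "m < n" and [measurable]: "g \<in> borel_measurable (count_space UNIV \<Otimes>\<^sub>M borel)"
  shows "(\<integral>\<^sup>+w. g (state \<epsilon> (Suc m) w) \<partial>M) =
    (\<integral>\<^sup>+w. gauss_exp (sqrt h) (\<lambda>z. g (swing_step \<epsilon> (state \<epsilon> m w) z)) \<partial>M)"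
proof -
  let ?U = "\<lambda>w. \<lambda>i\<in>{..<m}. X (Suc i) w - X i w" and ?V = "\<lambda>w. \<lambda>i\<in>{m}. X (Suc i) w - X i w"
  have "indep_var (\<Pi>\<^sub>M i\<in>{..<m}. borel) ?U (\<Pi>\<^sub>M i\<in>{m}. borel) ?V"
    using assms by (intro indep_var_restrict[OF indep]) auto
  moreover have "(\<lambda>v. v m) \<in> borel_measurable (\<Pi>\<^sub>M i\<in>{m}. (borel :: real measure))"
    by (intro measurable_component_singleton) auto
  moreover have "(\<lambda>p. g (swing_step \<epsilon> (fst p) (snd p))) \<in> borel_measurable ((count_space UNIV \<Otimes>\<^sub>M borel) \<Otimes>\<^sub>M borel)"
    by measurable
  moreover have "distributed M lborel (\<lambda>w. ?V w m) (normal_density 0 (sqrt h))"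
    using normal[OF assms(1)] by simp
  ultimately have "(\<integral>\<^sup>+w. g (swing_step \<epsilon> (state \<epsilon> m w) (?V w m)) \<partial>M) =
    (\<integral>\<^sup>+w. gauss_exp (sqrt h) (\<lambda>z. g (swing_step \<epsilon> (state \<epsilon> m w) z)) \<partial>M)"
    unfolding state_eq_sum
    by (subst nn_integral_indep_gauss[where F = "\<lambda>v. swing_state \<epsilon> (\<lambda>i. \<Sum>j<i. v j) m" and G = "\<lambda>v. v m"
          and U = ?U and V = ?V and s = "sqrt h" and g = "\<lambda>p. g (swing_step \<epsilon> (fst p) (snd p))", simplified fst_conv snd_conv])
       (auto intro: swing_state_sum_measurable)
  then show ?thesis by (simp add: state_def)
qed

text \<open>The supermartingale with remaining time (n - m) h decreases in mean from step 0 to step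
  n; the nonnegative potential left at the end is discarded.\<close>

lemma expected_count_le:
  assumes "\<epsilon> > 0"
  shows "(\<integral>\<^sup>+w. of_nat ((b + fst (state \<epsilon> n w)) div 2) \<partial>M) \<le> state_potential \<epsilon> (real n * h) b 0 (0, 0)"
proof -
  have "(\<integral>\<^sup>+w. state_potential \<epsilon> (real (n - m) * h) b 0 (state \<epsilon> m w) \<partial>M)
     \<le> state_potential \<epsilon> (real n * h) b 0 (0, 0)" if "m \<le> n" for m
    using that
  proof (induction m)
    case 0
    then show ?case by (simp add: state_def emeasure_space_1)
  next
    case (Suc m)
    define r where "r = real (n - Suc m) * h"
    have "r \<ge> 0" using h_pos by (simp add: r_def)
    moreover have "real (n - m) * h = r + h" using Suc.prems by (simp add: r_def of_nat_diff algebra_simps)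
    ultimately have r: "r \<ge> 0" "real (n - m) * h = r + h" by auto
    have "(\<integral>\<^sup>+w. state_potential \<epsilon> r b 0 (state \<epsilon> (Suc m) w) \<partial>M)
      = (\<integral>\<^sup>+w. gauss_exp (sqrt h) (\<lambda>z. state_potential \<epsilon> r b 0 (swing_step \<epsilon> (state \<epsilon> m w) z)) \<partial>M)"
      using Suc.prems nn_integral_state_Suc[of m "state_potential \<epsilon> r b 0"] by simp
    also have "\<dots> \<le> (\<integral>\<^sup>+w. state_potential \<epsilon> (r + h) b 0 (state \<epsilon> m w) \<partial>M)"
    proof (intro nn_integral_mono)
      fix w
      show "gauss_exp (sqrt h) (\<lambda>z. state_potential \<epsilon> r b 0 (swing_step \<epsilon> (state \<epsilon> m w) z)) \<le> state_potential \<epsilon> (r + h) b 0 (state \<epsilon> m w)"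
        using state_potential_super[OF assms h_pos r(1), of "snd (state \<epsilon> m w)" b "fst (state \<epsilon> m w)"]
          swing_state_bounds[of \<epsilon> "\<lambda>i. X i w" m] assms by (simp add: state_def)
    qed
    also have "\<dots> \<le> state_potential \<epsilon> (real n * h) b 0 (0, 0)" using Suc r by simp
    finally show ?case by (simp add: r_def)
  qed
  from this[of n] have "(\<integral>\<^sup>+w. state_potential \<epsilon> 0 b 0 (state \<epsilon> n w) \<partial>M)
     \<le> state_potential \<epsilon> (real n * h) b 0 (0, 0)" by simp
  then show ?thesis
    by (rule order_trans[rotated]) (auto intro!: nn_integral_mono simp: state_potential_def)
qed

text \<open>The one-step inequality is summed over n steps, for a total error 3 C h^2 n. Nothing is
  lost at the end: the final shifted distance is at most \<epsilon> + \<delta> < \<epsilon>', where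
  the level function vanishes.\<close>

lemma expected_count_ge:
  assumes "\<epsilon> > 0" "\<delta> > 0"
  defines "\<epsilon>' \<equiv> \<epsilon> + 3 * \<delta>"
  defines "C \<equiv> (10 + 4 * (real n * h) / \<epsilon>'\<^sup>2) / \<delta> ^ 4 + 8 / (\<epsilon>'\<^sup>2 * \<delta>\<^sup>2)"
  shows "potential \<epsilon>' b (real n * h) 0 \<le>
    (\<integral>\<^sup>+w. of_nat ((b + fst (state \<epsilon> n w)) div 2) \<partial>M) + ennreal (3 * C * h\<^sup>2 * real n)"
proof -
  have e': "\<epsilon>' > 0" using assms by simp
  have C: "C \<ge> 0" using assms h_pos by (simp add: C_def)
  have "state_potential \<epsilon>' (real n * h) b \<delta> (0, 0) \<le>
    (\<integral>\<^sup>+w. state_potential \<epsilon>' (real (n - m) * h) b \<delta> (state \<epsilon> m w) \<partial>M)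
     + ennreal (3 * C * h\<^sup>2 * real m)" if "m \<le> n" for m
    using that
  proof (induction m)
    case 0
    then show ?case by (simp add: state_def emeasure_space_1)
  next
    case (Suc m)
    define r where "r = real (n - Suc m) * h"
    let ?g = "\<lambda>w. gauss_exp (sqrt h) (\<lambda>z. state_potential \<epsilon>' r b \<delta> (swing_step \<epsilon> (state \<epsilon> m w) z))"
    have "r \<ge> 0" using h_pos by (simp add: r_def)
    moreover have "real (n - m) * h = r + h" using Suc.prems by (simp add: r_def of_nat_diff algebra_simps)
    moreover have "r \<le> real n * h" unfolding r_def using h_pos by (intro mult_right_mono) auto
    ultimately have r: "r \<ge> 0" "real (n - m) * h = r + h" "r \<le> real n * h" by auto
    have "state_potential \<epsilon>' (real n * h) b \<delta> (0, 0) \<le>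
      (\<integral>\<^sup>+w. state_potential \<epsilon>' (r + h) b \<delta> (state \<epsilon> m w) \<partial>M) + ennreal (3 * C * h\<^sup>2 * real m)"
      using Suc r by simp
    also have "(\<integral>\<^sup>+w. state_potential \<epsilon>' (r + h) b \<delta> (state \<epsilon> m w) \<partial>M) \<le>
      (\<integral>\<^sup>+w. ?g w + ennreal (3 * C * h\<^sup>2) \<partial>M)"
    proof (intro nn_integral_mono)
      fix w
      show "state_potential \<epsilon>' (r + h) b \<delta> (state \<epsilon> m w) \<le>
         ?g w + ennreal (3 * C * h\<^sup>2)"
        using state_potential_sub[OF assms(1,2) h_pos r(1,3), of "snd (state \<epsilon> m w)" b "fst (state \<epsilon> m w)"]
          swing_state_bounds[of \<epsilon> "\<lambda>i. X i w" m] assms by (simp add: state_def)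
    qed
    also have "\<dots> = (\<integral>\<^sup>+w. ?g w \<partial>M) + ennreal (3 * C * h\<^sup>2)"
    proof (subst nn_integral_add)
      have "(\<lambda>s. gauss_exp (sqrt h) (\<lambda>z. state_potential \<epsilon>' r b \<delta> (swing_step \<epsilon> s z)))
          \<in> borel_measurable (count_space UNIV \<Otimes>\<^sub>M borel)"
      proof -
        have [measurable]: "(\<lambda>p. state_potential \<epsilon>' r b \<delta> (swing_step \<epsilon> (fst p) (snd p)))
            \<in> borel_measurable ((count_space UNIV \<Otimes>\<^sub>M borel) \<Otimes>\<^sub>M borel)"
          by (rule measurable_compose[OF swing_step_measurable state_potential_measurable])
        show ?thesis unfolding gauss_exp_def by measurable
      qed
      then show "(\<lambda>w. ?g w) \<in> borel_measurable M"
        using Suc.prems by (intro measurable_compose[OF state_measurable[of m]]) auto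
    qed (auto simp: emeasure_space_1)
    finally have "state_potential \<epsilon>' (real n * h) b \<delta> (0, 0) \<le>
      (\<integral>\<^sup>+w. ?g w \<partial>M) + ennreal (3 * C * h\<^sup>2)
      + ennreal (3 * C * h\<^sup>2 * real m)" by (simp add: add_right_mono)
    moreover have "(\<integral>\<^sup>+w. ?g w \<partial>M) =
       (\<integral>\<^sup>+w. state_potential \<epsilon>' r b \<delta> (state \<epsilon> (Suc m) w) \<partial>M)"
      using Suc.prems nn_integral_state_Suc[of m "state_potential \<epsilon>' r b \<delta>"] by simp
    moreover have "ennreal (3 * C * h\<^sup>2 * real (Suc m)) = ennreal (3 * C * h\<^sup>2) + ennreal (3 * C * h\<^sup>2 * real m)"
      using C by (subst ennreal_plus[symmetric]) (auto simp: algebra_simps)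
    ultimately show ?case by (simp add: r_def add.assoc)
  qed
  from this[of n] have "state_potential \<epsilon>' (real n * h) b \<delta> (0, 0) \<le>
    (\<integral>\<^sup>+w. state_potential \<epsilon>' 0 b \<delta> (state \<epsilon> n w) \<partial>M)
     + ennreal (3 * C * h\<^sup>2 * real n)" by simp
  moreover have "state_potential \<epsilon>' 0 b \<delta> (state \<epsilon> n w) =
      of_nat ((b + fst (state \<epsilon> n w)) div 2)" for w
    using swing_state_bounds[of \<epsilon> "\<lambda>i. X i w" n] assms
    by (simp add: state_potential_def potential_def state_def levf_eq_0)
  moreover have "potential \<epsilon>' b (real n * h) 0 \<le> state_potential \<epsilon>' (real n * h) b \<delta> (0, 0)"
    using potential_mono[OF e', of 0 \<delta> b] unfolding state_potential_def by (simp add: add_increasing)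
  ultimately show ?thesis by simp
qed

end

section \<open>Swings of a continuous path\<close>

text \<open>Sign flips turn rises into drops, so the mutual recursion of \<open>T_time\<close> and
  \<open>S_time\<close> becomes one sequence, with \<open>S_time\<close> at the even
  indices.\<close>

primrec swing_time :: "(real \<Rightarrow> real) \<Rightarrow> real \<Rightarrow> nat \<Rightarrow> ereal" where
  "swing_time x \<epsilon> 0 = 0"
| "swing_time x \<epsilon> (Suc m) = drop_time (\<lambda>u. (- 1) ^ m * x u) \<epsilon> (swing_time x \<epsilon> m)"

lemma Inf_image_eq_Sup_minus: "Inf (f ` S) = - Sup ((\<lambda>u. - f u :: real) ` S)"
  by (simp add: Inf_real_def image_image)

lemma rise_time_eq: "rise_time x \<epsilon> a = drop_time (\<lambda>u. - x u) \<epsilon> a"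
  by (simp add: rise_time_def drop_time_def Inf_image_eq_Sup_minus add.commute)

lemma S_time_eq: "S_time x \<epsilon> j = swing_time x \<epsilon> (2 * j)"
  by (induction j) (auto simp: rise_time_eq)

lemma continuous_Sup_attained:
  fixes x :: "real \<Rightarrow> real"
  assumes "continuous_on {0..} x" "0 \<le> a" "a \<le> u"
  obtains s where "a \<le> s" "s \<le> u" "Sup (x ` {a..u}) = x s" "\<And>r. a \<le> r \<Longrightarrow> r \<le> u \<Longrightarrow> x r \<le> x s"
proof -
  have "continuous_on {a..u} x" using assms by (intro continuous_on_subset[OF assms(1)]) auto
  then obtain s where s: "s \<in> {a..u}" "\<forall>r\<in>{a..u}. x r \<le> x s"
    using continuous_attains_sup[of "{a..u}" x] assms by auto
  then have "Sup (x ` {a..u}) = x s" by (intro cSup_eq_maximum) auto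
  then show ?thesis using s that by auto
qed

lemma drop_time_le:
  fixes x :: "real \<Rightarrow> real"
  assumes "continuous_on {0..} x" "0 \<le> a" "a \<le> ereal s" "s \<le> u" "x s - x u > \<epsilon>"
  shows "drop_time x \<epsilon> a \<le> ereal u"
proof -
  obtain a' where a: "a = ereal a'" "0 \<le> a'" using assms by (cases a) auto
  have eq: "{r. a \<le> ereal r \<and> r \<le> u} = {a'..u}" using a by auto
  obtain s' where "Sup (x ` {a'..u}) = x s'" "\<And>r. a' \<le> r \<Longrightarrow> r \<le> u \<Longrightarrow> x r \<le> x s'"
    using continuous_Sup_attained[OF assms(1) a(2), of u] assms a by auto
  then have "Sup (x ` {r. a \<le> ereal r \<and> r \<le> u}) - x u > \<epsilon>"
    unfolding eq using assms a by (metis diff_right_mono ereal_less_eq(3) less_le_trans)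
  then show ?thesis unfolding drop_time_def using assms a
    by (intro Inf_lower imageI) auto
qed

lemma drop_time_ge: "drop_time x \<epsilon> a \<ge> a"
  unfolding drop_time_def by (rule Inf_greatest) auto

text \<open>The defining inequality is strict and may fail at the infimum itself; continuity leaves
  the weak one. If every drop ending at p were smaller than \<epsilon>, the same would hold on an
  interval to the right of p, contradicting the infimum.\<close>

lemma drop_time_attained:
  fixes x :: "real \<Rightarrow> real"
  assumes x: "continuous_on {0..} x" and a: "0 \<le> a" and p: "drop_time x \<epsilon> (ereal a) = ereal p" and e: "\<epsilon> > 0"
  shows "\<exists>s\<ge>a. s \<le> p \<and> x s - x p \<ge> \<epsilon>"
proof (rule ccontr)
  assume no: "\<not> ?thesis"
  define A where "A = {u. ereal a \<le> ereal u \<and> Sup (x ` {r. ereal a \<le> ereal r \<and> r \<le> u}) - x u > \<epsilon>}"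
  have p_Inf: "ereal p = Inf (ereal ` A)" using p by (simp add: drop_time_def A_def)
  have ap: "a \<le> p" using drop_time_ge[of "ereal a" x \<epsilon>] p by simp
  obtain s where s: "a \<le> s" "s \<le> p" "\<And>r. a \<le> r \<Longrightarrow> r \<le> p \<Longrightarrow> x r \<le> x s"
    using continuous_Sup_attained[OF x a ap] by metis
  \<comment> \<open>With oscillation below \<eta> near p, a drop ending shortly after p is less than
    the larger of x s - x p + \<eta> (maximum before p) and 2 \<eta> (maximum after p). The choice
    of \<eta> keeps both at most \<epsilon>.\<close>
  define \<eta> where "\<eta> = min (\<epsilon> - (x s - x p)) \<epsilon> / 2"
  have "x s - x p < \<epsilon>" using no s by (meson not_le)
  then have "\<eta> > 0" "\<eta> \<le> (\<epsilon> - (x s - x p)) / 2" "\<eta> \<le> \<epsilon> / 2"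
    using e by (auto simp: \<eta>_def intro!: divide_right_mono)
  then have \<eta>: "\<eta> > 0" "x s - x p + 2 * \<eta> \<le> \<epsilon>" "2 * \<eta> \<le> \<epsilon>" by (simp_all add: field_simps)
  obtain \<rho> where \<rho>: "\<rho> > 0" "\<And>u. u \<ge> 0 \<Longrightarrow> \<bar>u - p\<bar> < \<rho> \<Longrightarrow> \<bar>x u - x p\<bar> < \<eta>"
    using x[unfolded continuous_on_iff, rule_format, of p \<eta>] \<eta> a ap by (auto simp: dist_real_def)
  have "p + \<rho> \<le> u" if u: "u \<in> A" for u
  proof (rule ccontr)
    assume "\<not> p + \<rho> \<le> u"
    moreover have "p \<le> u" using u p_Inf by (metis Inf_lower ereal_less_eq(3) imageI)
    ultimately have near: "\<bar>x r - x p\<bar> < \<eta>" if "p \<le> r" "r \<le> u" for r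
      using \<rho>(2)[of r] that a ap by auto
    have "Sup (x ` {a..u}) \<le> max (x s) (x p + \<eta>)"
    proof (rule cSup_least)
      show "x ` {a..u} \<noteq> {}" using ap \<open>p \<le> u\<close> by auto
      fix z assume "z \<in> x ` {a..u}"
      then obtain r where r: "z = x r" "a \<le> r" "r \<le> u" by auto
      show "z \<le> max (x s) (x p + \<eta>)"
      proof (cases "r \<le> p")
        case True
        then show ?thesis using s r by (simp add: le_max_iff_disj)
      next
        case False
        then show ?thesis using near[of r] r by (simp add: le_max_iff_disj abs_less_iff)
      qed
    qed
    moreover have "{r. ereal a \<le> ereal r \<and> r \<le> u} = {a..u}" by auto
    then have "Sup (x ` {a..u}) - x u > \<epsilon>" using u by (simp add: A_def)
    ultimately show False using near[of u] \<open>p \<le> u\<close> \<eta> by (auto simp: max_def split: if_splits)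
  qed
  then have "ereal (p + \<rho>) \<le> Inf (ereal ` A)" by (intro Inf_greatest) auto
  then show False using p_Inf \<rho> by (metis ereal_less_eq(3) less_add_same_cancel1 not_le)
qed

lemma swing_time_nonneg: "0 \<le> swing_time x \<epsilon> m"
  by (induction m) (auto intro: order_trans[OF _ drop_time_ge])

text \<open>The invariant carries the time \<open>s\<close> of the grid extremum since the last grid
  swing. It is not earlier than the corresponding \<open>swing_time\<close>, so a grid move
  exceeding \<epsilon> from \<open>s\<close> completes a swing of the path as well. Grid counts
  therefore never exceed those of the path.\<close>

lemma swing_count_le_time:
  fixes x :: "real \<Rightarrow> real"
  assumes x: "continuous_on {0..} x" and "\<epsilon> \<ge> 0" "h \<ge> 0"
  shows "\<exists>s. swing_time x \<epsilon> (fst (swing_state \<epsilon> (\<lambda>i. x (real i * h)) i)) \<le> ereal s \<and> s \<le> real i * h \<and>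
     snd (swing_state \<epsilon> (\<lambda>i. x (real i * h)) i) =
       (- 1) ^ fst (swing_state \<epsilon> (\<lambda>i. x (real i * h)) i) * (x s - x (real i * h))"
proof (induction i)
  case 0
  then show ?case by (auto intro!: exI[of _ 0] simp: zero_ereal_def)
next
  case (Suc i)
  define k y where "k = fst (swing_state \<epsilon> (\<lambda>i. x (real i * h)) i)"
    and "y = snd (swing_state \<epsilon> (\<lambda>i. x (real i * h)) i)"
  obtain s where s: "swing_time x \<epsilon> k \<le> ereal s" "s \<le> real i * h" "y = (- 1) ^ k * (x s - x (real i * h))"
    using Suc unfolding k_def y_def by blast
  define u where "u = real (Suc i) * h"
  have iu: "real i * h \<le> u" using assms by (simp add: u_def mult_right_mono)
  define y' where "y' = max (y - (- 1) ^ k * (x u - x (real i * h))) 0"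
  have st: "swing_state \<epsilon> (\<lambda>i. x (real i * h)) (Suc i) = (if y' > \<epsilon> then (Suc k, 0) else (k, y'))"
    by (simp add: swing_step_def Let_def k_def y_def y'_def u_def)
  have "\<exists>r. swing_time x \<epsilon> k \<le> ereal r \<and> r \<le> u \<and> y' = (- 1) ^ k * (x r - x u)"
  proof (cases "y - (- 1) ^ k * (x u - x (real i * h)) \<ge> 0")
    case True
    then have "y' = (- 1) ^ k * (x s - x u)" by (simp add: y'_def s(3) algebra_simps)
    then show ?thesis using s iu by (intro exI[of _ s]) auto
  next
    case False
    have "ereal s \<le> ereal u" using s(2) iu by simp
    with False show ?thesis using s(1) by (intro exI[of _ u]) (auto simp: y'_def intro: order_trans)
  qed
  then obtain r where r: "swing_time x \<epsilon> k \<le> ereal r" "r \<le> u" "y' = (- 1) ^ k * (x r - x u)" by blast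
  show ?case
  proof (cases "y' > \<epsilon>")
    case True
    have "continuous_on {0..} (\<lambda>u. (- 1) ^ k * x u)" by (intro continuous_intros x)
    then have "swing_time x \<epsilon> (Suc k) \<le> ereal u"
      using drop_time_le[of "\<lambda>u. (- 1) ^ k * x u" "swing_time x \<epsilon> k" r u \<epsilon>] r True swing_time_nonneg
      by (simp add: algebra_simps)
    then show ?thesis unfolding st u_def[symmetric] using True by auto
  next
    case False
    then show ?thesis unfolding st u_def[symmetric] using r by auto
  qed
qed

lemma floor_grid:
  fixes h u :: real
  assumes "0 \<le> u" "0 < h"
  shows "real (nat \<lfloor>u / h\<rfloor>) * h \<le> u" "u \<le> real (nat \<lfloor>u / h\<rfloor>) * h + h"
proof -
  have "real (nat \<lfloor>u / h\<rfloor>) \<le> u / h" "u / h < real (nat \<lfloor>u / h\<rfloor>) + 1" using assms by auto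
  then show "real (nat \<lfloor>u / h\<rfloor>) * h \<le> u" "u \<le> real (nat \<lfloor>u / h\<rfloor>) * h + h"
    using assms(2) by (auto simp: field_simps)
qed

text \<open>Rounding both ends of a swing down to grid points costs less than (\<epsilon> -
  \<epsilon>') / 2 at each end, so a move of at least \<epsilon> still exceeds \<epsilon>'. Rounding
  is monotone, hence the rounded swings stay in order and can be counted by
  \<open>swing_count_Suc\<close>.\<close>

lemma swing_time_le_count:
  fixes x :: "real \<Rightarrow> real"
  assumes x: "continuous_on {0..} x" and e: "0 \<le> \<epsilon>'" "\<epsilon>' < \<epsilon>" and h: "h > 0"
    and osc: "\<And>u v. 0 \<le> u \<Longrightarrow> u \<le> t \<Longrightarrow> 0 \<le> v \<Longrightarrow> v \<le> t \<Longrightarrow> \<bar>u - v\<bar> \<le> h \<Longrightarrow> \<bar>x u - x v\<bar> < (\<epsilon> - \<epsilon>') / 2"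
    and "swing_time x \<epsilon> m = ereal p" "p \<le> t"
  shows "m \<le> fst (swing_state \<epsilon>' (\<lambda>i. x (real i * h)) (nat \<lfloor>p / h\<rfloor>))"
  using assms(6,7)
proof (induction m arbitrary: p)
  case (Suc m)
  let ?X = "\<lambda>i. x (real i * h)"
  have le: "swing_time x \<epsilon> m \<le> ereal p" using Suc.prems drop_time_ge by (metis swing_time.simps(2))
  then obtain q where q: "swing_time x \<epsilon> m = ereal q" "0 \<le> q" "q \<le> p"
    using swing_time_nonneg[of x \<epsilon> m] by (cases "swing_time x \<epsilon> m") auto
  have IH: "m \<le> fst (swing_state \<epsilon>' ?X (nat \<lfloor>q / h\<rfloor>))" using Suc q by auto
  have "continuous_on {0..} (\<lambda>u. (- 1) ^ m * x u)" by (intro continuous_intros x)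
  then obtain s where s: "q \<le> s" "s \<le> p" "(- 1) ^ m * x s - (- 1) ^ m * x p \<ge> \<epsilon>"
    using drop_time_attained[of "\<lambda>u. (- 1) ^ m * x u" q \<epsilon> p] q Suc.prems e by auto
  have fl: "\<bar>x u - ?X (nat \<lfloor>u / h\<rfloor>)\<bar> < (\<epsilon> - \<epsilon>') / 2" if "0 \<le> u" "u \<le> t" for u
    using that h floor_grid[of u h] by (intro osc) auto
  have near: "\<bar>x s - ?X (nat \<lfloor>s / h\<rfloor>)\<bar> < (\<epsilon> - \<epsilon>') / 2" "\<bar>x p - ?X (nat \<lfloor>p / h\<rfloor>)\<bar> < (\<epsilon> - \<epsilon>') / 2"
    using fl s q Suc.prems by auto
  have "(- 1) ^ m * (?X (nat \<lfloor>s / h\<rfloor>) - ?X (nat \<lfloor>p / h\<rfloor>)) > \<epsilon>'"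
    using near s(3) by (cases "even m") (auto simp: abs_if split: if_splits)
  moreover have idx: "nat \<lfloor>q / h\<rfloor> \<le> nat \<lfloor>s / h\<rfloor>" "nat \<lfloor>s / h\<rfloor> \<le> nat \<lfloor>p / h\<rfloor>"
    using s h by (auto intro!: nat_mono floor_mono divide_right_mono)
  moreover have "m \<le> fst (swing_state \<epsilon>' ?X (nat \<lfloor>s / h\<rfloor>))"
    using IH idx(1) swing_count_mono order_trans by blast
  ultimately show ?case by (intro swing_count_Suc[OF idx(2) _ _ e(1)])
qed simp

lemma swing_count_le: "fst (swing_state \<epsilon> x n) \<le> n"
  by (induction n) (auto simp: swing_step_def Let_def)

lemma uniform_mesh:
  fixes x :: "real \<Rightarrow> real"
  assumes "continuous_on {0..} x" "\<eta> > 0" "t > 0"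
  shows "\<forall>\<^sub>F n in sequentially. n > 0 \<and> (\<forall>u v. 0 \<le> u \<longrightarrow> u \<le> t \<longrightarrow> 0 \<le> v \<longrightarrow> v \<le> t \<longrightarrow>
     \<bar>u - v\<bar> \<le> t / real n \<longrightarrow> \<bar>x u - x v\<bar> < \<eta>)"
proof -
  have "continuous_on {0..t} x" using assms by (intro continuous_on_subset[OF assms(1)]) auto
  then have "uniformly_continuous_on {0..t} x" by (intro compact_uniformly_continuous) auto
  then obtain d where d: "d > 0" "\<And>u v. u \<in> {0..t} \<Longrightarrow> v \<in> {0..t} \<Longrightarrow> dist u v < d \<Longrightarrow> dist (x u) (x v) < \<eta>"
    using assms unfolding uniformly_continuous_on_def by metis
  have "(\<lambda>n. t / real n) \<longlonglongrightarrow> 0" by real_asymp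
  then have "\<forall>\<^sub>F n in sequentially. t / real n < d" using d(1) by (rule order_tendstoD)
  with eventually_gt_at_top[of 0] show ?thesis
    by eventually_elim (use d(2) in \<open>auto simp: dist_real_def\<close>)
qed

text \<open>Makes \<open>Max\<close> in \<open>num_bars\<close> meaningful. On a fine grid, even
  with threshold 0 in place of \<epsilon>', a walk of n steps has at most n swings, which bounds the
  swings of the path.\<close>

lemma finite_S_time:
  fixes x :: "real \<Rightarrow> real"
  assumes x: "continuous_on {0..} x" and "\<epsilon> > 0" "t > 0"
  shows "finite {k. S_time x \<epsilon> k \<le> ereal t}"
proof -
  have "\<forall>\<^sub>F n in sequentially. n > 0 \<and> (\<forall>u v. 0 \<le> u \<longrightarrow> u \<le> t \<longrightarrow> 0 \<le> v \<longrightarrow> v \<le> t \<longrightarrow>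
     \<bar>u - v\<bar> \<le> t / real n \<longrightarrow> \<bar>x u - x v\<bar> < (\<epsilon> - 0) / 2)"
    using assms by (intro uniform_mesh) auto
  then obtain n where n: "n > 0" "\<And>u v. 0 \<le> u \<Longrightarrow> u \<le> t \<Longrightarrow> 0 \<le> v \<Longrightarrow> v \<le> t \<Longrightarrow>
     \<bar>u - v\<bar> \<le> t / real n \<Longrightarrow> \<bar>x u - x v\<bar> < (\<epsilon> - 0) / 2"
    by (metis (no_types, lifting) eventually_happens trivial_limit_sequentially)
  have "k \<le> n" if k: "S_time x \<epsilon> k \<le> ereal t" for k
  proof -
    obtain p where p: "swing_time x \<epsilon> (2 * k) = ereal p" "p \<le> t" "0 \<le> p"
      using k swing_time_nonneg[of x \<epsilon> "2 * k"] unfolding S_time_eq by (cases "swing_time x \<epsilon> (2 * k)") auto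
    have "2 * k \<le> nat \<lfloor>p / (t / real n)\<rfloor>"
      by (rule order_trans[OF swing_time_le_count[OF x _ _ _ n(2) p(1,2)] swing_count_le]) (use assms n(1) in auto)
    also have "p / (t / real n) \<le> real n" using p assms n(1) by (simp add: field_simps)
    then have "nat \<lfloor>p / (t / real n)\<rfloor> \<le> n" by linarith
    finally show ?thesis by simp
  qed
  then have "{k. S_time x \<epsilon> k \<le> ereal t} \<subseteq> {..n}" by blast
  then show ?thesis by (rule finite_subset) simp
qed

section \<open>Bracketing the bars of a path by those of its grid samples\<close>

definition grid_bars :: "(nat \<Rightarrow> real) \<Rightarrow> nat \<Rightarrow> real \<Rightarrow> nat" where
  "grid_bars x n \<epsilon> = of_bool (\<exists>i\<le>n. \<exists>j\<le>n. x i - x j > \<epsilon>) + fst (swing_state \<epsilon> x n) div 2"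

text \<open>Sampling can only shrink the range and, by \<open>swing_count_le_time\<close>, the swing
  count. The strict range condition in \<open>grid_bars\<close> is the one governed by
  \<open>swing_state_reflect\<close>, and it implies the weak one here.\<close>

lemma grid_bars_le_num_bars:
  fixes x :: "real \<Rightarrow> real"
  assumes x: "continuous_on {0..} x" and e: "\<epsilon> > 0" and t: "t > 0" and n: "n > 0"
  shows "grid_bars (\<lambda>i. x (real i * (t / real n))) n \<epsilon> \<le> num_bars x t \<epsilon>"
proof -
  let ?X = "\<lambda>i. x (real i * (t / real n))"
  have bij: "0 \<le> real i * (t / real n) \<and> real i * (t / real n) \<le> t" if "i \<le> n" for i
    using that t n by (simp add: field_simps)
  have cont: "continuous_on {0..t} x" using continuous_on_subset[OF x] by auto
  have bdd: "bdd_above (x ` {0..t})" "bdd_below (x ` {0..t})"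
    using compact_imp_bounded[OF compact_continuous_image[OF cont compact_Icc]]
    by (auto simp: bounded_imp_bdd_above bounded_imp_bdd_below)
  have "(of_bool (\<exists>i\<le>n. \<exists>j\<le>n. ?X i - ?X j > \<epsilon>) :: nat) \<le> of_bool (path_range x t \<ge> \<epsilon>)"
  proof (cases "\<exists>i\<le>n. \<exists>j\<le>n. ?X i - ?X j > \<epsilon>")
    case True
    then obtain i j where ij: "i \<le> n" "j \<le> n" "?X i - ?X j > \<epsilon>" by blast
    have "?X i \<le> Sup (x ` {0..t})" using bij[OF ij(1)] bdd by (intro cSup_upper) auto
    moreover have "Inf (x ` {0..t}) \<le> ?X j" using bij[OF ij(2)] bdd by (intro cInf_lower) auto
    ultimately have "\<epsilon> \<le> path_range x t" using ij(3) by (simp add: path_range_def)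
    then show ?thesis by simp
  next
    case False
    then show ?thesis by (simp only: of_bool_def if_False zero_le)
  qed
  moreover have "fst (swing_state \<epsilon> ?X n) div 2 \<le> Max {k. S_time x \<epsilon> k \<le> ereal t}"
  proof (rule Max_ge[OF finite_S_time[OF x e t]])
    define k where "k = fst (swing_state \<epsilon> ?X n)"
    have mono: "swing_time x \<epsilon> (2 * (k div 2)) \<le> swing_time x \<epsilon> k"
      by (rule lift_Suc_mono_le[of "swing_time x \<epsilon>"]) (auto intro: drop_time_ge)
    obtain s where "swing_time x \<epsilon> k \<le> ereal s" "s \<le> real n * (t / real n)"
      using swing_count_le_time[OF x, of \<epsilon> "t / real n" n] e t unfolding k_def by auto
    then have "swing_time x \<epsilon> k \<le> ereal t" using n by (auto intro: order_trans)
    with mono show "fst (swing_state \<epsilon> ?X n) div 2 \<in> {k. S_time x \<epsilon> k \<le> ereal t}"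
      unfolding k_def[symmetric] S_time_eq by auto
  qed
  ultimately show ?thesis unfolding grid_bars_def num_bars_def by (rule add_mono)
qed

lemma num_bars_le_grid_bars:
  fixes x :: "real \<Rightarrow> real"
  assumes x: "continuous_on {0..} x" and e: "\<epsilon>' > 0" "\<epsilon>' < \<epsilon>" and t: "t > 0"
  shows "\<forall>\<^sub>F n in sequentially. num_bars x t \<epsilon> \<le> grid_bars (\<lambda>i. x (real i * (t / real n))) n \<epsilon>'"
proof -
  have cont: "continuous_on {0..t} x" using continuous_on_subset[OF x] by auto
  have ev: "\<forall>\<^sub>F n in sequentially. n > 0 \<and> (\<forall>u v. 0 \<le> u \<longrightarrow> u \<le> t \<longrightarrow> 0 \<le> v \<longrightarrow> v \<le> t \<longrightarrow>
     \<bar>u - v\<bar> \<le> t / real n \<longrightarrow> \<bar>x u - x v\<bar> < (\<epsilon> - \<epsilon>') / 2)"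
    using assms by (intro uniform_mesh) auto
  have fin: "finite {k. S_time x \<epsilon> k \<le> ereal t}" using e t by (intro finite_S_time[OF x]) auto
  define k where "k = Max {k. S_time x \<epsilon> k \<le> ereal t}"
  have "0 \<in> {k. S_time x \<epsilon> k \<le> ereal t}" using t by (simp add: zero_ereal_def)
  then have "k \<in> {k. S_time x \<epsilon> k \<le> ereal t}" unfolding k_def using Max_in[OF fin] by blast
  then obtain p where p: "swing_time x \<epsilon> (2 * k) = ereal p" "p \<le> t" "0 \<le> p"
    using swing_time_nonneg[of x \<epsilon> "2 * k"] unfolding S_time_eq by (cases "swing_time x \<epsilon> (2 * k)") auto
  obtain a b where ab: "a \<in> {0..t}" "b \<in> {0..t}" "Sup (x ` {0..t}) = x a" "Inf (x ` {0..t}) = x b"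
  proof -
    have "continuous_on {0..} (\<lambda>u. - x u)" by (intro continuous_intros x)
    then obtain b where b: "0 \<le> b" "b \<le> t" and S: "Sup ((\<lambda>u. - x u) ` {0..t}) = - x b"
      using continuous_Sup_attained[of "\<lambda>u. - x u" 0 t] t by (metis less_imp_le order_refl)
    have I: "Inf (x ` {0..t}) = x b" unfolding Inf_image_eq_Sup_minus[of x] S by simp
    obtain a where a: "0 \<le> a" "a \<le> t" "Sup (x ` {0..t}) = x a"
      using continuous_Sup_attained[OF x, of 0 t] t by (metis less_imp_le order_refl)
    show ?thesis by (rule that[OF _ _ a(3) I]) (use a b in auto)
  qed
  show ?thesis using ev
  proof eventually_elim
    case (elim n)
    define h where "h = t / real n"
    let ?X = "\<lambda>i. x (real i * h)"
    have h: "h > 0" using elim t by (simp add: h_def)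
    have osc: "\<bar>x u - x v\<bar> < (\<epsilon> - \<epsilon>') / 2" if "0 \<le> u" "u \<le> t" "0 \<le> v" "v \<le> t" "\<bar>u - v\<bar> \<le> h" for u v
      using elim that by (simp add: h_def)
    have fl: "nat \<lfloor>u / h\<rfloor> \<le> n \<and> \<bar>x u - ?X (nat \<lfloor>u / h\<rfloor>)\<bar> < (\<epsilon> - \<epsilon>') / 2" if "0 \<le> u" "u \<le> t" for u
    proof -
      have "\<bar>x u - ?X (nat \<lfloor>u / h\<rfloor>)\<bar> < (\<epsilon> - \<epsilon>') / 2"
        using that h floor_grid[of u h] by (intro osc) auto
      moreover have "u / h \<le> real n" using that elim t by (simp add: h_def field_simps)
      then have "nat \<lfloor>u / h\<rfloor> \<le> n" by linarith
      ultimately show ?thesis by blast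
    qed
    have "2 * k \<le> fst (swing_state \<epsilon>' ?X (nat \<lfloor>p / h\<rfloor>))"
      by (rule swing_time_le_count[OF x _ e(2) h osc p(1,2)]) (use e in auto)
    also have "\<dots> \<le> fst (swing_state \<epsilon>' ?X n)" using fl p by (intro swing_count_mono) auto
    finally have k: "k \<le> fst (swing_state \<epsilon>' ?X n) div 2" by simp
    have "(of_bool (path_range x t \<ge> \<epsilon>) :: nat) \<le> of_bool (\<exists>i\<le>n. \<exists>j\<le>n. ?X i - ?X j > \<epsilon>')"
    proof (cases "path_range x t \<ge> \<epsilon>")
      case True
      then have "x a - x b \<ge> \<epsilon>" by (simp add: path_range_def ab)
      then have "?X (nat \<lfloor>a / h\<rfloor>) - ?X (nat \<lfloor>b / h\<rfloor>) > \<epsilon>'"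
        using fl[of a] fl[of b] ab by (auto simp: abs_if split: if_splits)
      then have "\<exists>i\<le>n. \<exists>j\<le>n. ?X i - ?X j > \<epsilon>'" using fl[of a] fl[of b] ab by (meson atLeastAtMost_iff)
      then show ?thesis by simp
    qed simp
    with k show ?case unfolding grid_bars_def num_bars_def k_def h_def[symmetric] by (intro add_mono)
  qed
qed

section \<open>The expected number of bars\<close>

lemma levf_antimono:
  assumes "0 < \<epsilon>" "\<epsilon> \<le> \<epsilon>'" shows "levf \<epsilon>' b z \<le> levf \<epsilon> b z"
  unfolding levf_def using assms
  by (intro of_nat_mono level_mono nat_mono floor_mono divide_left_mono) auto

lemma potential_finite:
  assumes "\<epsilon> > 0" "r \<ge> 0" shows "potential \<epsilon> b r y < \<infinity>"
  using potential_bound[OF assms, of b y] by (rule le_less_trans) simp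

text \<open>As a function of the threshold, the level function is locally constant unless |z| /
  \<epsilon> is an integer, which happens on a null set; dominated convergence does the
  rest.\<close>

lemma potential_tendsto:
  assumes e: "e \<longlonglongrightarrow> \<epsilon>" and "\<epsilon> > 0" "t > 0"
  shows "(\<lambda>k. potential (e k) b t 0) \<longlonglongrightarrow> potential \<epsilon> b t 0"
proof -
  \<comment> \<open>Cutting the thresholds off at \<epsilon> / 2 makes the level function for
    \<epsilon> / 2 a bound for every index, without changing the sequence eventually.\<close>
  define e' where "e' k = max (e k) (\<epsilon> / 2)" for k
  have ev: "\<forall>\<^sub>F k in sequentially. e' k = e k"
    using order_tendstoD(1)[OF e, of "\<epsilon> / 2"] assms by (auto simp: e'_def elim!: eventually_mono)
  have e': "e' \<longlonglongrightarrow> \<epsilon>" using e ev by (simp add: tendsto_cong)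
  have lim: "(\<lambda>k. ennreal (normal_density 0 (sqrt t) z) * levf (e' k) b z) \<longlonglongrightarrow>
      ennreal (normal_density 0 (sqrt t) z) * levf \<epsilon> b z" if "\<bar>z\<bar> / \<epsilon> \<notin> \<int>" for z
  proof -
    have "(\<lambda>k. \<bar>z\<bar> / e' k) \<longlonglongrightarrow> \<bar>z\<bar> / \<epsilon>" using e' assms by (intro tendsto_intros) auto
    from eventually_floor_eq[OF this that]
    have "\<forall>\<^sub>F k in sequentially. levf (e' k) b z = levf \<epsilon> b z"
      by eventually_elim (simp add: levf_def)
    then show ?thesis by (intro tendsto_eventually) (auto elim: eventually_mono)
  qed
  have "(\<lambda>k. \<integral>\<^sup>+z. ennreal (normal_density 0 (sqrt t) z) * levf (e' k) b z \<partial>lborel) \<longlonglongrightarrow>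
      (\<integral>\<^sup>+z. ennreal (normal_density 0 (sqrt t) z) * levf \<epsilon> b z \<partial>lborel)"
  proof (rule nn_integral_dominated_convergence[where w = "\<lambda>z. ennreal (normal_density 0 (sqrt t) z) * levf (\<epsilon> / 2) b z"])
    show "AE z in lborel. ennreal (normal_density 0 (sqrt t) z) * levf (e' k) b z \<le>
       ennreal (normal_density 0 (sqrt t) z) * levf (\<epsilon> / 2) b z" for k
      using assms by (intro always_eventually allI mult_left_mono levf_antimono) (auto simp: e'_def)
    show "(\<integral>\<^sup>+z. ennreal (normal_density 0 (sqrt t) z) * levf (\<epsilon> / 2) b z \<partial>lborel) < \<infinity>"
      using potential_finite[of "\<epsilon> / 2" t b 0] assms by (simp add: potential_def gauss_exp_def)
    show "AE z in lborel. (\<lambda>k. ennreal (normal_density 0 (sqrt t) z) * levf (e' k) b z) \<longlonglongrightarrow>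
      ennreal (normal_density 0 (sqrt t) z) * levf \<epsilon> b z"
      using AE_divide_notin_Ints[OF \<open>\<epsilon> > 0\<close>]
    proof eventually_elim
      case (elim z)
      then have "\<bar>z\<bar> / \<epsilon> \<notin> \<int>" by (auto simp: abs_if)
      then show ?case by (rule lim)
    qed
  qed auto
  then have "(\<lambda>k. potential (e' k) b t 0) \<longlonglongrightarrow> potential \<epsilon> b t 0"
    using assms by (simp add: potential_def gauss_exp_def)
  then show ?thesis by (rule Lim_transform_eventually) (use ev in eventually_elim, simp)
qed

lemma gaussian_walk_uminus:
  assumes "gaussian_walk M X h n" shows "gaussian_walk M (\<lambda>i w. - X i w) h n"
proof -
  interpret gaussian_walk M X h n by fact
  show ?thesis
  proof
    have "indep_vars (\<lambda>_. borel) (\<lambda>i w. - (X (Suc i) w - X i w)) {..<n}"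
      by (rule indep_vars_compose2[OF indep]) auto
    then show "indep_vars (\<lambda>_. borel) (\<lambda>i w. - X (Suc i) w - - X i w) {..<n}" by simp
    show "distributed M lborel (\<lambda>w. - X (Suc i) w - - X i w) (normal_density 0 (sqrt h))" if "i < n" for i
      using normal_density_affine[OF normal[OF that], of "-1" 0] h_pos by simp
  qed (rule h_pos)
qed

text \<open>Two limits in order: first \<delta> is fixed so small that the potential at \<epsilon> +
  3 \<delta> still exceeds c, then n grows, and for fixed \<delta> the error 3 C t^2 / n
  vanishes.\<close>

lemma expected_count_tendsto:
  assumes walk: "\<And>n. n > 0 \<Longrightarrow> gaussian_walk M (X n) (t / real n) n" and "\<epsilon> > 0" "t > 0" "b < 2"
  shows "(\<lambda>n. \<integral>\<^sup>+w. of_nat ((b + fst (swing_state \<epsilon> (\<lambda>i. X n i w) n)) div 2) \<partial>M) \<longlonglongrightarrow> potential \<epsilon> b t 0"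
    (is "?E \<longlonglongrightarrow> _")
proof (rule order_tendstoI)
  fix c assume c: "potential \<epsilon> b t 0 < c"
  \<comment> \<open>The initial reward \<open>b div 2\<close> vanishes because
    \<open>b < 2\<close>.\<close>
  have "?E n \<le> potential \<epsilon> b t 0" if "n > 0" for n
    using gaussian_walk.expected_count_le[OF walk[OF that] \<open>\<epsilon> > 0\<close>, of b] that assms
    by (simp add: state_potential_def gaussian_walk.state_def[OF walk[OF that]])
  then have "?E n < c" if "n > 0" for n using c that le_less_trans by blast
  then show "\<forall>\<^sub>F n in sequentially. ?E n < c"
    using eventually_gt_at_top[of 0] by (rule eventually_mono[rotated])
next
  fix c assume c: "c < potential \<epsilon> b t 0"
  have "(\<lambda>k. \<epsilon> + 3 * (1 / real (Suc k))) \<longlonglongrightarrow> \<epsilon>" by real_asymp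
  from potential_tendsto[OF this assms(2,3), of b] c
  have "\<forall>\<^sub>F k in sequentially. c < potential (\<epsilon> + 3 * (1 / real (Suc k))) b t 0" by (rule order_tendstoD)
  then obtain k where k: "c < potential (\<epsilon> + 3 * (1 / real (Suc k))) b t 0"
    using eventually_happens trivial_limit_sequentially by blast
  define \<delta> where "\<delta> = 1 / real (Suc k)"
  define \<epsilon>' where "\<epsilon>' = \<epsilon> + 3 * \<delta>"
  have \<delta>: "\<delta> > 0" by (simp add: \<delta>_def)
  define C where "C = (10 + 4 * t / \<epsilon>'\<^sup>2) / \<delta> ^ 4 + 8 / (\<epsilon>'\<^sup>2 * \<delta>\<^sup>2)"
  have bound: "potential \<epsilon>' b t 0 - ennreal (3 * C * (t / real n)\<^sup>2 * real n) \<le> ?E n" if "n > 0" for n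
  proof -
    have *: "real n * (t / real n) = t" using that by simp
    have "potential \<epsilon>' b t 0 \<le> ?E n + ennreal (3 * C * (t / real n)\<^sup>2 * real n)"
      using gaussian_walk.expected_count_ge[OF walk[OF that] \<open>\<epsilon> > 0\<close> \<delta>, of b]
      unfolding * gaussian_walk.state_def[OF walk[OF that]] C_def \<epsilon>'_def by simp
    then show ?thesis using potential_finite[of \<epsilon>' t b 0] assms \<delta>
      by (auto simp: ennreal_minus_le_iff add.commute \<epsilon>'_def)
  qed
  have "(\<lambda>n. potential \<epsilon>' b t 0 - ennreal (3 * C * (t / real n)\<^sup>2 * real n)) \<longlonglongrightarrow> potential \<epsilon>' b t 0 - ennreal 0"
  proof (intro tendsto_diff_ennreal tendsto_ennrealI)
    have "(\<lambda>n. (t / real n)\<^sup>2 * real n) \<longlonglongrightarrow> 0" using assms by real_asymp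
    from tendsto_mult_right_zero[OF this, of "3 * C"]
    show "(\<lambda>n. 3 * C * (t / real n)\<^sup>2 * real n) \<longlonglongrightarrow> 0" by (simp add: mult.assoc)
  qed (use potential_finite[of \<epsilon>' t b 0] assms \<delta> in \<open>auto simp: \<epsilon>'_def\<close>)
  then have "\<forall>\<^sub>F n in sequentially. c < potential \<epsilon>' b t 0 - ennreal (3 * C * (t / real n)\<^sup>2 * real n)"
    by (rule order_tendstoD) (use k in \<open>simp add: \<epsilon>'_def \<delta>_def\<close>)
  then show "\<forall>\<^sub>F n in sequentially. c < ?E n"
    using eventually_gt_at_top[of 0]
  proof eventually_elim
    case (elim n)
    then show ?case using bound less_le_trans by blast
  qed
qed

section \<open>Expected bars of Brownian motion\<close>

context standard_brownian_motion begin

lemma grid_gaussian_walk: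
  assumes "t > 0" "n > 0"
  shows "gaussian_walk M (\<lambda>i. B (real i * (t / real n))) (t / real n) n"
proof
  have "mono (\<lambda>i. real i * (t / real n))" using assms by (intro monoI mult_right_mono) auto
  then show "indep_vars (\<lambda>_. borel) (\<lambda>i w. B (real (Suc i) * (t / real n)) w - B (real i * (t / real n)) w) {..<n}"
    using independent_increments[of "\<lambda>i. real i * (t / real n)" n] by simp
  show "distributed M lborel (\<lambda>w. B (real (Suc i) * (t / real n)) w - B (real i * (t / real n)) w)
      (normal_density 0 (sqrt (t / real n)))" for i
  proof -
    have "real (Suc i) * (t / real n) - real i * (t / real n) = t / real n"
      by (simp add: algebra_simps add_divide_distrib)
    moreover have "0 \<le> real i * (t / real n)" "real i * (t / real n) < real (Suc i) * (t / real n)"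
      using assms by (auto intro: mult_strict_right_mono simp del: of_nat_Suc times_divide_eq_right)
    ultimately show ?thesis using normal_increments by metis
  qed
qed (use assms in simp)

lemma expected_grid_bars_tendsto:
  assumes "t > 0" "\<epsilon> > 0"
  shows "(\<lambda>n. \<integral>\<^sup>+w. of_nat (grid_bars (\<lambda>i. B (real i * (t / real n)) w) n \<epsilon>) \<partial>M) \<longlonglongrightarrow>
    potential \<epsilon> 1 t 0 + (potential \<epsilon> 1 t 0 - potential \<epsilon> 0 t 0)"
proof -
  define X where "X n i = B (real i * (t / real n))" for n i
  define K where "K n w = fst (swing_state \<epsilon> (\<lambda>i. X n i w) n)" for n w
  define K' where "K' n w = fst (swing_state \<epsilon> (\<lambda>i. - X n i w) n)" for n w
  have walk: "gaussian_walk M (X n) (t / real n) n" if "n > 0" for n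
    unfolding X_def using grid_gaussian_walk assms that by blast
  have walk': "gaussian_walk M (\<lambda>i w. - X n i w) (t / real n) n" if "n > 0" for n
    using gaussian_walk_uminus walk that by blast
  have meas: "K n \<in> M \<rightarrow>\<^sub>M count_space UNIV" "K' n \<in> M \<rightarrow>\<^sub>M count_space UNIV" if "n > 0" for n
    using gaussian_walk.count_measurable[OF walk[OF that], of n \<epsilon>]
      gaussian_walk.count_measurable[OF walk'[OF that], of n \<epsilon>]
    unfolding gaussian_walk.state_def[OF walk[OF that]] gaussian_walk.state_def[OF walk'[OF that]]
      K_def[abs_def] K'_def[abs_def] by simp_all
  have E: "(\<integral>\<^sup>+w. of_nat (grid_bars (\<lambda>i. X n i w) n \<epsilon>) \<partial>M) =
      (\<integral>\<^sup>+w. of_nat ((1 + K n w) div 2) \<partial>M) +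
      ((\<integral>\<^sup>+w. of_nat ((1 + K' n w) div 2) \<partial>M) - (\<integral>\<^sup>+w. of_nat (K' n w div 2) \<partial>M))" if n: "n > 0" for n
  proof -
    note [measurable] = meas[OF n]
    \<comment> \<open>By reflection the range indicator is \<open>K mod 2 + K' mod 2\<close>; the
      first summand completes \<open>K div 2\<close> to \<open>(1 + K) div 2\<close>. The second is
      \<open>(1 + K') div 2 - K' div 2\<close>, so its mean is a difference of known quantities once
      these are finite.\<close>
    have bars: "grid_bars (\<lambda>i. X n i w) n \<epsilon> = (1 + K n w) div 2 + K' n w mod 2" for w
      using swing_state_reflect[of \<epsilon> n "\<lambda>i. X n i w"] assms
      by (simp add: grid_bars_def K_def K'_def Suc_div_2_eq)
    have "K' n w div 2 \<le> n" for w
      unfolding K'_def using swing_count_le[of \<epsilon> "\<lambda>i. - X n i w" n] by simp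
    then have "(\<integral>\<^sup>+w. of_nat (K' n w div 2) \<partial>M) \<le> (\<integral>\<^sup>+w. of_nat n \<partial>M)" by (intro nn_integral_mono of_nat_mono)
    then have "(\<integral>\<^sup>+w. of_nat (K' n w div 2) \<partial>M) < \<infinity>"
      by (rule le_less_trans) (simp add: emeasure_space_1 of_nat_less_top)
    then have fin: "(\<integral>\<^sup>+w. of_nat (K' n w div 2) \<partial>M) \<noteq> \<infinity>" by simp
    have "(\<integral>\<^sup>+w. of_nat ((1 + K' n w) div 2) \<partial>M) = (\<integral>\<^sup>+w. of_nat (K' n w mod 2) \<partial>M) + (\<integral>\<^sup>+w. of_nat (K' n w div 2) \<partial>M)"
      by (subst nn_integral_add[symmetric]) (auto simp: Suc_div_2_eq add.commute)
    then have "(\<integral>\<^sup>+w. of_nat (K' n w mod 2) \<partial>M) =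
       (\<integral>\<^sup>+w. of_nat ((1 + K' n w) div 2) \<partial>M) - (\<integral>\<^sup>+w. of_nat (K' n w div 2) \<partial>M)"
      using fin by simp
    then show ?thesis unfolding bars of_nat_add by (subst nn_integral_add) auto
  qed
  have lim: "(\<lambda>n. \<integral>\<^sup>+w. of_nat ((b + K n w) div 2) \<partial>M) \<longlonglongrightarrow> potential \<epsilon> b t 0"
    "(\<lambda>n. \<integral>\<^sup>+w. of_nat ((b + K' n w) div 2) \<partial>M) \<longlonglongrightarrow> potential \<epsilon> b t 0" if "b < 2" for b
    unfolding K_def K'_def using that assms
    by (intro expected_count_tendsto[where X = X] expected_count_tendsto[where X = "\<lambda>n i w. - X n i w"] walk walk'; simp)+
  have "(\<lambda>n. (\<integral>\<^sup>+w. of_nat ((1 + K n w) div 2) \<partial>M) +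
      ((\<integral>\<^sup>+w. of_nat ((1 + K' n w) div 2) \<partial>M) - (\<integral>\<^sup>+w. of_nat (K' n w div 2) \<partial>M)))
     \<longlonglongrightarrow> potential \<epsilon> 1 t 0 + (potential \<epsilon> 1 t 0 - potential \<epsilon> 0 t 0)"
    using lim(1)[of 1] lim(2)[of 1] lim(2)[of 0] potential_finite[of \<epsilon> t _ 0] assms
    by (intro tendsto_add tendsto_diff_ennreal) (auto simp: less_top)
  then show ?thesis unfolding X_def[symmetric]
    by (rule Lim_transform_eventually) (use eventually_gt_at_top[of 0] in eventually_elim, simp add: E)
qed

text \<open>The level functions are not ordered pointwise (\<open>level 0 2 = 4\<close> but
  \<open>level 1 2 = 2\<close>), so the order is inherited from the counts
  \<open>K div 2 \<le> (1 + K) div 2\<close> in the limit. It keeps the \<open>ennreal\<close>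
  subtraction from truncating.\<close>

lemma potential_le:
  assumes "t > 0" "\<epsilon> > 0" shows "potential \<epsilon> 0 t 0 \<le> potential \<epsilon> 1 t 0"
proof (rule LIMSEQ_le)
  have "gaussian_walk M (\<lambda>i. B (real i * (t / real n))) (t / real n) n" if "n > 0" for n
    using grid_gaussian_walk assms that by blast
  from expected_count_tendsto[where X = "\<lambda>n i. B (real i * (t / real n))", OF this assms(2,1)]
  have lim: "(\<lambda>n. \<integral>\<^sup>+w. of_nat ((b + fst (swing_state \<epsilon> (\<lambda>i. B (real i * (t / real n)) w) n)) div 2) \<partial>M)
      \<longlonglongrightarrow> potential \<epsilon> b t 0" if "b < 2" for b
    using that by blast
  show "(\<lambda>n. \<integral>\<^sup>+w. of_nat ((0 + fst (swing_state \<epsilon> (\<lambda>i. B (real i * (t / real n)) w) n)) div 2) \<partial>M) \<longlonglongrightarrow> potential \<epsilon> 0 t 0"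
    "(\<lambda>n. \<integral>\<^sup>+w. of_nat ((1 + fst (swing_state \<epsilon> (\<lambda>i. B (real i * (t / real n)) w) n)) div 2) \<partial>M) \<longlonglongrightarrow> potential \<epsilon> 1 t 0"
    by (rule lim, simp)+
qed (auto intro!: exI[of _ 0] nn_integral_mono div_le_mono)

text \<open>The lower bound compares with grid bars at the same threshold. The upper bound applies
  Fatou to grid bars at \<epsilon>' < \<epsilon> and then lets \<epsilon>' increase to \<epsilon> by
  continuity. \<open>num_bars\<close> enters only through monotonicity of the integral.\<close>

theorem expected_num_bars_eq:
  assumes "t > 0" "\<epsilon> > 0"
  shows "expected_num_bars M B t \<epsilon> = potential \<epsilon> 1 t 0 + (potential \<epsilon> 1 t 0 - potential \<epsilon> 0 t 0)"
proof (rule antisym)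
  let ?A = "\<lambda>\<epsilon>. potential \<epsilon> 1 t 0 + (potential \<epsilon> 1 t 0 - potential \<epsilon> 0 t 0)"
  let ?g = "\<lambda>n \<epsilon> w. of_nat (grid_bars (\<lambda>i. B (real i * (t / real n)) w) n \<epsilon>) :: ennreal"
  have cont: "AE w in M. continuous_on {0..} (\<lambda>t. B t w)" by (rule continuous_paths)
  show "?A \<epsilon> \<le> expected_num_bars M B t \<epsilon>"
  proof (rule tendsto_upperbound[OF expected_grid_bars_tendsto[OF assms]])
    show "\<forall>\<^sub>F n in sequentially. (\<integral>\<^sup>+w. ?g n \<epsilon> w \<partial>M) \<le> expected_num_bars M B t \<epsilon>"
      using eventually_gt_at_top[of 0]
    proof eventually_elim
      case n: (elim n)
      show ?case unfolding expected_num_bars_def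
      proof (rule nn_integral_mono_AE)
        show "AE w in M. ?g n \<epsilon> w \<le> of_nat (num_bars (\<lambda>s. B s w) t \<epsilon>)"
          using cont
        proof eventually_elim
          case (elim w)
          then show ?case by (intro of_nat_mono grid_bars_le_num_bars assms n)
        qed
      qed
    qed
  qed simp
  have upper: "expected_num_bars M B t \<epsilon> \<le> ?A \<epsilon>'" if \<epsilon>': "0 < \<epsilon>'" "\<epsilon>' < \<epsilon>" for \<epsilon>'
  proof -
    \<comment> \<open>Fatou requires measurable grid bars; the reflection identity expresses the
      range indicator by two swing counts already known to be measurable.\<close>
    have [measurable]: "?g (Suc n) \<epsilon>' \<in> borel_measurable M" for n
    proof -
      have walk: "gaussian_walk M (\<lambda>i. B (real i * (t / real (Suc n)))) (t / real (Suc n)) (Suc n)"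
        using grid_gaussian_walk[OF assms(1)] by blast
      note walk' = gaussian_walk_uminus[OF walk]
      have [measurable]: "(\<lambda>w. fst (swing_state \<epsilon>' (\<lambda>i. B (real i * (t / real (Suc n))) w) (Suc n))) \<in> M \<rightarrow>\<^sub>M count_space UNIV"
        "(\<lambda>w. fst (swing_state \<epsilon>' (\<lambda>i. - B (real i * (t / real (Suc n))) w) (Suc n))) \<in> M \<rightarrow>\<^sub>M count_space UNIV"
        using gaussian_walk.count_measurable[OF walk, of "Suc n" \<epsilon>'] gaussian_walk.count_measurable[OF walk', of "Suc n" \<epsilon>']
        unfolding gaussian_walk.state_def[OF walk] gaussian_walk.state_def[OF walk'] by auto
      show ?thesis unfolding grid_bars_def swing_state_reflect[OF less_imp_le[OF \<epsilon>'(1)]] by measurable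
    qed
    have "expected_num_bars M B t \<epsilon> \<le> (\<integral>\<^sup>+w. liminf (\<lambda>n. ?g (Suc n) \<epsilon>' w) \<partial>M)"
      unfolding expected_num_bars_def
    proof (rule nn_integral_mono_AE)
      show "AE w in M. of_nat (num_bars (\<lambda>s. B s w) t \<epsilon>) \<le> liminf (\<lambda>n. ?g (Suc n) \<epsilon>' w)"
        using cont
      proof eventually_elim
        case (elim w)
        have "\<forall>\<^sub>F n in sequentially. of_nat (num_bars (\<lambda>s. B s w) t \<epsilon>) \<le> ?g n \<epsilon>' w"
          using num_bars_le_grid_bars[OF elim \<epsilon>' assms(1)] by eventually_elim (rule of_nat_mono)
        then have "\<forall>\<^sub>F n in sequentially. of_nat (num_bars (\<lambda>s. B s w) t \<epsilon>) \<le> ?g (Suc n) \<epsilon>' w"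
          by (subst eventually_sequentially_Suc)
        then show ?case by (rule Liminf_bounded)
      qed
    qed
    also have "\<dots> \<le> liminf (\<lambda>n. \<integral>\<^sup>+w. ?g (Suc n) \<epsilon>' w \<partial>M)" by (intro nn_integral_liminf) measurable
    also have "\<dots> = ?A \<epsilon>'"
      using LIMSEQ_Suc[OF expected_grid_bars_tendsto[OF assms(1) \<epsilon>'(1)]] by (intro lim_imp_Liminf) auto
    finally show ?thesis .
  qed
  define e where "e k = \<epsilon> - \<epsilon> / real (Suc (Suc k))" for k
  have e: "e \<longlonglongrightarrow> \<epsilon>" unfolding e_def by real_asymp
  have "(\<lambda>k. ?A (e k)) \<longlonglongrightarrow> ?A \<epsilon>"
    using potential_finite[of \<epsilon> t _ 0] assms
    by (intro tendsto_add tendsto_diff_ennreal potential_tendsto e) (auto simp: less_top)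
  moreover have "expected_num_bars M B t \<epsilon> \<le> ?A (e k)" for k
  proof (rule upper)
    have "0 < \<epsilon> + \<epsilon> * real k" using assms by (simp add: add_pos_nonneg)
    then show "0 < e k" "e k < \<epsilon>" using assms by (auto simp: e_def field_simps)
  qed
  ultimately show "expected_num_bars M B t \<epsilon> \<le> ?A \<epsilon>"
    by (intro tendsto_lowerbound[of _ _ sequentially]) auto
qed

end

section \<open>Mellin transforms\<close>

text \<open>Extension of the power by 0 to the whole line makes Mellin integrals plain
  \<open>lborel\<close> integrals, so that scaling and Fubini need no integration domains.\<close>

definition pos_powr :: "complex \<Rightarrow> real \<Rightarrow> complex" where
  "pos_powr a x = (if x > 0 then of_real x powr a else 0)"

lemma pos_powr_eq_exp: "pos_powr a x = (if x > 0 then exp (a * of_real (ln x)) else 0)"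
  by (auto simp: pos_powr_def powr_def Ln_of_real)

lemma pos_powr_measurable [measurable]: "pos_powr a \<in> borel_measurable borel"
proof -
  have "(\<lambda>x. a * complex_of_real (ln x)) \<in> borel_measurable borel" by measurable
  moreover have "exp \<in> borel_measurable (borel :: complex measure)"
    by (intro borel_measurable_continuous_onI continuous_intros)
  ultimately have "(\<lambda>x. exp (a * complex_of_real (ln x))) \<in> borel_measurable borel"
    by (rule measurable_compose)
  then show ?thesis unfolding pos_powr_eq_exp[abs_def] by measurable
qed

lemma norm_pos_powr: "norm (pos_powr a x) = (if x > 0 then x powr Re a else 0)"
  by (auto simp: pos_powr_def norm_powr_real_powr)

lemma pos_powr_add: "pos_powr (a + b) x = pos_powr a x * pos_powr b x"
  by (auto simp: pos_powr_def powr_add)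

lemma pos_powr_scale:
  assumes "c > 0" shows "pos_powr a (c * x) = of_real c powr a * pos_powr a x"
  using assms by (auto simp: pos_powr_eq_exp powr_def Ln_of_real zero_less_mult_iff ln_mult ring_distribs exp_add)

lemma mellin_scale:
  assumes "integrable lborel (\<lambda>x. pos_powr a x * g x)" "c > 0"
  shows "integrable lborel (\<lambda>x. pos_powr a x * g (c * x))" (is ?A)
    and "(LINT x|lborel. pos_powr a x * g (c * x)) = of_real c powr (- a - 1) * (LINT x|lborel. pos_powr a x * g x)" (is ?B)
proof -
  have eq: "pos_powr a x * g (c * x) = of_real c powr (- a) * (pos_powr a (c * x) * g (c * x))" for x
    using assms by (simp add: pos_powr_scale powr_minus)
  have int: "integrable lborel (\<lambda>x. pos_powr a (c * x) * g (c * x))"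
    using lborel_integrable_real_affine[OF assms(1), of c 0] assms(2) by simp
  show ?A unfolding eq using int by simp
  have "(LINT x|lborel. pos_powr a x * g x) = of_real c * (LINT x|lborel. pos_powr a (c * x) * g (c * x))"
    using lborel_integral_real_affine[of c "\<lambda>x. pos_powr a x * g x" 0] assms by (simp add: scaleR_conv_of_real)
  then show ?B unfolding eq using assms by (simp add: powr_diff powr_minus field_simps)
qed

text \<open>Bridge from gauge integrals, in which the Gamma integral and the fundamental theorem are
  stated, to \<open>lborel\<close>, where Fubini and termwise integration take place.\<close>

lemma integrable_lborel_of_lebesgue:
  fixes f :: "real \<Rightarrow> complex"
  assumes "f absolutely_integrable_on S" "(f has_integral I) S"
    and [measurable]: "g \<in> borel_measurable borel" and g: "\<And>x. g x = (if x \<in> S then f x else 0)"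
  shows "integrable lborel g" and "integral\<^sup>L lborel g = I"
proof -
  have eq: "(\<lambda>x. indicator S x *\<^sub>R f x) = g" using g by (auto simp: fun_eq_iff indicator_def)
  then have "integrable lebesgue g" using assms(1) by (simp add: set_integrable_def)
  then show int: "integrable lborel g" by (subst (asm) integrable_completion) auto
  have "g = (\<lambda>x. if x \<in> S then f x else 0)" using g by (simp add: fun_eq_iff)
  then have "(g has_integral I) UNIV" using assms(2) by (simp only: has_integral_restrict_UNIV)
  moreover have "(g has_integral integral\<^sup>L lborel g) UNIV"
    using has_integral_integral_lborel[OF int] .
  ultimately show "integral\<^sup>L lborel g = I" by (rule has_integral_unique[rotated])
qed

lemma mellin_exp:
  assumes "Re s > 0"
  shows "integrable lborel (\<lambda>x. pos_powr (s - 1) x * of_real (exp (- x)))" (is ?A)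
    and "(LINT x|lborel. pos_powr (s - 1) x * of_real (exp (- x))) = Gamma s" (is ?B)
proof -
  note * = integrable_lborel_of_lebesgue[OF absolutely_integrable_Gamma_integral'[OF assms] Gamma_integral_complex'[OF assms]]
  show ?A ?B by (rule *; auto simp: pos_powr_def exp_minus field_simps)+
qed

lemma mellin_Icc:
  assumes "Re s > 0"
  shows "integrable lborel (\<lambda>x. pos_powr (s - 1) x * of_bool (x \<le> 1))" (is ?A)
    and "(LINT x|lborel. pos_powr (s - 1) x * of_bool (x \<le> 1)) = 1 / s" (is ?B)
proof -
  have int: "((\<lambda>t. complex_of_real t powr (s - 1)) has_integral
      (of_real 1 powr s / s - of_real 0 powr s / s)) {0..1}" using assms
    by (intro fundamental_theorem_of_calculus_interior)
       (auto intro!: continuous_intros derivative_eq_intros has_vector_derivative_real_field)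
  moreover have "(\<lambda>t. t powr (Re s - 1)) integrable_on {0..1}"
    using assms by (intro integrable_on_powr_from_0) auto
  then have "(\<lambda>t. complex_of_real t powr (s - 1)) absolutely_integrable_on {0..1}"
    using has_integral_integrable[OF int]
    by (elim absolutely_integrable_integrable_bound[rotated]) (auto simp: norm_powr_real_powr)
  ultimately have *: "(\<lambda>t. complex_of_real t powr (s - 1)) absolutely_integrable_on {0..1}"
     "((\<lambda>t. complex_of_real t powr (s - 1)) has_integral 1 / s) {0..1}" by simp_all
  show ?A ?B by (rule integrable_lborel_of_lebesgue[OF *]; auto simp: pos_powr_def)+
qed

section \<open>Taylor expansion of \<open>z / (e\<^sup>z - 1)\<close>\<close>

definition exp_quot :: "complex \<Rightarrow> complex" where
  "exp_quot z = (if z = 0 then 1 else (exp z - 1) / z)"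

lemma exp_quot_holomorphic: "exp_quot holomorphic_on UNIV"
proof -
  have "(\<lambda>z. if z = 0 then deriv exp 0 else (exp z - exp 0) / (z - 0)) holomorphic_on UNIV"
    by (rule pole_lemma) (auto intro: holomorphic_intros)
  also have "(\<lambda>z. if z = 0 then deriv exp 0 else (exp z - exp 0) / (z - 0)) = exp_quot"
    using DERIV_imp_deriv[OF DERIV_exp[of "0::complex"]] by (auto simp: exp_quot_def fun_eq_iff)
  finally show ?thesis .
qed

text \<open>The zeros are the nonzero multiples of 2 pi i, and 6 < 2 pi. The radius 6 leaves the
  point 1 well inside the disc, as needed for \<open>bern_summable\<close>.\<close>

lemma exp_quot_nonzero:
  assumes "norm z < 6" shows "exp_quot z \<noteq> 0"
proof
  assume "exp_quot z = 0"
  then have "z \<noteq> 0" "exp z = 1" by (auto simp: exp_quot_def split: if_splits)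
  then obtain n where n: "Re z = 0" "Im z = of_int (2 * n) * pi" by (auto simp: exp_eq_1)
  have "n \<noteq> 0" using n \<open>z \<noteq> 0\<close> by (auto simp: complex_eq_iff)
  then have "\<bar>Im z\<bar> \<ge> 2 * pi" using n by (auto simp: abs_mult)
  then show False using assms abs_Im_le_cmod[of z] pi_gt3 by linarith
qed

text \<open>These are B_k / k! with the Bernoulli numbers B_k, in the convention B_1 = -1/2.\<close>

definition bern :: "nat \<Rightarrow> complex" where
  "bern k = (deriv ^^ k) (\<lambda>z. 1 / exp_quot z) 0 / fact k"

lemma exp_quot_inverse_holomorphic: "(\<lambda>z. 1 / exp_quot z) holomorphic_on ball 0 6"
  using exp_quot_nonzero
  by (intro holomorphic_intros holomorphic_on_subset[OF exp_quot_holomorphic]) auto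

lemma bern_sums:
  assumes "norm z < 6" shows "(\<lambda>k. bern k * z ^ k) sums (1 / exp_quot z)"
  using holomorphic_power_series[OF exp_quot_inverse_holomorphic, of z] assms by (simp add: bern_def)

lemma bern_summable: "summable (\<lambda>k. norm (bern k))"
  using powser_insidea[of bern 5 1] bern_sums[of 5] by (auto dest: sums_summable)

lemma bern_0 [simp]: "bern 0 = 1"
  by (simp add: bern_def exp_quot_def)

text \<open>The function f(z) = z / (e^z - 1) satisfies f(-z) = f(z) + z, so its odd part is linear
  and odd derivatives at 0 of order above 1 vanish.\<close>

lemma bern_odd:
  assumes "odd k" "k \<ge> 2" shows "bern k = 0"
proof -
  define f where "f z = 1 / exp_quot z" for z
  have hol: "f holomorphic_on ball 0 6" unfolding f_def by (rule exp_quot_inverse_holomorphic)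
  have refl: "f (- w) = f w + w" if "w \<in> ball 0 6" for w
  proof (cases "w = 0")
    case False
    then have "exp w \<noteq> 1" using exp_quot_nonzero[of w] that by (auto simp: exp_quot_def)
    then show ?thesis using False by (simp add: f_def exp_quot_def exp_minus field_simps)
  qed (simp add: f_def exp_quot_def)
  have "(deriv ^^ k) (\<lambda>w. f (- 1 * w)) 0 = (deriv ^^ k) (\<lambda>w. f w + w) 0"
    by (rule higher_deriv_transform_within_open[of _ "ball 0 6"])
       (auto intro!: holomorphic_intros holomorphic_on_compose_gen[OF _ hol, unfolded o_def] hol simp: refl)
  moreover have "(deriv ^^ k) (\<lambda>w. f (- 1 * w)) 0 = (- 1) ^ k * (deriv ^^ k) f (- 1 * 0)"
    by (rule higher_deriv_compose_linear[OF hol, of "ball 0 6"]) auto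
  moreover have "(deriv ^^ k) (\<lambda>w. f w + w) 0 = (deriv ^^ k) f 0 + (deriv ^^ k) (\<lambda>w. w) 0"
    by (rule higher_deriv_add[OF hol]) (auto intro: holomorphic_intros)
  moreover have "(deriv ^^ k) (\<lambda>w. w) (0::complex) = 0" using assms by simp
  ultimately have "(deriv ^^ k) f 0 = 0" using assms by simp
  moreover have "f = (\<lambda>z. 1 / exp_quot z)" by (simp add: f_def fun_eq_iff)
  ultimately show ?thesis by (simp add: bern_def)
qed

section \<open>Analytic continuation of the Riemann zeta function\<close>

abbreviation bose :: "real \<Rightarrow> complex" where
  "bose x \<equiv> of_real (1 / (exp x - 1))"

definition zeta_tail :: "complex \<Rightarrow> complex" where
  "zeta_tail s = (LINT x|lborel. pos_powr (s - 1) x * (of_bool (x > 1) * bose x))"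

lemma zeta_tail_bound:
  assumes "x > 1" "Re s \<le> S" "1 \<le> S"
  shows "norm (pos_powr (s - 1) x * bose x) \<le> 2 * (x powr (S - 1) * exp (- x))"
proof -
  have "x powr Re (s - 1) \<le> x powr (S - 1)" using assms by (intro powr_mono) auto
  moreover have "1 / (exp x - 1) \<le> 2 * exp (- x)"
  proof -
    have "exp x \<ge> 2" using assms exp_ge_add_one_self[of x] by linarith
    then have "exp x * 1 \<le> 2 * (exp x - 1)" "exp x - 1 > 0" using assms by simp_all
    then show ?thesis by (simp add: exp_minus pos_divide_le_eq) (simp add: field_simps)
  qed
  moreover have "1 / (exp x - 1) \<ge> 0" using assms by simp
  ultimately have "x powr Re (s - 1) * (1 / (exp x - 1)) \<le> x powr (S - 1) * (2 * exp (- x))"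
    by (intro mult_mono) auto
  moreover have "norm (pos_powr (s - 1) x * bose x) = x powr Re (s - 1) * (1 / (exp x - 1))"
    unfolding norm_mult norm_of_real norm_pos_powr using assms by simp
  ultimately show ?thesis by (simp only: mult_ac)
qed

abbreviation gamma_kernel :: "real \<Rightarrow> real \<Rightarrow> real" where
  "gamma_kernel S x \<equiv> (if x > 0 then x powr (S - 1) else 0) * exp (- x)"

lemma integrable_Gamma_real:
  fixes S :: real
  assumes "S > 0" shows "integrable lborel (\<lambda>x. gamma_kernel S x)"
proof -
  have "(\<lambda>x. norm (pos_powr (of_real S - 1) x * of_real (exp (- x)))) =
      (\<lambda>x. gamma_kernel S x)"
    by (auto simp: fun_eq_iff norm_mult norm_pos_powr)
  then show ?thesis using integrable_norm[OF mellin_exp(1)[of "of_real S"]] assms by simp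
qed

lemma zeta_tail_integrable:
  assumes [measurable]: "Measurable.pred borel P" and "\<And>x. P x \<Longrightarrow> x > 1"
  shows "integrable lborel (\<lambda>x. pos_powr (s - 1) x * (of_bool (P x) * bose x))"
proof (rule Bochner_Integration.integrable_bound)
  define S where "S = max (Re s) 1"
  show "integrable lborel (\<lambda>x. 2 * gamma_kernel S x)"
    by (intro integrable_mult_right integrable_Gamma_real) (simp add: S_def)
  show "AE x in lborel. norm (pos_powr (s - 1) x * (of_bool (P x) * bose x)) \<le>
      norm (2 * gamma_kernel S x)"
  proof (rule AE_I2)
    fix x
    show "norm (pos_powr (s - 1) x * (of_bool (P x) * bose x)) \<le>
      norm (2 * gamma_kernel S x)"
      using zeta_tail_bound[of x s S] assms(2)[of x] by (cases "P x") (auto simp: S_def)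
  qed
qed measurable

text \<open>Integrals over [1, n] are holomorphic by differentiation under the integral. On the unit
  disc around \<open>s0\<close> the remainder is at most a tail of one Gamma integral with exponent
  \<open>S \<ge> Re s\<close>, so convergence is locally uniform.\<close>

lemma zeta_tail_holomorphic: "zeta_tail holomorphic_on UNIV"
proof (rule holomorphic_uniform_sequence)
  define g where "g s x = exp ((s - 1) * of_real (ln x)) * bose x" for s x
  define I where "I n s = integral (cbox 1 (real n)) (g s)" for n s
  have cont: "continuous_on (UNIV \<times> cbox 1 (real n)) (\<lambda>(s, x). of_real (ln x) * g s x)" for n
    unfolding g_def split_beta by (intro continuous_intros) auto
  have cont': "continuous_on (cbox 1 (real n)) (g s)" for n s
    unfolding g_def by (intro continuous_intros) auto
  show "I n holomorphic_on UNIV" for n unfolding I_def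
  proof (rule leibniz_rule_holomorphic)
    show "((\<lambda>s. g s x) has_field_derivative (of_real (ln x) * g s x)) (at s within UNIV)"
      if "x \<in> cbox 1 (real n)" for s x
      using that unfolding g_def by (auto intro!: derivative_eq_intros)
    show "g s integrable_on cbox 1 (real n)" for s by (rule integrable_continuous[OF cont'])
  qed (use cont in auto)
  have I: "I n s = (LINT x|lborel. pos_powr (s - 1) x * (of_bool (1 < x \<and> x \<le> real n) * bose x))" for n s
  proof -
    have "set_integrable lborel (cbox 1 (real n)) (g s)"
      unfolding set_integrable_def by (rule borel_integrable_compact[OF compact_cbox cont'])
    then have "I n s = (LINT x:cbox 1 (real n)|lborel. g s x)"
      unfolding I_def by (simp add: set_borel_integral_eq_integral(2))
    also have "\<dots> = (LINT x|lborel. pos_powr (s - 1) x * (of_bool (1 \<le> x \<and> x \<le> real n) * bose x))"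
      unfolding set_lebesgue_integral_def
      by (intro Bochner_Integration.integral_cong refl) (simp add: g_def pos_powr_eq_exp indicator_def)
    also have "\<dots> = (LINT x|lborel. pos_powr (s - 1) x * (of_bool (1 < x \<and> x \<le> real n) * bose x))"
    proof (rule integral_cong_AE)
      show "AE x in lborel. pos_powr (s - 1) x * (of_bool (1 \<le> x \<and> x \<le> real n) * bose x) =
          pos_powr (s - 1) x * (of_bool (1 < x \<and> x \<le> real n) * bose x)"
        using AE_lborel_singleton[of 1] by eventually_elim (simp add: less_le)
    qed measurable
    finally show ?thesis .
  qed
  fix s0 :: complex
  define S where "S = max (norm s0 + 1) 1"
  have S: "S > 0" by (rule less_le_trans[of 0 1]) (auto simp: S_def)
  define h where "h n x = of_bool (x > real n) * (2 * gamma_kernel S x)" for n x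
  have h_int: "integrable lborel (\<lambda>x. 2 * gamma_kernel S x)"
    by (intro integrable_mult_right integrable_Gamma_real S)
  have [measurable]: "h n \<in> borel_measurable borel" for n unfolding h_def by measurable
  have hn_int: "integrable lborel (h n)" for n
    by (rule Bochner_Integration.integrable_bound[OF h_int]) (auto simp: h_def)
  have lim: "(\<lambda>n. LINT x|lborel. h n x) \<longlonglongrightarrow> (LINT x|(lborel :: real measure). (0::real))"
  proof (rule integral_dominated_convergence)
    show "integrable lborel (\<lambda>x. 2 * gamma_kernel S x)" by (rule h_int)
    show "AE x in lborel. (\<lambda>n. h n x) \<longlonglongrightarrow> 0"
    proof (rule AE_I2)
      fix x :: real
      obtain N where "x < real N" using reals_Archimedean2 by blast
      then have "\<forall>\<^sub>F n in sequentially. h n x = 0"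
        by (auto intro!: eventually_sequentiallyI[of N] simp: h_def)
      then show "(\<lambda>n. h n x) \<longlonglongrightarrow> 0" by (rule tendsto_eventually)
    qed
  qed (auto simp: h_def)
  have bound: "norm (zeta_tail s - I n s) \<le> (LINT x|lborel. h n x)" if s: "s \<in> cball s0 1" and n: "n \<ge> 1" for s n
  proof -
    have "zeta_tail s - I n s = (LINT x|lborel. pos_powr (s - 1) x * (of_bool (x > 1) * bose x) -
        pos_powr (s - 1) x * (of_bool (1 < x \<and> x \<le> real n) * bose x))"
      unfolding zeta_tail_def I by (intro Bochner_Integration.integral_diff[symmetric] zeta_tail_integrable) auto
    also have "\<dots> = (LINT x|lborel. pos_powr (s - 1) x * (of_bool (x > real n) * bose x))"
      using n by (intro Bochner_Integration.integral_cong) auto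
    also have "norm \<dots> \<le> (LINT x|lborel. h n x)"
    proof (rule order_trans[OF integral_norm_bound integral_mono])
      show "integrable lborel (\<lambda>x. norm (pos_powr (s - 1) x * (of_bool (x > real n) * bose x)))"
        using n by (intro integrable_norm zeta_tail_integrable) auto
      have "Re s \<le> norm s0 + 1"
        using complex_Re_le_cmod[of s] norm_triangle_sub[of s s0] s by (simp add: dist_norm norm_minus_commute)
      then show "norm (pos_powr (s - 1) x * (of_bool (x > real n) * bose x)) \<le> h n x" for x
        using zeta_tail_bound[of x s S] n by (auto simp: h_def S_def)
    qed (rule hn_int)
    finally show ?thesis .
  qed
  have "uniform_limit (cball s0 1) I zeta_tail sequentially"
  proof (rule uniform_limitI)
    fix e :: real assume "e > 0"
    then have "\<forall>\<^sub>F n in sequentially. (LINT x|lborel. h n x) < e"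
      using order_tendstoD(2)[OF lim, of e] by simp
    with eventually_ge_at_top[of 1] show "\<forall>\<^sub>F n in sequentially. \<forall>s\<in>cball s0 1. dist (I n s) (zeta_tail s) < e"
    proof eventually_elim
      case (elim n)
      then show ?case using bound by (force simp: dist_norm norm_minus_commute)
    qed
  qed
  then show "\<exists>d>0. cball s0 d \<subseteq> UNIV \<and> uniform_limit (cball s0 d) I zeta_tail sequentially"
    by (intro exI[of _ 1]) auto
qed auto


lemma of_real_of_bool: "complex_of_real (of_bool P) = of_bool P"
  by (cases P) auto

text \<open>For a nonnegative function the integral of the norm is its Mellin transform at the real
  part of \<open>s\<close>. Absolute summability in the termwise integrations below thus follows
  from the closed forms themselves.\<close>

lemma integral_norm_pos_powr:
  assumes "\<And>x. g x \<ge> 0"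
  shows "(LINT x|lborel. norm (pos_powr (s - 1) x * of_real (g x))) =
    norm (LINT x|lborel. pos_powr (of_real (Re s) - 1) x * of_real (g x))"
proof -
  have *: "pos_powr (of_real (Re a)) x * of_real (g x) = of_real (norm (pos_powr a x * of_real (g x)))" for a x
    using assms[of x] by (simp add: norm_mult norm_pos_powr) (simp add: pos_powr_def powr_of_real)
  have "pos_powr (of_real (Re s) - 1) x * of_real (g x) = of_real (norm (pos_powr (s - 1) x * of_real (g x)))" for x
    using *[of "s - 1" x] by (simp only: minus_complex.sel one_complex.sel of_real_diff of_real_1)
  then show ?thesis by (simp add: integral_nonneg_AE del: norm_mult)
qed

text \<open>Termwise integration of the geometric series 1 / (e^x - 1) = sum of e^(-(n+1) x); the
  substitution (n + 1) x produces the Dirichlet factor.\<close>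

lemma zeta_integral:
  assumes "Re s > 1"
  shows "(\<lambda>n. of_nat (Suc n) powr (- s) * Gamma s) sums
    (LINT x|lborel. pos_powr (s - 1) x * bose x)"
proof -
  define f where "f n x = pos_powr (s - 1) x * of_real (exp (- (real (Suc n) * x)))" for n x
  have eq: "exp (- (real (Suc n) * x)) = exp (- x) * exp (- x) ^ n" for n and x :: real
    by (simp add: exp_of_nat_mult[symmetric] algebra_simps flip: exp_add)
  have ints: "integrable lborel (\<lambda>x. pos_powr (s - 1) x * of_real (exp (- (real (Suc n) * x))))"
    "(LINT x|lborel. pos_powr (s - 1) x * of_real (exp (- (real (Suc n) * x)))) = of_nat (Suc n) powr (- s) * Gamma s"
    if "Re s > 0" for n s
    using mellin_scale[OF mellin_exp(1)[OF that], of "real (Suc n)"] mellin_exp(2)[OF that] by simp_all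
  have "(\<lambda>n. LINT x|lborel. f n x) sums (LINT x|lborel. (\<Sum>n. f n x))"
  proof (rule sums_integral)
    show "integrable lborel (f n)" for n unfolding f_def using ints assms by simp
    show "AE x in lborel. summable (\<lambda>n. norm (f n x))"
    proof (rule AE_I2)
      fix x :: real
      show "summable (\<lambda>n. norm (f n x))"
      proof (cases "x > 0")
        case True
        have "norm (f n x) = norm (pos_powr (s - 1) x) * (exp (- x) * exp (- x) ^ n)" for n
          unfolding f_def eq norm_mult norm_of_real by simp
        moreover have "summable (\<lambda>n. exp (- x) ^ n)" using True by (intro summable_geometric) simp
        ultimately show ?thesis by (simp add: summable_mult)
      qed (simp add: f_def pos_powr_def)
    qed
    have "(LINT x|lborel. norm (f n x)) = real (Suc n) powr (- Re s) * norm (Gamma (of_real (Re s) :: complex))" for n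
    proof -
      have "(LINT x|lborel. norm (f n x)) =
        norm (LINT x|lborel. pos_powr (of_real (Re s) - 1) x * of_real (exp (- (real (Suc n) * x))))"
        unfolding f_def by (rule integral_norm_pos_powr) simp
      also have "norm (LINT x|lborel. pos_powr (of_real (Re s) - 1) x * of_real (exp (- (real (Suc n) * x)))) =
          norm (of_nat (Suc n) powr (- of_real (Re s)) * Gamma (of_real (Re s) :: complex))"
        using assms by (subst ints(2)) auto
      also have "\<dots> = real (Suc n) powr (- Re s) * norm (Gamma (of_real (Re s) :: complex))"
        using norm_powr_real_powr[of "of_nat (Suc n)" "- of_real (Re s)"] by (simp add: norm_mult del: of_nat_Suc)
      finally show ?thesis .
    qed
    moreover have "summable (\<lambda>n. real (Suc n) powr (- Re s))"
      using assms by (subst summable_Suc_iff) (simp add: summable_real_powr_iff)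
    ultimately show "summable (\<lambda>n. LINT x|lborel. norm (f n x))" by (simp add: summable_mult2)
  qed
  moreover have "(\<Sum>n. f n x) = pos_powr (s - 1) x * bose x" for x
  proof (cases "x > 0")
    case True
    have "(\<lambda>n. exp (- x) * exp (- x) ^ n) sums (exp (- x) * (1 / (1 - exp (- x))))"
      using True by (intro sums_mult geometric_sums) simp
    also have "exp (- x) * (1 / (1 - exp (- x))) = 1 / (exp x - 1)"
      using True by (simp add: exp_minus field_simps)
    finally have "(\<lambda>n. f n x) sums (pos_powr (s - 1) x * bose x)"
      unfolding f_def eq by (intro sums_mult sums_of_real)
    then show ?thesis by (rule sums_unique[symmetric])
  qed (simp add: f_def pos_powr_def)
  ultimately show ?thesis using ints(2)[of s] assms by (simp add: f_def)
qed

text \<open>On (0, 1] the integrand is x^(s-2) times the power series of x / (e^x - 1), and the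
  integral of x^(s+k-2) is 1 / (s + k - 1). Summability of \<open>bern\<close> dominates all terms
  at once.\<close>

lemma zeta_head_integral:
  assumes "Re s > 1"
  shows "integrable lborel (\<lambda>x. pos_powr (s - 1) x * (of_bool (x \<le> 1) * bose x))" (is ?A)
    and "(\<lambda>k. bern k / (s + of_nat k - 1)) sums
      (LINT x|lborel. pos_powr (s - 1) x * (of_bool (x \<le> 1) * bose x))" (is ?B)
proof -
  define f where "f k x = bern k * (pos_powr (s + of_nat k - 1 - 1) x * of_bool (x \<le> 1))" for k x
  have ints: "integrable lborel (\<lambda>x. pos_powr (s + of_nat k - 1 - 1) x * of_bool (x \<le> 1))"
    "(LINT x|lborel. pos_powr (s + of_nat k - 1 - 1) x * of_bool (x \<le> 1)) = 1 / (s + of_nat k - 1)"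
    if "Re s > 1" for s k using that mellin_Icc[of "s + of_nat k - 1"] by simp_all
  have int: "integrable lborel (f k)" for k unfolding f_def using ints[OF assms] by simp
  have ae: "AE x in lborel. summable (\<lambda>k. norm (f k x))"
  proof (rule AE_I2)
    fix x :: real
    show "summable (\<lambda>k. norm (f k x))"
    proof (rule summable_comparison_test'[of "\<lambda>k. norm (bern k) * norm (pos_powr (s - 2) x)" 0])
      show "summable (\<lambda>k. norm (bern k) * norm (pos_powr (s - 2) x))" by (intro summable_mult2 bern_summable)
      fix k :: nat
      have "x powr (Re s + real k - 2) \<le> x powr (Re s - 2)" if "0 < x" "x \<le> 1"
        using that powr_mono'[of "Re s - 2" "Re s + real k - 2" x] by simp
      then show "norm (norm (f k x)) \<le> norm (bern k) * norm (pos_powr (s - 2) x)"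
        by (auto simp: f_def norm_mult norm_pos_powr intro!: mult_left_mono)
    qed
  qed
  have summ: "summable (\<lambda>k. LINT x|lborel. norm (f k x))"
  proof (rule summable_comparison_test'[of "\<lambda>k. norm (bern k) * (1 / (Re s - 1))" 0])
    show "summable (\<lambda>k. norm (bern k) * (1 / (Re s - 1)))" by (intro summable_mult2 bern_summable)
    fix k :: nat
    have "(LINT x|lborel. norm (f k x)) =
        norm (bern k) * (LINT x|lborel. norm (pos_powr (s + of_nat k - 1 - 1) x * of_real (of_bool (x \<le> 1))))"
    proof -
      have "norm (of_bool P :: complex) = norm (complex_of_real (of_bool P))" for P by (cases P) auto
      then show ?thesis unfolding f_def norm_mult by simp
    qed
    also have "\<dots> = norm (bern k) * norm (LINT x|lborel. pos_powr (of_real (Re (s + of_nat k - 1)) - 1) x * of_real (of_bool (x \<le> 1)))"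
      by (subst integral_norm_pos_powr) auto
    also have "of_real (Re (s + of_nat k - 1)) = (of_real (Re s) + of_nat k - 1 :: complex)" by simp
    also have "(LINT x|lborel. pos_powr (of_real (Re s) + of_nat k - 1 - 1) x * of_real (of_bool (x \<le> 1))) = 1 / (of_real (Re s) + of_nat k - 1)"
      using ints(2)[of "of_real (Re s)" k] assms of_real_of_bool by simp
    also have "norm (1 / (of_real (Re s) + of_nat k - 1 :: complex)) = 1 / (Re s + real k - 1)"
    proof -
      have "(of_real (Re s) + of_nat k - 1 :: complex) = of_real (Re s + real k - 1)" by simp
      then show ?thesis using assms by (simp only: norm_divide norm_of_real norm_one)
    qed
    also have "\<dots> \<le> 1 / (Re s - 1)" using assms by (intro divide_left_mono) auto
    finally show "norm (LINT x|lborel. norm (f k x)) \<le> norm (bern k) * (1 / (Re s - 1))"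
      by (simp add: integral_nonneg_AE mult_left_mono)
  qed
  have sum: "(\<Sum>k. f k x) = pos_powr (s - 1) x * (of_bool (x \<le> 1) * bose x)" for x
  proof (cases "0 < x \<and> x \<le> 1")
    case True
    have "(\<lambda>k. bern k * of_real x ^ k) sums (1 / exp_quot (of_real x))" using True by (intro bern_sums) simp
    then have "(\<lambda>k. pos_powr (s - 2) x * (bern k * of_real x ^ k)) sums (pos_powr (s - 2) x * (1 / exp_quot (of_real x)))"
      by (rule sums_mult)
    moreover have "pos_powr (s - 2) x * (bern k * of_real x ^ k) = f k x" for k
    proof -
      have "pos_powr (s + of_nat k - 1 - 1) x = pos_powr (s - 2) x * pos_powr (of_nat k) x"
        using pos_powr_add[of "s - 2" "of_nat k" x] by (simp add: algebra_simps)
      moreover have "pos_powr (of_nat k) x = of_real x ^ k"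
        using True by (simp add: pos_powr_def powr_nat')
      ultimately show ?thesis using True by (simp add: f_def)
    qed
    moreover have "pos_powr (s - 2) x * (1 / exp_quot (of_real x)) = pos_powr (s - 1) x * bose x"
    proof -
      have "pos_powr (s - 1) x = pos_powr (s - 2) x * of_real x"
        using True pos_powr_add[of "s - 2" 1 x] by (simp add: pos_powr_def)
      then show ?thesis using True by (simp add: exp_quot_def exp_of_real)
    qed
    ultimately have "(\<lambda>k. f k x) sums (pos_powr (s - 1) x * bose x)" by simp
    then show ?thesis using True by (simp add: sums_iff)
  qed (auto simp: f_def pos_powr_def)
  show ?A using integrable_suminf[OF int ae summ] unfolding sum .
  show ?B using sums_integral[OF int ae summ] ints[OF assms] unfolding sum by (simp add: f_def)
qed

lemma zeta_dirichlet_sums: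
  assumes "Re s > 1"
  shows "(\<lambda>n. of_nat (Suc n) powr (- s)) sums
    (rGamma s * ((\<Sum>k. bern k / (s + of_nat k - 1)) + zeta_tail s))"
proof -
  have G: "Gamma s \<noteq> 0" "rGamma s = inverse (Gamma s)"
    using assms by (auto simp: Gamma_eq_zero_iff rGamma_inverse_Gamma elim!: nonpos_Ints_cases)
  have "(LINT x|lborel. pos_powr (s - 1) x * bose x) =
    (LINT x|lborel. pos_powr (s - 1) x * (of_bool (x \<le> 1) * bose x) +
       pos_powr (s - 1) x * (of_bool (x > 1) * bose x))"
    by (intro Bochner_Integration.integral_cong) auto
  also have "\<dots> = (\<Sum>k. bern k / (s + of_nat k - 1)) + zeta_tail s" unfolding zeta_tail_def
    unfolding sums_unique[OF zeta_head_integral(2)[OF assms], symmetric]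
    by (intro Bochner_Integration.integral_add zeta_head_integral(1) zeta_tail_integrable assms) auto
  finally have "(\<lambda>n. rGamma s * (of_nat (Suc n) powr (- s) * Gamma s)) sums
      (rGamma s * ((\<Sum>k. bern k / (s + of_nat k - 1)) + zeta_tail s))"
    using sums_mult[OF zeta_integral[OF assms], of "rGamma s"] by simp
  moreover have "rGamma s * (of_nat (Suc n) powr (- s) * Gamma s) = of_nat (Suc n) powr (- s)" for n
    using G by simp
  ultimately show ?thesis by (simp only:)
qed


text \<open>An entire version of bern (k+1) rGamma(s) / (s + k): in rGamma(s) = pochhammer s (k+1)
  rGamma(s+k+1) the last factor s + k of the Pochhammer product has been cancelled. The summand of
  index 0 in the head series carries the pole at 1 and stays separate in
  \<open>zeta_ext\<close>.\<close>

definition zeta_term :: "nat \<Rightarrow> complex \<Rightarrow> complex" where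
  "zeta_term k s = bern (Suc k) * rGamma (s + of_nat (Suc k)) * pochhammer s k"

definition zeta_ext :: "complex \<Rightarrow> complex" where
  "zeta_ext s = (if s = 1 then 0 else rGamma s / (s - 1) +
     (\<Sum>k. zeta_term k s) + rGamma s * zeta_tail s)"

lemma zeta_term_eq:
  "(s + of_nat k) * zeta_term k s = bern (Suc k) * rGamma s"
  by (simp add: zeta_term_def pochhammer_rGamma[of s "Suc k"] pochhammer_Suc mult_ac)

lemma zeta_ext_series_holomorphic:
  "(\<lambda>s. \<Sum>k. zeta_term k s) holomorphic_on UNIV"
proof (rule holomorphic_uniform_sequence)
  show "(\<lambda>s. \<Sum>k<n. zeta_term k s) holomorphic_on UNIV" for n
    unfolding zeta_term_def pochhammer_prod by (intro holomorphic_intros)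
  fix s0 :: complex
  have "compact (rGamma ` cball s0 1)" by (intro compact_continuous_image continuous_intros) auto
  then obtain K where K: "\<And>s. s \<in> cball s0 1 \<Longrightarrow> norm (rGamma s) \<le> K"
    by (meson bounded_iff compact_imp_bounded image_eqI)
  have "uniform_limit (cball s0 1) (\<lambda>n s. \<Sum>k<n. zeta_term k s)
     (\<lambda>s. \<Sum>k. zeta_term k s) sequentially"
  proof (rule Weierstrass_m_test_ev)
    show "summable (\<lambda>k. norm (bern (Suc k)) * K)"
      using bern_summable by (intro summable_mult2) (subst summable_Suc_iff)
    \<comment> \<open>For k at least N, |s + k| is at least 1 on the whole disc, so
      \<open>zeta_term_eq\<close> bounds the term by its right-hand side. The finitely many earlier
      terms, which may have s + k near 0, are entire anyway.\<close>
    obtain N :: nat where N: "norm s0 + 2 \<le> real N" using real_arch_simple by blast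
    show "\<forall>\<^sub>F k in sequentially. \<forall>s\<in>cball s0 1.
        norm (zeta_term k s) \<le> norm (bern (Suc k)) * K"
    proof (intro eventually_sequentiallyI[of N] ballI)
      fix k s assume "N \<le> k" and s: "s \<in> cball s0 1"
      have "norm s \<le> norm s0 + 1" using s norm_triangle_sub[of s s0] by (simp add: dist_norm norm_minus_commute)
      moreover have "norm (of_nat k :: complex) \<le> norm (s + of_nat k) + norm s"
        using norm_triangle_ineq4[of "s + of_nat k" s] by simp
      ultimately have 1: "1 \<le> norm (s + of_nat k)" using N \<open>N \<le> k\<close> by simp
      have "norm (zeta_term k s) \<le>
          norm (s + of_nat k) * norm (zeta_term k s)"
        using 1 by (simp add: mult_le_cancel_right1)
      also have "\<dots> = norm (bern (Suc k)) * norm (rGamma s)"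
        unfolding norm_mult[symmetric] zeta_term_eq ..
      also have "\<dots> \<le> norm (bern (Suc k)) * K" using K[OF s] by (intro mult_left_mono) auto
      finally show "norm (zeta_term k s) \<le> norm (bern (Suc k)) * K" .
    qed
  qed
  then show "\<exists>d>0. cball s0 d \<subseteq> UNIV \<and> uniform_limit (cball s0 d)
      (\<lambda>n s. \<Sum>k<n. zeta_term k s)
      (\<lambda>s. \<Sum>k. zeta_term k s) sequentially"
    by (intro exI[of _ 1]) auto
qed auto

lemma zeta_ext_holomorphic: "zeta_ext holomorphic_on (- {1})"
proof -
  have "(\<lambda>s. rGamma s / (s - 1) +
     (\<Sum>k. zeta_term k s) + rGamma s * zeta_tail s) holomorphic_on (- {1})"
    by (intro holomorphic_intros holomorphic_on_subset[OF zeta_ext_series_holomorphic]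
        holomorphic_on_subset[OF zeta_tail_holomorphic]) auto
  then show ?thesis by (rule holomorphic_transform) (simp add: zeta_ext_def)
qed

lemma zeta_ext_sums:
  assumes "Re s > 1" shows "(\<lambda>n. of_nat (Suc n) powr (- s)) sums zeta_ext s"
proof -
  have nz: "s + of_nat k \<noteq> 0" for k using assms by (auto simp: complex_eq_iff)
  have s1: "s \<noteq> 1" using assms by auto
  have "zeta_term k s = rGamma s * (bern (Suc k) / (s + of_nat (Suc k) - 1))" for k
    using zeta_term_eq[of s k] nz[of k] by (simp add: field_simps)
  moreover have "(\<lambda>k. bern k / (s + of_nat k - 1)) sums (\<Sum>k. bern k / (s + of_nat k - 1))"
    using zeta_head_integral(2)[OF assms] by (auto simp: sums_iff)
  then have "(\<lambda>k. bern (Suc k) / (s + of_nat (Suc k) - 1)) sums ((\<Sum>k. bern k / (s + of_nat k - 1)) - 1 / (s - 1))"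
    by (subst sums_Suc_iff) simp
  then have "(\<lambda>k. rGamma s * (bern (Suc k) / (s + of_nat (Suc k) - 1))) sums
      (rGamma s * ((\<Sum>k. bern k / (s + of_nat k - 1)) - 1 / (s - 1)))" by (rule sums_mult)
  ultimately have "(\<Sum>k. zeta_term k s) =
      rGamma s * ((\<Sum>k. bern k / (s + of_nat k - 1)) - 1 / (s - 1))"
    by (simp only: sums_iff)
  then have "zeta_ext s = rGamma s * ((\<Sum>k. bern k / (s + of_nat k - 1)) + zeta_tail s)"
    using s1 by (simp add: zeta_ext_def algebra_simps)
  then show ?thesis using zeta_dirichlet_sums[OF assms] by simp
qed

lemma riemann_zeta_eq: "riemann_zeta = zeta_ext"
  unfolding riemann_zeta_def
proof (rule the_equality)
  show "zeta_ext holomorphic_on - {1} \<and>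
    (\<forall>s. 1 < Re s \<longrightarrow> (\<lambda>n. of_nat (Suc n) powr - s) sums zeta_ext s) \<and> zeta_ext 1 = 0"
    using zeta_ext_holomorphic zeta_ext_sums by (simp add: zeta_ext_def)
next
  fix f :: "complex \<Rightarrow> complex"
  assume f: "f holomorphic_on - {1} \<and> (\<forall>s. 1 < Re s \<longrightarrow> (\<lambda>n. of_nat (Suc n) powr - s) sums f s) \<and> f 1 = 0"
  have "f s = zeta_ext s" if "s \<noteq> 1" for s
  proof (rule analytic_continuation_open[of "{s. Re s > 1}" "- {1}" f zeta_ext])
    show "{s. Re s > 1} \<noteq> {}" by (auto intro!: exI[of _ 2])
    show "connected (- {1 :: complex})" by (intro connected_punctured_universe) simp
    show "f z = zeta_ext z" if "z \<in> {s. Re s > 1}" for z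
      using that f zeta_ext_sums[of z] sums_unique2 by blast
  qed (use f zeta_ext_holomorphic that in \<open>auto simp: open_halfspace_Re_gt\<close>)
  then show "f = zeta_ext" using f by (auto simp: fun_eq_iff zeta_ext_def)
qed

lemma riemann_zeta_holomorphic: "riemann_zeta holomorphic_on (- {1})"
  unfolding riemann_zeta_eq by (rule zeta_ext_holomorphic)

lemma riemann_zeta_sums: "Re s > 1 \<Longrightarrow> (\<lambda>n. of_nat (Suc n) powr (- s)) sums riemann_zeta s"
  unfolding riemann_zeta_eq by (rule zeta_ext_sums)

lemma riemann_zeta_simple_pole:
  obtains F where "F holomorphic_on UNIV" "F 1 = 1" "\<And>s. s \<noteq> 1 \<Longrightarrow> riemann_zeta s = F s / (s - 1)"
proof
  define F where "F s = rGamma s + (s - 1) * ((\<Sum>k. zeta_term k s) +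
    rGamma s * zeta_tail s)" for s
  show "F holomorphic_on UNIV" unfolding F_def
    by (intro holomorphic_intros zeta_ext_series_holomorphic zeta_tail_holomorphic)
  show "F 1 = 1" by (simp add: F_def)
  show "riemann_zeta s = F s / (s - 1)" if "s \<noteq> 1" for s
    using that by (simp add: F_def riemann_zeta_eq zeta_ext_def add_divide_distrib)
qed

text \<open>At \<open>s = - 2 j\<close> only the term with \<open>k = 2 j\<close> survives, and its Bernoulli number vanishes.\<close>

lemma riemann_zeta_trivial_zero:
  assumes "j > 0" shows "riemann_zeta (- of_nat (2 * j)) = 0"
proof -
  define s :: complex where "s = - of_nat (2 * j)"
  have rG: "rGamma s = 0" unfolding s_def by (simp add: rGamma_eq_zero_iff del: of_nat_mult)
  have "zeta_term k s = 0" for k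
  proof -
    consider "k < 2 * j" | "k = 2 * j" | "k > 2 * j" by linarith
    then show ?thesis
    proof cases
      case 1
      then have "s + of_nat (Suc k) = - of_nat (2 * j - Suc k)" by (simp add: s_def of_nat_diff del: of_nat_mult)
      then have "rGamma (s + of_nat (Suc k)) = 0" by (simp only: rGamma_eq_zero_iff) simp
      then show ?thesis by (simp add: zeta_term_def)
    next
      case 2
      then show ?thesis using assms bern_odd[of "Suc k"] by (simp add: zeta_term_def)
    next
      case 3
      then have "pochhammer s k = 0" unfolding s_def by (simp add: pochhammer_of_nat_eq_0_lemma del: of_nat_mult)
      then show ?thesis by (simp add: zeta_term_def)
    qed
  qed
  then have "(\<Sum>k. zeta_term k s) = 0" by (simp only: suminf_zero)
  moreover have "s \<noteq> 1" using assms by (auto simp: s_def complex_eq_iff)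
  ultimately show ?thesis unfolding s_def[symmetric] using rG by (simp add: riemann_zeta_eq zeta_ext_def)
qed

section \<open>Moments and tails of the normal distribution\<close>

lemma change_of_variables_complex:
  fixes h :: "real \<Rightarrow> complex"
  assumes S: "S \<in> sets lebesgue" and d: "\<And>x. x \<in> S \<Longrightarrow> (g has_real_derivative g' x) (at x within S)"
    and inj: "inj_on g S" and h: "h absolutely_integrable_on (g ` S)"
  shows "(\<lambda>x. of_real \<bar>g' x\<bar> * h (g x)) absolutely_integrable_on S"
    and "integral S (\<lambda>x. of_real \<bar>g' x\<bar> * h (g x)) = integral (g ` S) h"
proof -
  have hRe: "(\<lambda>x. Re (h x)) absolutely_integrable_on (g ` S)" and hIm: "(\<lambda>x. Im (h x)) absolutely_integrable_on (g ` S)"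
    using absolutely_integrable_linear[OF h bounded_linear_Re] absolutely_integrable_linear[OF h bounded_linear_Im]
    by (simp_all add: o_def)
  note cv = has_absolute_integral_change_of_variables_1'[OF S d inj]
  have R: "(\<lambda>x. \<bar>g' x\<bar> * Re (h (g x))) absolutely_integrable_on S"
      "integral S (\<lambda>x. \<bar>g' x\<bar> * Re (h (g x))) = integral (g ` S) (\<lambda>x. Re (h x))"
    and I: "(\<lambda>x. \<bar>g' x\<bar> * Im (h (g x))) absolutely_integrable_on S"
      "integral S (\<lambda>x. \<bar>g' x\<bar> * Im (h (g x))) = integral (g ` S) (\<lambda>x. Im (h x))"
    using cv[of "\<lambda>x. Re (h x)"] cv[of "\<lambda>x. Im (h x)"] hRe hIm by blast+
  have eq: "of_real \<bar>g' x\<bar> * h (g x) = of_real (\<bar>g' x\<bar> * Re (h (g x))) + \<i> * of_real (\<bar>g' x\<bar> * Im (h (g x)))" for x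
    by (simp add: complex_eq_iff)
  have R': "(\<lambda>x. complex_of_real (\<bar>g' x\<bar> * Re (h (g x)))) absolutely_integrable_on S"
    and I': "(\<lambda>x. \<i> * complex_of_real (\<bar>g' x\<bar> * Im (h (g x)))) absolutely_integrable_on S"
    using absolutely_integrable_linear[OF R(1) bounded_linear_of_real]
      absolutely_integrable_linear[OF I(1) bounded_linear_compose[OF bounded_linear_mult_right[of \<i>] bounded_linear_of_real]]
    by (simp_all add: o_def)
  show "(\<lambda>x. of_real \<bar>g' x\<bar> * h (g x)) absolutely_integrable_on S"
    unfolding eq by (rule set_integral_add(1)[OF R' I'])
  then have int: "(\<lambda>x. of_real \<bar>g' x\<bar> * h (g x)) integrable_on S" using set_lebesgue_integral_eq_integral(1) by blast
  have hint: "h integrable_on g ` S" using h set_lebesgue_integral_eq_integral(1) by blast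
  show "integral S (\<lambda>x. of_real \<bar>g' x\<bar> * h (g x)) = integral (g ` S) h"
    using integral_linear[OF int bounded_linear_Re] integral_linear[OF int bounded_linear_Im]
      integral_linear[OF hint bounded_linear_Re] integral_linear[OF hint bounded_linear_Im] R(2) I(2)
    by (auto simp: complex_eq_iff o_def)
qed

text \<open>Substitution u = x^2: the factor 2 x of du raises the exponent 2 (s - 1) to 2 s - 1 and
  leaves the factor 1/2.\<close>

lemma mellin_square:
  assumes int: "integrable lborel (\<lambda>u. pos_powr (s - 1) u * g u)" and [measurable]: "g \<in> borel_measurable borel"
  shows "integrable lborel (\<lambda>x. pos_powr (2 * s - 1) x * g (x\<^sup>2))" (is ?A)
    and "(LINT x|lborel. pos_powr (2 * s - 1) x * g (x\<^sup>2)) = (LINT u|lborel. pos_powr (s - 1) u * g u) / 2" (is ?B)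
proof -
  define h where "h u = pos_powr (s - 1) u * g u" for u
  have [measurable]: "h \<in> borel_measurable borel" unfolding h_def by measurable
  have img: "(\<lambda>x::real. x\<^sup>2) ` {0<..} = {0<..}"
  proof -
    have "u \<in> (\<lambda>x::real. x\<^sup>2) ` {0<..}" if "u > 0" for u :: real
      using that by (intro image_eqI[of _ _ "sqrt u"]) auto
    then show ?thesis by auto
  qed
  have leb: "integrable lebesgue h" using int unfolding h_def by (subst integrable_completion) auto
  have h0: "h u = 0" if "u \<notin> {0<..}" for u using that by (simp add: h_def pos_powr_def)
  have ind: "indicator {0<..} u *\<^sub>R h u = h u" for u using h0[of u] by (auto simp: indicator_def)
  have habs: "h absolutely_integrable_on ((\<lambda>x::real. x\<^sup>2) ` {0<..})"
    unfolding img set_integrable_def ind by (rule leb)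
  have inj: "inj_on (\<lambda>x::real. x\<^sup>2) {0<..}" by (auto simp: inj_on_def power2_eq_iff)
  have der: "((\<lambda>x. x\<^sup>2) has_real_derivative 2 * x) (at x within {0<..})" for x
    by (auto intro!: derivative_eq_intros)
  have sets: "{0<..} \<in> sets (lebesgue :: real measure)" by simp
  note cv = change_of_variables_complex[OF sets der inj habs]
  have val: "integral {0<..} h = integral\<^sup>L lborel h"
  proof -
    have "(h has_integral integral\<^sup>L lborel h) UNIV"
      using has_integral_integral_lborel int unfolding h_def by blast
    then have "((\<lambda>u. if u \<in> {0<..} then h u else 0) has_integral integral\<^sup>L lborel h) UNIV"
      by (rule has_integral_eq[rotated]) (use h0 in auto)
    then have "(h has_integral integral\<^sup>L lborel h) {0<..}" by (simp only: has_integral_restrict_UNIV)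
    then show ?thesis by (rule integral_unique)
  qed
  have hi: "((\<lambda>x. of_real \<bar>2 * x\<bar> * h (x\<^sup>2)) has_integral integral\<^sup>L lborel h) {0<..}"
    using cv unfolding img val using set_lebesgue_integral_eq_integral(1) integrable_integral by metis
  have eq: "2 * (pos_powr (2 * s - 1) x * g (x\<^sup>2)) = (if x \<in> {0<..} then of_real \<bar>2 * x\<bar> * h (x\<^sup>2) else 0)" for x
  proof (cases "x > 0")
    case True
    have "pos_powr (2 * s - 1) x = of_real x * pos_powr (s - 1) (x\<^sup>2)"
    proof -
      have "of_real x * pos_powr (s - 1) (x\<^sup>2) = exp (of_real (ln x)) * exp ((s - 1) * of_real (2 * ln x))"
        using True by (simp add: pos_powr_eq_exp ln_realpow exp_of_real)
      also have "\<dots> = pos_powr (2 * s - 1) x"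
        using True by (simp add: pos_powr_eq_exp exp_add[symmetric] algebra_simps)
      finally show ?thesis ..
    qed
    then show ?thesis using True by (simp add: h_def)
  qed (simp add: pos_powr_def)
  note fin = integrable_lborel_of_lebesgue[OF cv(1) hi, of "\<lambda>x. 2 * (pos_powr (2 * s - 1) x * g (x\<^sup>2))"]
  have i2: "integrable lborel (\<lambda>x. 2 * (pos_powr (2 * s - 1) x * g (x\<^sup>2)))" by (rule fin(1)) (use eq in auto)
  from integrable_mult_right[OF this, of "1 / 2"] show ?A by simp
  have "(LINT x|lborel. 2 * (pos_powr (2 * s - 1) x * g (x\<^sup>2))) = integral\<^sup>L lborel h" by (rule fin(2)) (use eq in auto)
  moreover have "integral\<^sup>L lborel h = (LINT u|lborel. pos_powr (s - 1) u * g u)"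
    by (simp add: h_def[abs_def])
  ultimately show ?B by (simp add: mult.commute)
qed

text \<open>The analytic expression for E |W|^p, where W is centred Gaussian with variance
  \<open>t\<close>.\<close>

definition abs_moment :: "real \<Rightarrow> complex \<Rightarrow> complex" where
  "abs_moment t p = of_real (2 * t) powr (p / 2) * Gamma ((p + 1) / 2) / of_real (sqrt pi)"

lemma abs_moment_normal:
  assumes "t > 0" "Re p > -1"
  shows "integrable lborel (\<lambda>x. pos_powr p \<bar>x\<bar> * of_real (normal_density 0 (sqrt t) x))" (is ?A)
    and "(LINT x|lborel. pos_powr p \<bar>x\<bar> * of_real (normal_density 0 (sqrt t) x)) = abs_moment t p" (is ?B)
proof -
  let ?\<phi> = "\<lambda>x. complex_of_real (normal_density 0 (sqrt t) x)"
  \<comment> \<open>The scaling that turns the Gaussian density into a multiple of exp (-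
    x^2).\<close>
  define c where "c = 1 / sqrt (2 * t)"
  have c: "c > 0" using assms by (simp add: c_def)
  have Re: "Re ((p + 1) / 2) > 0" using assms by simp
  note m1 = mellin_exp[OF Re]
  have "integrable lborel (\<lambda>x. pos_powr (2 * ((p + 1) / 2) - 1) x * of_real (exp (- x\<^sup>2)))"
    "(LINT x|lborel. pos_powr (2 * ((p + 1) / 2) - 1) x * of_real (exp (- x\<^sup>2))) = Gamma ((p + 1) / 2) / 2"
    using mellin_square[OF m1(1)] m1(2) by simp_all
  then have m2: "integrable lborel (\<lambda>x. pos_powr p x * of_real (exp (- x\<^sup>2)))"
    "(LINT x|lborel. pos_powr p x * of_real (exp (- x\<^sup>2))) = Gamma ((p + 1) / 2) / 2"
    by (simp_all add: field_simps)
  define C where "C = 1 / sqrt (2 * pi * t)"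
  have \<phi>: "normal_density 0 (sqrt t) x = C * exp (- (c * x)\<^sup>2)" for x
    using assms by (simp add: normal_density_def C_def c_def power_mult_distrib power_divide)
  have m3: "integrable lborel (\<lambda>x. pos_powr p x * ?\<phi> x)"
    "(LINT x|lborel. pos_powr p x * ?\<phi> x) = of_real C * (of_real c powr (- p - 1) * (Gamma ((p + 1) / 2) / 2))"
  proof -
    have eq: "pos_powr p x * ?\<phi> x = of_real C * (pos_powr p x * of_real (exp (- (c * x)\<^sup>2)))" for x
      unfolding \<phi> by simp
    show "integrable lborel (\<lambda>x. pos_powr p x * ?\<phi> x)"
      unfolding eq by (intro integrable_mult_right mellin_scale(1)[OF m2(1) c])
    show "(LINT x|lborel. pos_powr p x * ?\<phi> x) = of_real C * (of_real c powr (- p - 1) * (Gamma ((p + 1) / 2) / 2))"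
      unfolding eq using mellin_scale(2)[OF m2(1) c] m2(2) by simp
  qed
  have split: "pos_powr p \<bar>x\<bar> * ?\<phi> x =
      pos_powr p x * ?\<phi> x + pos_powr p (- x) * ?\<phi> (- x)" for x
    by (auto simp: pos_powr_def normal_density_def abs_if)
  have neg: "integrable lborel (\<lambda>x. pos_powr p (- x) * ?\<phi> (- x))"
    "(LINT x|lborel. pos_powr p (- x) * ?\<phi> (- x)) = (LINT x|lborel. pos_powr p x * ?\<phi> x)"
    using lborel_integrable_real_affine[OF m3(1), of "-1" 0]
      lborel_integral_real_affine[of "-1" "\<lambda>x. pos_powr p x * ?\<phi> x" 0] by simp_all
  show ?A unfolding split using m3(1) neg(1) by (rule Bochner_Integration.integrable_add)
  have "(LINT x|lborel. pos_powr p \<bar>x\<bar> * ?\<phi> x) =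
      of_real C * (of_real c powr (- p - 1) * Gamma ((p + 1) / 2))"
    unfolding split Bochner_Integration.integral_add[OF m3(1) neg(1)] neg(2) m3(2) by simp
  also have "of_real C * (of_real c powr (- p - 1) * Gamma ((p + 1) / 2)) = abs_moment t p"
  proof -
    have a: "of_real c powr (- p - 1) = of_real (2 * t) powr (p / 2) * of_real (sqrt (2 * t))"
    proof -
      have lc: "ln c = - (ln (2 * t) / 2)" using assms by (simp add: c_def ln_div ln_sqrt)
      have s: "sqrt (2 * t) = exp (ln (2 * t) / 2)" using assms by (simp add: ln_sqrt[symmetric])
      have "of_real c powr (- p - 1) = exp ((- p - 1) * of_real (ln c))"
        using c by (simp add: powr_def Ln_of_real)
      also have "\<dots> = exp (p / 2 * of_real (ln (2 * t))) * exp (of_real (ln (2 * t) / 2))"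
        unfolding lc exp_add[symmetric] by (rule arg_cong[where f = exp]) (simp add: field_simps)
      also have "\<dots> = of_real (2 * t) powr (p / 2) * of_real (sqrt (2 * t))"
        unfolding s using assms Ln_of_real[of "2 * t"] by (simp add: powr_def exp_of_real[symmetric] del: of_real_mult)
      finally show ?thesis .
    qed
    have "C * sqrt (2 * t) = 1 / sqrt pi"
      using assms by (simp add: C_def real_sqrt_mult)
    then have b: "of_real C * of_real (sqrt (2 * t)) = (1 / of_real (sqrt pi) :: complex)"
      by (metis of_real_1 of_real_divide of_real_mult)
    have "of_real C * (of_real c powr (- p - 1) * Gamma ((p + 1) / 2)) =
        (of_real C * of_real (sqrt (2 * t))) * (of_real (2 * t) powr (p / 2) * Gamma ((p + 1) / 2))"
      unfolding a by (simp only: mult_ac)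
    then show ?thesis unfolding b abs_moment_def by simp
  qed
  finally show ?B .
qed

section \<open>Mellin transform of the Gaussian tail probability\<close>

definition normal_tail :: "real \<Rightarrow> real \<Rightarrow> real" where
  "normal_tail t a = (LINT x|lborel. normal_density 0 (sqrt t) x * of_bool (a \<le> \<bar>x\<bar>))"

lemma normal_tail_measurable [measurable]: "normal_tail t \<in> borel_measurable borel"
  unfolding normal_tail_def[abs_def] by measurable

lemma normal_tail_nonneg: "normal_tail t a \<ge> 0"
  unfolding normal_tail_def by (intro integral_nonneg_AE) auto

lemma mellin_le_abs:
  assumes "Re p > 0" "x \<noteq> 0"
  shows "integrable lborel (\<lambda>\<epsilon>. pos_powr (p - 1) \<epsilon> * of_bool (\<epsilon> \<le> \<bar>x\<bar>))"
    and "(LINT \<epsilon>|lborel. pos_powr (p - 1) \<epsilon> * of_bool (\<epsilon> \<le> \<bar>x\<bar>)) = pos_powr p \<bar>x\<bar> / p"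
proof -
  have eq: "(of_bool (\<epsilon> \<le> \<bar>x\<bar>) :: complex) = of_bool (1 / \<bar>x\<bar> * \<epsilon> \<le> 1)" for \<epsilon>
    using assms by (simp add: divide_le_eq_1)
  have c: "1 / \<bar>x\<bar> > 0" using assms by simp
  note ms = mellin_scale[where g = "\<lambda>x. of_bool (x \<le> 1)", OF mellin_Icc(1)[OF assms(1)] c]
  show "integrable lborel (\<lambda>\<epsilon>. pos_powr (p - 1) \<epsilon> * of_bool (\<epsilon> \<le> \<bar>x\<bar>))" unfolding eq by (rule ms(1))
  have "of_real (1 / \<bar>x\<bar>) powr (- p) = pos_powr p \<bar>x\<bar>"
    using assms Ln_of_real[of "\<bar>x\<bar>"] Ln_of_real[of "1 / \<bar>x\<bar>"]
    by (simp add: pos_powr_def powr_def ln_div del: of_real_divide)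
  then show "(LINT \<epsilon>|lborel. pos_powr (p - 1) \<epsilon> * of_bool (\<epsilon> \<le> \<bar>x\<bar>)) = pos_powr p \<bar>x\<bar> / p"
    unfolding eq ms(2) mellin_Icc(2)[OF assms(1)] by simp
qed

text \<open>Layer cake: exchanging the integrals over \<epsilon> and x leaves the integral of
  \<epsilon>^(p-1) up to |x|, which is |x|^p / p. The exchange is justified by the absolute moment
  of order \<open>Re p\<close>.\<close>

lemma mellin_normal_tail:
  assumes "t > 0" "Re p > 0"
  shows "integrable lborel (\<lambda>\<epsilon>. pos_powr (p - 1) \<epsilon> * of_real (normal_tail t \<epsilon>))" (is ?A)
    and "(LINT \<epsilon>|lborel. pos_powr (p - 1) \<epsilon> * of_real (normal_tail t \<epsilon>)) = abs_moment t p / p" (is ?B)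
proof -
  define \<phi> where "\<phi> = normal_density 0 (sqrt t)"
  have \<phi>0: "\<phi> x \<ge> 0" for x by (simp add: \<phi>_def)
  have [measurable]: "\<phi> \<in> borel_measurable borel" unfolding \<phi>_def by measurable
  define K where "K x \<epsilon> = of_real (\<phi> x) * (pos_powr (p - 1) \<epsilon> * of_bool (\<epsilon> \<le> \<bar>x\<bar>))" for x \<epsilon>
  have int_x: "integrable lborel (K x)" "(LINT \<epsilon>|lborel. K x \<epsilon>) = pos_powr p \<bar>x\<bar> * of_real (\<phi> x) / p" if "x \<noteq> 0" for x
    unfolding K_def using mellin_le_abs[OF assms(2) that] by simp_all
  have norm_x: "(LINT \<epsilon>|lborel. norm (K x \<epsilon>)) = norm (pos_powr p \<bar>x\<bar> * of_real (\<phi> x)) / Re p" if "x \<noteq> 0" for x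
  proof -
    have "(LINT \<epsilon>|lborel. norm (K x \<epsilon>)) = \<phi> x * (LINT \<epsilon>|lborel. norm (pos_powr (p - 1) \<epsilon> * of_real (of_bool (\<epsilon> \<le> \<bar>x\<bar>))))"
      unfolding K_def using \<phi>0[of x] by (simp add: norm_mult of_real_of_bool)
    also have "\<dots> = \<phi> x * norm (LINT \<epsilon>|lborel. pos_powr (of_real (Re p) - 1) \<epsilon> * of_bool (\<epsilon> \<le> \<bar>x\<bar>))"
      by (subst integral_norm_pos_powr) (auto simp: of_real_of_bool)
    also have "\<dots> = \<phi> x * norm (pos_powr (of_real (Re p)) \<bar>x\<bar> / of_real (Re p))"
      using assms(2) that by (subst mellin_le_abs(2)) auto
    also have "\<dots> = norm (pos_powr p \<bar>x\<bar> * of_real (\<phi> x)) / Re p"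
      using assms \<phi>0[of x] by (simp add: norm_mult norm_divide norm_pos_powr)
    finally show ?thesis .
  qed
  have ae0: "AE x in lborel. x \<noteq> (0::real)" by (rule AE_lborel_singleton)
  have mom: "integrable lborel (\<lambda>x. pos_powr p \<bar>x\<bar> * of_real (\<phi> x))"
    "(LINT x|lborel. pos_powr p \<bar>x\<bar> * of_real (\<phi> x)) = abs_moment t p"
    using abs_moment_normal[OF assms(1), of p] assms(2) unfolding \<phi>_def by simp_all
  have [measurable]: "(\<lambda>(x, \<epsilon>). K x \<epsilon>) \<in> borel_measurable (lborel \<Otimes>\<^sub>M lborel)"
    unfolding K_def by measurable
  have "integrable lborel (\<lambda>x. LINT \<epsilon>|lborel. norm (K x \<epsilon>))"
  proof (subst integrable_cong_AE)
    show "AE x in lborel. (LINT \<epsilon>|lborel. norm (K x \<epsilon>)) = norm (pos_powr p \<bar>x\<bar> * of_real (\<phi> x)) / Re p"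
      using ae0 by eventually_elim (rule norm_x)
    show "integrable lborel (\<lambda>x. norm (pos_powr p \<bar>x\<bar> * of_real (\<phi> x)) / Re p)"
      using mom(1) by (intro integrable_divide integrable_norm) auto
  qed measurable
  then have prod: "integrable (lborel \<Otimes>\<^sub>M lborel) (\<lambda>(x, \<epsilon>). K x \<epsilon>)"
    using ae0 int_x(1) by (intro lborel_pair.Fubini_integrable) (auto elim: eventually_mono)
  have inner: "(LINT x|lborel. K x \<epsilon>) = pos_powr (p - 1) \<epsilon> * of_real (normal_tail t \<epsilon>)" for \<epsilon>
  proof -
    have "K x \<epsilon> = pos_powr (p - 1) \<epsilon> * of_real (\<phi> x * of_bool (\<epsilon> \<le> \<bar>x\<bar>))" for x
      by (simp add: K_def of_real_of_bool)
    then show ?thesis by (simp add: normal_tail_def \<phi>_def del: of_real_mult)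
  qed
  show ?A using lborel_pair.integrable_snd[OF prod] unfolding inner .
  have "(LINT \<epsilon>|lborel. pos_powr (p - 1) \<epsilon> * of_real (normal_tail t \<epsilon>)) = (LINT x|lborel. LINT \<epsilon>|lborel. K x \<epsilon>)"
    using lborel_pair.Fubini_integral[OF prod] unfolding inner .
  also have "\<dots> = (LINT x|lborel. pos_powr p \<bar>x\<bar> * of_real (\<phi> x) / p)"
    using ae0 by (intro integral_cong_AE) (auto elim!: eventually_mono simp: int_x)
  also have "\<dots> = abs_moment t p / p" using mom(2) by simp
  finally show ?B .
qed

section \<open>The zeta function of Brownian motion\<close>

text \<open>The jump of \<open>level b\<close> at m = k + 1, so the level function is a sum of
  indicators of |z| \<ge> (k + 1) \<epsilon> with these weights.\<close>

definition bar_weight :: "nat \<Rightarrow> nat \<Rightarrow> real" where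
  "bar_weight b k = (if even (b + Suc k) then 2 * real (Suc k) else 0)"

lemma bar_weight_nonneg: "bar_weight b k \<ge> 0"
  by (simp add: bar_weight_def)

lemma level_eq_sum: "real (level b j) = (\<Sum>k<j. bar_weight b k)"
  by (induction j) (auto simp: level_Suc bar_weight_def)

lemma levf_eq_suminf:
  assumes "\<epsilon> > 0"
  shows "levf \<epsilon> b z = (\<Sum>k. ennreal (bar_weight b k * of_bool (real (Suc k) * \<epsilon> \<le> \<bar>z\<bar>)))"
proof -
  define j where "j = nat \<lfloor>\<bar>z\<bar> / \<epsilon>\<rfloor>"
  have j: "real (Suc k) * \<epsilon> \<le> \<bar>z\<bar> \<longleftrightarrow> k < j" for k
  proof -
    have "real (Suc k) * \<epsilon> \<le> \<bar>z\<bar> \<longleftrightarrow> of_int (int (Suc k)) \<le> \<bar>z\<bar> / \<epsilon>"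
      using assms by (simp add: pos_le_divide_eq)
    also have "\<dots> \<longleftrightarrow> int (Suc k) \<le> \<lfloor>\<bar>z\<bar> / \<epsilon>\<rfloor>" by (rule le_floor_iff[symmetric])
    also have "\<dots> \<longleftrightarrow> k < j" unfolding j_def by linarith
    finally show ?thesis .
  qed
  have "(\<Sum>k. ennreal (bar_weight b k * of_bool (real (Suc k) * \<epsilon> \<le> \<bar>z\<bar>))) =
      (\<Sum>k<j. ennreal (bar_weight b k * of_bool (real (Suc k) * \<epsilon> \<le> \<bar>z\<bar>)))"
    unfolding j by (intro suminf_finite) auto
  also have "\<dots> = (\<Sum>k<j. ennreal (bar_weight b k))" unfolding j by (intro sum.cong) auto
  also have "\<dots> = ennreal (real (level b j))" unfolding level_eq_sum
    by (intro sum_ennreal bar_weight_nonneg)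
  finally show ?thesis unfolding levf_def j_def by (simp add: ennreal_of_nat_eq_real_of_nat)
qed

lemma nn_integral_normal_tail:
  assumes "t > 0" "w \<ge> 0"
  shows "gauss_exp (sqrt t) (\<lambda>z. ennreal (w * of_bool (a \<le> \<bar>z\<bar>))) = ennreal (w * normal_tail t a)"
proof -
  have "integrable lborel (\<lambda>x. normal_density 0 (sqrt t) x * of_bool (a \<le> \<bar>x\<bar>))"
    by (rule Bochner_Integration.integrable_bound[of _ "normal_density 0 (sqrt t)"]) (use assms in auto)
  then have "(\<integral>\<^sup>+x. ennreal (normal_density 0 (sqrt t) x * of_bool (a \<le> \<bar>x\<bar>)) \<partial>lborel) = ennreal (normal_tail t a)"
    unfolding normal_tail_def by (intro nn_integral_eq_integral) auto
  then have "gauss_exp (sqrt t) (\<lambda>z. ennreal (of_bool (a \<le> \<bar>z\<bar>))) = ennreal (normal_tail t a)"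
    unfolding gauss_exp_def by (simp add: ennreal_mult)
  then show ?thesis using assms normal_tail_nonneg
    by (subst ennreal_mult) (auto simp: gauss_exp_cmult ennreal_mult)
qed

abbreviation bar_prob :: "real \<Rightarrow> nat \<Rightarrow> real \<Rightarrow> real" where
  "bar_prob t k \<epsilon> \<equiv> normal_tail t (real (Suc k) * \<epsilon>)"

lemma potential_eq_suminf:
  assumes "\<epsilon> > 0" "t > 0"
  shows "potential \<epsilon> b t 0 = (\<Sum>k. ennreal (bar_weight b k * bar_prob t k \<epsilon>))"
proof -
  have "potential \<epsilon> b t 0 = gauss_exp (sqrt t) (levf \<epsilon> b)" using assms by (simp add: potential_def)
  also have "\<dots> = (\<integral>\<^sup>+z. (\<Sum>k. ennreal (normal_density 0 (sqrt t) z) * ennreal (bar_weight b k * of_bool (real (Suc k) * \<epsilon> \<le> \<bar>z\<bar>))) \<partial>lborel)"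
    unfolding gauss_exp_def by (simp only: levf_eq_suminf[OF assms(1)] ennreal_suminf_cmult)
  also have "\<dots> = (\<Sum>k. gauss_exp (sqrt t) (\<lambda>z. ennreal (bar_weight b k * of_bool (real (Suc k) * \<epsilon> \<le> \<bar>z\<bar>))))"
    unfolding gauss_exp_def by (intro nn_integral_suminf) measurable
  also have "\<dots> = (\<Sum>k. ennreal (bar_weight b k * bar_prob t k \<epsilon>))"
    by (intro suminf_cong nn_integral_normal_tail assms bar_weight_nonneg)
  finally show ?thesis .
qed

lemma potential_sums:
  assumes "\<epsilon> > 0" "t > 0"
  shows "(\<lambda>k. bar_weight b k * bar_prob t k \<epsilon>) sums enn2real (potential \<epsilon> b t 0)"
proof -
  let ?f = "\<lambda>k. bar_weight b k * bar_prob t k \<epsilon>"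
  have nn: "?f k \<ge> 0" for k by (intro mult_nonneg_nonneg bar_weight_nonneg normal_tail_nonneg)
  have ne: "(\<Sum>k. ennreal (?f k)) \<noteq> top"
    using potential_finite[of \<epsilon> t b 0] assms by (simp add: potential_eq_suminf)
  have "summable ?f" by (rule summable_suminf_not_top[OF nn ne])
  moreover have "enn2real (potential \<epsilon> b t 0) = (\<Sum>k. ?f k)"
    unfolding potential_eq_suminf[OF assms] suminf_ennreal[OF nn ne]
    using calculation nn by (intro enn2real_ennreal suminf_nonneg)
  ultimately show ?thesis by (simp add: summable_sums)
qed

text \<open>Twice the drops minus the rises. The index is shifted by one: even \<open>k\<close>
  belongs to odd m = k + 1, with coefficient 4 m, and odd \<open>k\<close> to even m, with
  coefficient - 2 m.\<close>

definition bar_coeff :: "nat \<Rightarrow> real" where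
  "bar_coeff k = 2 * bar_weight 1 k - bar_weight 0 k"

lemma bar_coeff_eq: "bar_coeff k = (if even k then 4 else - 2) * real (Suc k)"
  by (auto simp: bar_coeff_def bar_weight_def)

context standard_brownian_motion begin

definition mean_bars :: "real \<Rightarrow> real \<Rightarrow> real" where
  "mean_bars t \<epsilon> = enn2real (expected_num_bars M B t \<epsilon>)"

lemma expected_num_bars_sums:
  assumes "t > 0" "\<epsilon> > 0"
  shows "(\<lambda>k. bar_coeff k * bar_prob t k \<epsilon>) sums mean_bars t \<epsilon>"
    and "summable (\<lambda>k. \<bar>bar_coeff k * bar_prob t k \<epsilon>\<bar>)"
proof -
  note s = potential_sums[OF assms(2,1)]
  define a b where "a = enn2real (potential \<epsilon> 1 t 0)" and "b = enn2real (potential \<epsilon> 0 t 0)"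
  have "potential \<epsilon> 1 t 0 = ennreal a" "potential \<epsilon> 0 t 0 = ennreal b"
    unfolding a_def b_def using potential_finite[of \<epsilon> t _ 0] assms by simp_all
  moreover from this have "b \<le> a" unfolding a_def b_def
    using potential_le[OF assms] potential_finite[of \<epsilon> t 1 0] assms by (intro enn2real_mono) auto
  moreover have "0 \<le> b" by (simp add: b_def)
  ultimately have "expected_num_bars M B t \<epsilon> = ennreal (a + (a - b))"
    unfolding expected_num_bars_eq[OF assms] by (subst ennreal_plus) (auto simp: ennreal_minus)
  then have "mean_bars t \<epsilon> = 2 * a - b"
    unfolding mean_bars_def using \<open>b \<le> a\<close> \<open>0 \<le> b\<close> by simp
  then show "(\<lambda>k. bar_coeff k * bar_prob t k \<epsilon>) sums mean_bars t \<epsilon>"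
    using sums_diff[OF sums_mult[OF s[of 1], of 2] s[of 0]]
    by (simp add: bar_coeff_def a_def b_def left_diff_distrib mult.assoc)
  have "summable (\<lambda>k. 2 * (bar_weight 1 k * bar_prob t k \<epsilon>) + bar_weight 0 k * bar_prob t k \<epsilon>)"
    using s by (intro summable_add summable_mult) (auto simp: sums_iff)
  then show "summable (\<lambda>k. \<bar>bar_coeff k * bar_prob t k \<epsilon>\<bar>)"
  proof (rule summable_comparison_test'[where N = 0])
    fix k :: nat
    have "\<bar>bar_coeff k\<bar> \<le> 2 * bar_weight 1 k + bar_weight 0 k"
      unfolding bar_coeff_def using bar_weight_nonneg[of 1 k] bar_weight_nonneg[of 0 k] by linarith
    then have "\<bar>bar_coeff k\<bar> * bar_prob t k \<epsilon> \<le> (2 * bar_weight 1 k + bar_weight 0 k) * bar_prob t k \<epsilon>"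
      using normal_tail_nonneg by (rule mult_right_mono)
    then show "norm \<bar>bar_coeff k * bar_prob t k \<epsilon>\<bar> \<le>
      2 * (bar_weight 1 k * bar_prob t k \<epsilon>) + bar_weight 0 k * bar_prob t k \<epsilon>"
      by (simp add: abs_mult normal_tail_nonneg algebra_simps)
  qed
qed

lemma expected_num_bars_finite:
  assumes "t > 0" "\<epsilon> > 0" shows "expected_num_bars M B t \<epsilon> < \<infinity>"
proof -
  have "expected_num_bars M B t \<epsilon> \<le> potential \<epsilon> 1 t 0 + potential \<epsilon> 1 t 0"
    unfolding expected_num_bars_eq[OF assms] by (intro add_left_mono diff_le_self_ennreal)
  also have "\<dots> < \<infinity>" using potential_finite[of \<epsilon> t 1 0] assms by simp
  finally show ?thesis .
qed

end

text \<open>The coefficients are 4 m for all m minus 6 m for even m. The even m contribute 2^(1-p)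
  times the full Dirichlet series at p - 1.\<close>

lemma bar_coeff_dirichlet_sums:
  assumes "Re p > 2"
  shows "(\<lambda>k. of_real (bar_coeff k) * of_nat (Suc k) powr (- p)) sums
    ((4 - 6 * 2 powr (1 - p)) * riemann_zeta (p - 1))"
proof -
  define g where "g k = complex_of_nat (Suc k) powr (- (p - 1))" for k
  have g: "g sums riemann_zeta (p - 1)" using riemann_zeta_sums[of "p - 1"] assms by (simp add: g_def[abs_def] del: of_nat_Suc)
  define e where "e k = (if odd k then g k else 0)" for k
  have "e sums (2 powr (1 - p) * riemann_zeta (p - 1))"
  proof -
    have "g (2 * j + 1) = 2 powr (1 - p) * g j" for j
    proof -
      have "complex_of_nat (Suc (2 * j + 1)) = of_nat 2 * of_nat (Suc j)" by simp
      then show ?thesis unfolding g_def by (simp only:) (subst powr_times_real; simp)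
    qed
    then have "(\<lambda>j. e (2 * j + 1)) sums (2 powr (1 - p) * riemann_zeta (p - 1))"
      using sums_mult[OF g, of "2 powr (1 - p)"] by (simp add: e_def)
    moreover have "strict_mono (\<lambda>j::nat. 2 * j + 1)" by (auto simp: strict_mono_def)
    moreover have "e n = 0" if "n \<notin> range (\<lambda>j. 2 * j + 1)" for n
      using that by (auto simp: e_def elim!: oddE)
    ultimately show ?thesis by (subst (asm) sums_mono_reindex) auto
  qed
  then have "(\<lambda>k. 4 * g k - 6 * e k) sums (4 * riemann_zeta (p - 1) - 6 * (2 powr (1 - p) * riemann_zeta (p - 1)))"
    by (intro sums_diff sums_mult g)
  moreover have "4 * g k - 6 * e k = of_real (bar_coeff k) * of_nat (Suc k) powr (- p)" for k
  proof -
    have "g k = of_nat (Suc k) * of_nat (Suc k) powr (- p)"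
      unfolding g_def using powr_add[of "of_nat (Suc k) :: complex" 1 "- p"] by (simp add: algebra_simps del: of_nat_Suc)
    then show ?thesis by (simp add: e_def bar_coeff_eq algebra_simps)
  qed
  ultimately show ?thesis by (simp add: algebra_simps)
qed

context standard_brownian_motion begin

abbreviation zeta_integrand :: "real \<Rightarrow> complex \<Rightarrow> real \<Rightarrow> complex" where
  "zeta_integrand t p \<epsilon> \<equiv> pos_powr (p - 1) \<epsilon> * of_real (mean_bars t \<epsilon>)"

lemma indicator_zeta_integrand:
  "indicator {0<..} \<epsilon> *\<^sub>R process_zeta_integrand M B t p \<epsilon> =
     zeta_integrand t p \<epsilon>"
  by (auto simp: process_zeta_integrand_def mean_bars_def pos_powr_def indicator_def)

text \<open>Termwise Mellin transform: rescaling the tail by k + 1 yields the factor (k + 1)^(-p),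
  so the coefficients assemble into the Dirichlet series of
  \<open>bar_coeff_dirichlet_sums\<close>.\<close>

lemma zeta_integrand_integral:
  assumes t: "t > 0" and p: "Re p > 2"
  shows "integrable lborel (zeta_integrand t p)" (is ?A)
    and "(LINT \<epsilon>|lborel. zeta_integrand t p \<epsilon>) =
      (4 - 6 * 2 powr (1 - p)) * riemann_zeta (p - 1) * abs_moment t p / p" (is ?B)
proof -
  define f where "f k \<epsilon> = of_real (bar_coeff k) * (pos_powr (p - 1) \<epsilon> * of_real (bar_prob t k \<epsilon>))" for k \<epsilon>
  have tail: "integrable lborel (\<lambda>\<epsilon>. pos_powr (p - 1) \<epsilon> * of_real (bar_prob t k \<epsilon>))"
    "(LINT \<epsilon>|lborel. pos_powr (p - 1) \<epsilon> * of_real (bar_prob t k \<epsilon>)) = of_nat (Suc k) powr (- p) * (abs_moment t p / p)"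
    if "Re p > 0" for k p
    using mellin_scale[OF mellin_normal_tail(1)[OF t that], of "real (Suc k)"] mellin_normal_tail(2)[OF t that]
    by (simp_all del: of_nat_Suc)
  have int: "integrable lborel (f k)" for k unfolding f_def using tail(1)[of p] p by simp
  have ae: "AE \<epsilon> in lborel. summable (\<lambda>k. norm (f k \<epsilon>))"
  proof (rule AE_I2)
    fix \<epsilon> :: real
    show "summable (\<lambda>k. norm (f k \<epsilon>))"
    proof (cases "\<epsilon> > 0")
      case True
      have "norm (f k \<epsilon>) = norm (pos_powr (p - 1) \<epsilon>) * \<bar>bar_coeff k * bar_prob t k \<epsilon>\<bar>" for k
        unfolding f_def norm_mult norm_of_real by (simp add: abs_mult)
      then show ?thesis using expected_num_bars_sums(2)[OF t True] by (simp add: summable_mult)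
    qed (simp add: f_def pos_powr_def)
  qed
  have summ: "summable (\<lambda>k. LINT \<epsilon>|lborel. norm (f k \<epsilon>))"
  proof -
    define K where "K = norm (abs_moment t (of_real (Re p)) / of_real (Re p))"
    have "(LINT \<epsilon>|lborel. norm (f k \<epsilon>)) = \<bar>bar_coeff k\<bar> * (real (Suc k) powr (- Re p) * K)" for k
    proof -
      have "(LINT \<epsilon>|lborel. norm (f k \<epsilon>)) = \<bar>bar_coeff k\<bar> *
          (LINT \<epsilon>|lborel. norm (pos_powr (p - 1) \<epsilon> * of_real (bar_prob t k \<epsilon>)))"
        unfolding f_def norm_mult[of "of_real (bar_coeff k)"] norm_of_real by (rule Bochner_Integration.integral_mult_right_zero)
      also have "(LINT \<epsilon>|lborel. norm (pos_powr (p - 1) \<epsilon> * of_real (bar_prob t k \<epsilon>))) =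
          norm (LINT \<epsilon>|lborel. pos_powr (of_real (Re p) - 1) \<epsilon> * of_real (bar_prob t k \<epsilon>))"
        by (rule integral_norm_pos_powr) (rule normal_tail_nonneg)
      also have "(LINT \<epsilon>|lborel. pos_powr (of_real (Re p) - 1) \<epsilon> * of_real (bar_prob t k \<epsilon>)) =
          of_nat (Suc k) powr (- of_real (Re p)) * (abs_moment t (of_real (Re p)) / of_real (Re p))"
        using p by (intro tail(2)) simp
      also have "norm \<dots> = real (Suc k) powr (- Re p) * K"
        unfolding norm_mult K_def
        using norm_powr_real_powr[of "of_nat (Suc k)" "- of_real (Re p)"] by (simp del: of_nat_Suc)
      finally show ?thesis .
    qed
    \<comment> \<open>The linear growth of the coefficients costs one power of k + 1; this is where
      \<open>Re p > 2\<close> is used.\<close>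
    moreover have "summable (\<lambda>k. \<bar>bar_coeff k\<bar> * (real (Suc k) powr (- Re p) * K))"
    proof (rule summable_comparison_test'[where N = 0])
      have "summable (\<lambda>k. real (Suc k) powr (1 - Re p))"
        using p by (subst summable_Suc_iff) (simp add: summable_real_powr_iff)
      then show "summable (\<lambda>k. 4 * K * real (Suc k) powr (1 - Re p))" by (rule summable_mult)
      fix k :: nat
      have "\<bar>bar_coeff k\<bar> \<le> 4 * real (Suc k)" by (simp add: bar_coeff_eq abs_mult)
      then have "\<bar>bar_coeff k\<bar> * (real (Suc k) powr (- Re p) * K) \<le> 4 * real (Suc k) * (real (Suc k) powr (- Re p) * K)"
        by (intro mult_right_mono) (auto simp: K_def)
      also have "\<dots> = 4 * K * real (Suc k) powr (1 - Re p)"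
        using powr_add[of "real (Suc k)" 1 "- Re p"] by (simp add: algebra_simps del: of_nat_Suc)
      finally show "norm (\<bar>bar_coeff k\<bar> * (real (Suc k) powr (- Re p) * K)) \<le> 4 * K * real (Suc k) powr (1 - Re p)"
        by (simp add: K_def abs_mult)
    qed
    ultimately show ?thesis by simp
  qed
  have sum: "(\<Sum>k. f k \<epsilon>) = zeta_integrand t p \<epsilon>" for \<epsilon>
  proof (cases "\<epsilon> > 0")
    case True
    have "(\<lambda>k. pos_powr (p - 1) \<epsilon> * of_real (bar_coeff k * bar_prob t k \<epsilon>)) sums
        (zeta_integrand t p \<epsilon>)"
      by (intro sums_mult sums_of_real expected_num_bars_sums(1) t True)
    moreover have "pos_powr (p - 1) \<epsilon> * of_real (bar_coeff k * bar_prob t k \<epsilon>) = f k \<epsilon>" for k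
      by (simp add: f_def)
    ultimately show ?thesis by (simp only: sums_iff)
  qed (simp add: f_def pos_powr_def)
  show ?A using integrable_suminf[OF int ae summ] unfolding sum .
  have "(\<lambda>k. LINT \<epsilon>|lborel. f k \<epsilon>) sums (LINT \<epsilon>|lborel. zeta_integrand t p \<epsilon>)"
    using sums_integral[OF int ae summ] unfolding sum .
  moreover have "(LINT \<epsilon>|lborel. f k \<epsilon>) = of_real (bar_coeff k) * of_nat (Suc k) powr (- p) * (abs_moment t p / p)" for k
    unfolding f_def using tail(2)[of p k] p by (simp del: of_nat_Suc)
  moreover have "(\<lambda>k. of_real (bar_coeff k) * of_nat (Suc k) powr (- p) * (abs_moment t p / p)) sums
      ((4 - 6 * 2 powr (1 - p)) * riemann_zeta (p - 1) * (abs_moment t p / p))"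
    by (intro sums_mult2 bar_coeff_dirichlet_sums p)
  ultimately show ?B by (simp add: sums_iff)
qed

text \<open>Drops alone suffice: for |z| \<ge> 1 the band index j satisfies 1 / \<epsilon> \<le> 2
  j, and \<open>level 1 j\<close> is at least j^2 / 2, hence at least 1 / (8 \<epsilon>^2).\<close>

lemma expected_num_bars_lower:
  assumes "t > 0" "0 < \<epsilon>" "\<epsilon> \<le> 1"
  shows "normal_tail t 1 / (8 * \<epsilon>\<^sup>2) \<le> mean_bars t \<epsilon>"
proof -
  have "ennreal (1 / (8 * \<epsilon>\<^sup>2) * of_bool (1 \<le> \<bar>z\<bar>)) \<le> levf \<epsilon> 1 z" for z
  proof (cases "1 \<le> \<bar>z\<bar>")
    case True
    define j where "j = nat \<lfloor>\<bar>z\<bar> / \<epsilon>\<rfloor>"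
    have "1 / \<epsilon> \<le> \<bar>z\<bar> / \<epsilon>" "1 \<le> 1 / \<epsilon>" using True assms by (auto intro: divide_right_mono)
    moreover from this have "1 \<le> \<lfloor>\<bar>z\<bar> / \<epsilon>\<rfloor>" by (simp add: le_floor_iff)
    then have "1 \<le> real j" "\<bar>z\<bar> / \<epsilon> < real j + 1" unfolding j_def by linarith+
    ultimately have "1 / \<epsilon> \<le> 2 * real j" by linarith
    then have "(1 / \<epsilon>)\<^sup>2 \<le> (2 * real j)\<^sup>2" using assms by (intro power_mono) auto
    moreover have "j \<le> 2 * ((j + 1) div 2)" by linarith
    then have "real j \<le> 2 * real ((j + 1) div 2)" by linarith
    then have "(real j)\<^sup>2 \<le> (2 * real ((j + 1) div 2))\<^sup>2" by (intro power_mono) auto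
    ultimately have "1 / (8 * \<epsilon>\<^sup>2) \<le> real (level 1 j)"
      by (simp add: level_def power_mult_distrib power_divide)
    then show ?thesis using True unfolding levf_def j_def[symmetric]
      by (simp add: ennreal_of_nat_eq_real_of_nat ennreal_leI)
  qed simp
  then have "ennreal (1 / (8 * \<epsilon>\<^sup>2) * normal_tail t 1) \<le> potential \<epsilon> 1 t 0"
    unfolding potential_def using assms
    by (subst nn_integral_normal_tail[symmetric]) (auto intro!: gauss_exp_mono)
  also have "\<dots> \<le> expected_num_bars M B t \<epsilon>" using assms by (simp add: expected_num_bars_eq)
  finally have "enn2real (ennreal (1 / (8 * \<epsilon>\<^sup>2) * normal_tail t 1)) \<le> mean_bars t \<epsilon>"
    unfolding mean_bars_def using expected_num_bars_finite assms by (intro enn2real_mono) auto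
  then show ?thesis by (simp add: normal_tail_nonneg)
qed

end

lemma normal_tail_pos:
  assumes "t > 0" shows "normal_tail t 1 > 0"
proof -
  have "ennreal (normal_density 0 (sqrt t) 2) * indicator {1..2} z \<le>
      ennreal (normal_density 0 (sqrt t) z) * ennreal (1 * of_bool (1 \<le> \<bar>z\<bar>))" for z :: real
    using normal_density_le_iff_abs[of z 2 "sqrt t"] by (auto simp: indicator_def intro: ennreal_leI)
  then have "(\<integral>\<^sup>+z. ennreal (normal_density 0 (sqrt t) 2) * indicator {1..2::real} z \<partial>lborel) \<le>
      gauss_exp (sqrt t) (\<lambda>z. ennreal (1 * of_bool (1 \<le> \<bar>z\<bar>)))"
    unfolding gauss_exp_def by (rule nn_integral_mono)
  also have "\<dots> = ennreal (1 * normal_tail t 1)" by (rule nn_integral_normal_tail[OF assms]) simp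
  finally have "(\<integral>\<^sup>+z. ennreal (normal_density 0 (sqrt t) 2) * indicator {1..2::real} z \<partial>lborel) \<le> ennreal (normal_tail t 1)"
    by simp
  moreover have "(\<integral>\<^sup>+z. ennreal (normal_density 0 (sqrt t) 2) * indicator {1..2::real} z \<partial>lborel) =
      ennreal (normal_density 0 (sqrt t) 2)"
    by (simp add: nn_integral_cmult_indicator)
  moreover have "normal_density 0 (sqrt t) 2 > 0" using assms by (simp add: normal_density_pos)
  ultimately show ?thesis using normal_tail_nonneg[of t 1] by (simp add: ennreal_le_iff)
qed

section \<open>Domain of convergence and closed form of the zeta function\<close>

context standard_brownian_motion begin

text \<open>Near 0 the norm dominates q \<epsilon>^(Re p - 3), whose exponent is at most -1, and
  hence q \<epsilon>^(s-1) on (0, 1] for every s > 0. The latter has integral q / s; the choice of s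
  makes it I + 1, more than the supposed integral I.\<close>

lemma zeta_integrand_not_integrable:
  assumes t: "t > 0" and p: "Re p \<le> 2"
    and int: "integrable lborel (zeta_integrand t p)"
  shows False
proof -
  define q where "q = normal_tail t 1 / 8"
  define I where "I = (LINT \<epsilon>|lborel. norm (zeta_integrand t p \<epsilon>))"
  have q: "q > 0" using normal_tail_pos[OF t] by (simp add: q_def)
  have I: "I \<ge> 0" unfolding I_def by (intro integral_nonneg_AE) auto
  define s where "s = q / (I + 1)"
  have s: "s > 0" using q I by (simp add: s_def)
  have "(LINT \<epsilon>|lborel. q * norm (pos_powr (of_real s - 1) \<epsilon> * of_real (of_bool (\<epsilon> \<le> 1)))) \<le> I"
    unfolding I_def
  proof (rule integral_mono)
    show "integrable lborel (\<lambda>\<epsilon>. q * norm (pos_powr (of_real s - 1) \<epsilon> * of_real (of_bool (\<epsilon> \<le> 1))))"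
      using mellin_Icc(1)[of "of_real s"] s by (intro integrable_mult_right integrable_norm) (simp add: of_real_of_bool)
    show "integrable lborel (\<lambda>\<epsilon>. norm (zeta_integrand t p \<epsilon>))"
      by (rule integrable_norm[OF int])
    fix \<epsilon> :: real
    show "q * norm (pos_powr (of_real s - 1) \<epsilon> * of_real (of_bool (\<epsilon> \<le> 1))) \<le>
        norm (zeta_integrand t p \<epsilon>)"
    proof (cases "0 < \<epsilon> \<and> \<epsilon> \<le> 1")
      case True
      have "q * \<epsilon> powr (s - 1) \<le> q * \<epsilon> powr (Re p - 3)"
        using True q s p by (intro mult_left_mono powr_mono') auto
      also have "\<epsilon> powr (Re p - 3) = \<epsilon> powr (Re p - 1) / \<epsilon>\<^sup>2"
        using True powr_diff[of \<epsilon> "Re p - 1" 2] by simp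
      also have "q * (\<epsilon> powr (Re p - 1) / \<epsilon>\<^sup>2) = \<epsilon> powr (Re p - 1) * (normal_tail t 1 / (8 * \<epsilon>\<^sup>2))"
        by (simp add: q_def)
      also have "\<dots> \<le> \<epsilon> powr (Re p - 1) * mean_bars t \<epsilon>"
        using expected_num_bars_lower[OF t] True by (intro mult_left_mono) auto
      finally show ?thesis using True by (simp add: norm_mult norm_pos_powr mean_bars_def)
    qed (auto simp: pos_powr_def)
  qed
  moreover have "(LINT \<epsilon>|lborel. q * norm (pos_powr (of_real s - 1) \<epsilon> * of_real (of_bool (\<epsilon> \<le> 1)))) = q * (1 / s)"
  proof -
    have "(LINT \<epsilon>|lborel. norm (pos_powr (of_real s - 1) \<epsilon> * of_real (of_bool (\<epsilon> \<le> 1)))) =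
        norm (LINT \<epsilon>|lborel. pos_powr (of_real s - 1) \<epsilon> * of_real (of_bool (\<epsilon> \<le> 1)))"
      using integral_norm_pos_powr[of "\<lambda>\<epsilon>. of_bool (\<epsilon> \<le> 1)" "of_real s"] by simp
    also have "(LINT \<epsilon>|lborel. pos_powr (of_real s - 1) \<epsilon> * of_real (of_bool (\<epsilon> \<le> 1))) = 1 / of_real s"
      using mellin_Icc(2)[of "of_real s"] s by (simp add: of_real_of_bool)
    finally show ?thesis using s by (simp add: norm_divide)
  qed
  moreover have "q * (1 / s) = I + 1" using q I by (simp add: s_def)
  ultimately show False by simp
qed

lemma process_zeta_converges_iff:
  assumes "t > 0" shows "process_zeta_converges M B t p \<longleftrightarrow> Re p > 2"
proof -
  have "process_zeta_converges M B t p \<longleftrightarrow>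
     integrable lborel (zeta_integrand t p)"
    using expected_num_bars_finite[OF assms]
    by (simp add: process_zeta_converges_def set_integrable_def indicator_zeta_integrand)
  then show ?thesis
    using zeta_integrand_integral(1)[OF assms, of p] zeta_integrand_not_integrable[OF assms, of p] by (meson not_le)
qed

lemma process_zeta_eq:
  assumes "t > 0" "Re p > 2"
  shows "process_zeta M B t p = 4 * (2 powr p - 3) / of_real (sqrt pi) * of_real (t / 2) powr (p / 2) *
                  Gamma ((p + 1) / 2) * riemann_zeta (p - 1)"
proof -
  have p0: "p \<noteq> 0" using assms by auto
  have "process_zeta M B t p = (4 - 6 * 2 powr (1 - p)) * riemann_zeta (p - 1) * abs_moment t p"
    using p0 zeta_integrand_integral(2)[OF assms]
    by (simp add: process_zeta_def set_lebesgue_integral_def indicator_zeta_integrand)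
  also have "\<dots> = ((4 - 6 * 2 powr (1 - p)) * of_real (2 * t) powr (p / 2)) * (riemann_zeta (p - 1) * Gamma ((p + 1) / 2) / of_real (sqrt pi))"
    by (simp add: abs_moment_def)
  \<comment> \<open>Since (2 t)^(p/2) = 2^p (t/2)^(p/2), the factor becomes (4 - 6 2^(1-p)) 2^p = 4
    2^p - 12.\<close>
  also have "(4 - 6 * 2 powr (1 - p)) * of_real (2 * t) powr (p / 2) = 4 * (2 powr p - 3) * of_real (t / 2) powr (p / 2)"
  proof -
    have "of_real (2 * t) powr (p / 2) = 2 powr p * of_real (t / 2) powr (p / 2)"
    proof -
      have "of_real (2 * t) powr (p / 2) = exp (p / 2 * of_real (ln (2 * t)))"
        using assms Ln_of_real[of "2 * t"] by (simp add: powr_def del: of_real_mult)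
      also have "ln (2 * t) = 2 * ln 2 + ln (t / 2)" using assms by (simp add: ln_mult ln_div)
      also have "exp (p / 2 * of_real (2 * ln 2 + ln (t / 2))) = exp (p * of_real (ln 2)) * exp (p / 2 * of_real (ln (t / 2)))"
        by (simp add: exp_add[symmetric] algebra_simps)
      also have "\<dots> = 2 powr p * of_real (t / 2) powr (p / 2)"
        using assms Ln_of_real[of "t / 2"] Ln_of_real[of 2] by (simp add: powr_def del: of_real_divide)
      finally show ?thesis .
    qed
    moreover have "2 powr (1 - p) * 2 powr p = (2 :: complex)" by (simp add: powr_add[symmetric])
    ultimately show ?thesis by (simp add: algebra_simps)
  qed
  finally show ?thesis by simp
qed

end

section \<open>The closed formula as a meromorphic function\<close>

lemma half_Suc_nonpos_Ints_cases:
  assumes "(p + 1) / 2 \<in> (\<int>\<^sub>\<le>\<^sub>0 :: complex set)"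
  obtains m where "p = - 1 - 2 * of_nat m"
proof -
  obtain m where "(p + 1) / 2 = - of_nat m" using assms by (elim nonpos_Ints_cases')
  moreover have "p = 2 * ((p + 1) / 2) - 1" by (simp add: add_divide_distrib)
  ultimately have "p = - 1 - 2 * of_nat m" by simp
  then show ?thesis by (rule that)
qed

text \<open>At p = -1, -3, ... this takes the value 0, because \<open>Gamma\<close> is 0 at its
  poles; the continuation has to be read off from limits there, by means of
  \<open>remove_sings\<close>.\<close>

definition zeta_formula :: "real \<Rightarrow> complex \<Rightarrow> complex" where
  "zeta_formula t p = 4 * (2 powr p - 3) / of_real (sqrt pi) * of_real (t / 2) powr (p / 2) *
     Gamma ((p + 1) / 2) * riemann_zeta (p - 1)"

abbreviation zeta_domain :: "complex set" where
  "zeta_domain \<equiv> {p. p \<noteq> 2 \<and> (p + 1) / 2 \<notin> \<int>\<^sub>\<le>\<^sub>0}"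

lemma zeta_formula_holomorphic:
  "zeta_formula t holomorphic_on zeta_domain"
proof -
  have "riemann_zeta \<circ> (\<lambda>p. p - 1) holomorphic_on zeta_domain"
    by (rule holomorphic_on_compose_gen[OF _ riemann_zeta_holomorphic])
       (auto intro!: holomorphic_intros simp: algebra_simps)
  then show ?thesis unfolding zeta_formula_def[abs_def] o_def
    by (intro holomorphic_intros) auto
qed

lemma open_zeta_formula_domain: "open zeta_domain"
proof -
  have "closed (\<int>\<^sub>\<le>\<^sub>0 :: complex set)" by (rule closed_subset_Ints) (rule nonpos_Ints_subset_Ints)
  then have "closed ((\<lambda>p :: complex. (p + 1) / 2) -` \<int>\<^sub>\<le>\<^sub>0)" by (rule closed_vimage) (intro continuous_intros, simp)
  then have "open (- ({2} \<union> (\<lambda>p :: complex. (p + 1) / 2) -` \<int>\<^sub>\<le>\<^sub>0))" by (intro open_Compl closed_Un) auto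
  also have "- ({2} \<union> (\<lambda>p :: complex. (p + 1) / 2) -` \<int>\<^sub>\<le>\<^sub>0) = zeta_domain" by auto
  finally show ?thesis .
qed

lemma zeta_formula_analytic:
  assumes "p \<noteq> 2" "(p + 1) / 2 \<notin> \<int>\<^sub>\<le>\<^sub>0" shows "zeta_formula t analytic_on {p}"
  using zeta_formula_holomorphic open_zeta_formula_domain assms
  by (intro holomorphic_on_imp_analytic_at) auto

text \<open>The poles of the Gamma factor are cancelled by the trivial zeros of the zeta function.\<close>

lemma zeta_formula_removable:
  assumes "(p\<^sub>0 + 1) / 2 \<in> \<int>\<^sub>\<le>\<^sub>0"
  shows "remove_sings (zeta_formula t) analytic_on {p\<^sub>0}"
proof -
  obtain n where p0: "p\<^sub>0 = - 1 - 2 * of_nat n" using assms by (rule half_Suc_nonpos_Ints_cases)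
  then have n: "(p\<^sub>0 + 1) / 2 = - of_nat n" by simp
  have half: "(p + 1) / 2 + of_nat n = (p - p\<^sub>0) / 2" for p
    by (simp add: p0 add_divide_distrib diff_divide_distrib)
  have zero: "riemann_zeta (p\<^sub>0 - 1) = 0"
  proof -
    have eq: "p\<^sub>0 - 1 = - of_nat (2 * Suc n)" by (simp add: p0)
    show ?thesis unfolding eq by (rule riemann_zeta_trivial_zero) simp
  qed
  have iso: "isolated_singularity_at (zeta_formula t) p\<^sub>0"
  proof (rule isolated_singularity_at_holomorphic)
    have "ball p\<^sub>0 1 - {p\<^sub>0} \<subseteq> zeta_domain"
    proof
      fix p assume p: "p \<in> ball p\<^sub>0 1 - {p\<^sub>0}"
      then have Re: "\<bar>Re (p\<^sub>0 - p)\<bar> < 1" using abs_Re_le_cmod[of "p\<^sub>0 - p"] by (simp add: dist_norm)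
      then have "p \<noteq> 2" by (auto simp: p0)
      moreover have "(p + 1) / 2 \<notin> \<int>\<^sub>\<le>\<^sub>0"
      proof
        assume "(p + 1) / 2 \<in> \<int>\<^sub>\<le>\<^sub>0"
        then obtain m where pm: "p = - 1 - 2 * of_nat m" by (rule half_Suc_nonpos_Ints_cases)
        then have "m = n" using Re by (simp add: p0)
        then show False using p by (simp add: p0 pm)
      qed
      ultimately show "p \<in> zeta_domain" by simp
    qed
    then show "zeta_formula t holomorphic_on ball p\<^sub>0 1 - {p\<^sub>0}"
      by (rule holomorphic_on_subset[OF zeta_formula_holomorphic])
  qed auto
  define A where "A p = 4 * (2 powr p - 3) / of_real (sqrt pi) * of_real (t / 2) powr (p / 2)" for p :: complex
  have "A holomorphic_on UNIV" unfolding A_def by (intro holomorphic_intros) auto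
  then have A: "A \<midarrow>p\<^sub>0\<rightarrow> A p\<^sub>0"
    using holomorphic_on_imp_continuous_on continuous_on_eq_continuous_at isCont_def by blast
  have "filterlim (\<lambda>p. (p + 1) / 2) (at (- of_nat n)) (at p\<^sub>0)"
  proof (rule filterlim_atI)
    show "(\<lambda>p. (p + 1) / 2) \<midarrow>p\<^sub>0\<rightarrow> - of_nat n" unfolding n[symmetric] by (intro tendsto_intros) auto
    show "\<forall>\<^sub>F p in at p\<^sub>0. (p + 1) / 2 \<noteq> - of_nat n"
      unfolding eventually_at_filter eq_neg_iff_add_eq_0 half by (intro always_eventually) auto
  qed
  from filterlim_compose[OF Gamma_residues this]
  have G: "(\<lambda>p. Gamma ((p + 1) / 2) * ((p + 1) / 2 + of_nat n)) \<midarrow>p\<^sub>0\<rightarrow> (- 1) ^ n / fact n" .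
  have "p\<^sub>0 - 1 \<noteq> 1" by (auto simp: p0 complex_eq_iff)
  then have "riemann_zeta field_differentiable (at (p\<^sub>0 - 1))"
    using riemann_zeta_holomorphic by (intro holomorphic_on_imp_differentiable_at[of _ "- {1}"]) auto
  then obtain d where "(riemann_zeta has_field_derivative d) (at (p\<^sub>0 - 1))" by (auto simp: field_differentiable_def)
  then have "((\<lambda>p. riemann_zeta (p - 1)) has_field_derivative d * 1) (at p\<^sub>0)"
    by (intro DERIV_chain'[where f = "\<lambda>p. p - 1"]) (auto intro!: derivative_eq_intros)
  then have Z: "(\<lambda>p. (riemann_zeta (p - 1) - riemann_zeta (p\<^sub>0 - 1)) / (p - p\<^sub>0)) \<midarrow>p\<^sub>0\<rightarrow> d"
    by (simp add: has_field_derivative_iff)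
  \<comment> \<open>As (p + 1) / 2 + n = (p - p0) / 2, the factor regularizing Gamma times twice the
    difference quotient of zeta is just the zeta value, its value at p0 - 1 being 0. The limit is
    finite: residue of Gamma times derivative of zeta.\<close>
  have "(\<lambda>p. A p * (Gamma ((p + 1) / 2) * ((p + 1) / 2 + of_nat n)) *
      (2 * ((riemann_zeta (p - 1) - riemann_zeta (p\<^sub>0 - 1)) / (p - p\<^sub>0)))) \<midarrow>p\<^sub>0\<rightarrow> A p\<^sub>0 * ((- 1) ^ n / fact n) * (2 * d)"
    by (intro tendsto_mult A G Z tendsto_const)
  moreover have "\<forall>\<^sub>F p in at p\<^sub>0. A p * (Gamma ((p + 1) / 2) * ((p + 1) / 2 + of_nat n)) *
      (2 * ((riemann_zeta (p - 1) - riemann_zeta (p\<^sub>0 - 1)) / (p - p\<^sub>0))) = zeta_formula t p"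
    unfolding eventually_at_filter
  proof (intro always_eventually allI impI)
    fix p assume "p \<noteq> p\<^sub>0"
    then show "A p * (Gamma ((p + 1) / 2) * ((p + 1) / 2 + of_nat n)) *
      (2 * ((riemann_zeta (p - 1) - riemann_zeta (p\<^sub>0 - 1)) / (p - p\<^sub>0))) = zeta_formula t p"
      by (simp add: half zero zeta_formula_def A_def)
  qed
  ultimately have "zeta_formula t \<midarrow>p\<^sub>0\<rightarrow> A p\<^sub>0 * ((- 1) ^ n / fact n) * (2 * d)"
    by (rule Lim_transform_eventually)
  with iso show ?thesis by (rule remove_sings_analytic_at)
qed

lemma zeta_formula_at_2:
  assumes "t > 0"
  shows "isolated_singularity_at (zeta_formula t) 2" "is_pole (zeta_formula t) 2"
    "zorder (zeta_formula t) 2 = - 1" "residue (zeta_formula t) 2 = of_real t"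
proof -
  obtain F where F: "F holomorphic_on UNIV" "F 1 = 1" "\<And>s. s \<noteq> 1 \<Longrightarrow> riemann_zeta s = F s / (s - 1)"
    using riemann_zeta_simple_pole by blast
  define G where "G p = 4 * (2 powr p - 3) / of_real (sqrt pi) * of_real (t / 2) powr (p / 2) *
     Gamma ((p + 1) / 2) * F (p - 1)" for p
  have np: "(p + 1) / 2 \<notin> \<int>\<^sub>\<le>\<^sub>0" if "p \<in> ball 2 1" for p :: complex
  proof
    assume "(p + 1) / 2 \<in> \<int>\<^sub>\<le>\<^sub>0"
    then obtain m where "p = - 1 - 2 * of_nat m" by (elim half_Suc_nonpos_Ints_cases)
    moreover have "\<bar>Re (2 - p)\<bar> < 1" using that abs_Re_le_cmod[of "2 - p"] by (simp add: dist_norm)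
    ultimately show False by simp
  qed
  have "F \<circ> (\<lambda>p. p - 1) holomorphic_on ball 2 1"
    by (rule holomorphic_on_compose_gen[OF _ F(1)]) (auto intro!: holomorphic_intros)
  then have G: "G holomorphic_on ball 2 1" unfolding G_def o_def using np by (intro holomorphic_intros) auto
  have eq: "zeta_formula t p = G p / (p - 2)" if "p \<noteq> 2" for p
  proof -
    have "riemann_zeta (p - 1) = F (p - 1) / (p - 2)" using F(3)[of "p - 1"] that by simp
    then show ?thesis by (simp add: zeta_formula_def G_def)
  qed
  have \<Gamma>: "Gamma (3 / 2 :: complex) = of_real (sqrt pi) / 2"
  proof -
    have "Gamma (1 / 2 + 1 :: complex) = 1 / 2 * Gamma (1 / 2)" by (intro Gamma_plus1) (auto elim!: nonpos_Ints_cases simp: complex_eq_iff)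
    then show ?thesis by (simp add: Gamma_one_half_complex)
  qed
  have "(2 :: complex) powr 2 = 4" using powr_nat'[of "2 :: complex" 2] by simp
  \<comment> \<open>At p = 2 the factors are 4 (4 - 3) / sqrt pi, t / 2, Gamma (3/2) = sqrt pi / 2
    and F 1 = 1, with product t.\<close>
  then have G2: "G 2 = of_real t" using assms by (simp add: G_def F(2) \<Gamma>)
  then have G2': "G 2 \<noteq> 0" using assms by simp
  have ev: "\<forall>\<^sub>F p in at 2. zeta_formula t p = G p / (p - 2)"
    unfolding eventually_at_filter using eq by auto
  show "isolated_singularity_at (zeta_formula t) 2"
  proof (rule isolated_singularity_at_holomorphic)
    show "zeta_formula t holomorphic_on ball 2 1 - {2}"
      by (rule holomorphic_on_subset[OF zeta_formula_holomorphic]) (use np in auto)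
  qed auto
  have "is_pole (\<lambda>p. G p / (p - 2) ^ 1) 2" by (rule is_pole_basic[OF G]) (use G2' in auto)
  moreover have "is_pole (zeta_formula t) 2 \<longleftrightarrow> is_pole (\<lambda>p. G p / (p - 2) ^ 1) 2"
    by (rule is_pole_cong) (use ev in auto)
  ultimately show "is_pole (zeta_formula t) 2" by blast
  show "zorder (zeta_formula t) 2 = - 1"
    by (rule zorder_eqI[OF _ _ G G2']) (auto simp: eq power_int_minus field_simps)
  have "residue (zeta_formula t) 2 = residue (\<lambda>p. G p / (p - 2)) 2" by (rule residue_cong[OF ev refl])
  also have "\<dots> = of_real t" using residue_simple[OF _ _ G, of 2] G2 by simp
  finally show "residue (zeta_formula t) 2 = of_real t" .
qed

text \<open>The closed formula is asserted off 2 and off the poles of Gamma, where the HOL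
  expression is a default value. At the latter points Z is determined by holomorphy, so together the
  clauses fix Z off 2.\<close>

theorem theorem4p2:
  fixes M :: "'a measure" and B :: "real \<Rightarrow> 'a \<Rightarrow> real" and t :: real
  assumes "standard_brownian_motion M B"
    and "t > 0"
  shows "(\<forall>p. process_zeta_converges M B t p \<longleftrightarrow> Re p > 2) \<and>
    (\<exists>Z. Z meromorphic_on UNIV \<and>
         Z holomorphic_on (- {2}) \<and>
         (\<forall>p. Re p > 2 \<longrightarrow> Z p = process_zeta M B t p) \<and>
         (\<forall>p. p \<noteq> 2 \<and> (p + 1) / 2 \<notin> \<int>\<^sub>\<le>\<^sub>0 \<longrightarrow>
            Z p = 4 * (2 powr p - 3) / of_real (sqrt pi) * of_real (t / 2) powr (p / 2) *
                  Gamma ((p + 1) / 2) * riemann_zeta (p - 1)) \<and>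
         (\<forall>p. is_pole Z p \<longleftrightarrow> p = 2) \<and>
         zorder Z 2 = - 1 \<and>
         residue Z 2 = of_real t)"
proof -
  interpret standard_brownian_motion M B by fact
  note at2 = zeta_formula_at_2[OF assms(2)]
  define Z where "Z = remove_sings (zeta_formula t)"
  have formula: "Z p = zeta_formula t p" if "p \<noteq> 2" "(p + 1) / 2 \<notin> \<int>\<^sub>\<le>\<^sub>0" for p
    unfolding Z_def using that by (intro remove_sings_at_analytic zeta_formula_analytic)
  have ana: "Z analytic_on {p}" if "p \<noteq> 2" for p
    unfolding Z_def using that zeta_formula_removable remove_sings_analytic_on[OF zeta_formula_analytic] by blast
  then have hol: "Z holomorphic_on - {2}"
    by (intro analytic_imp_holomorphic) (subst analytic_on_analytic_at, auto)
  have pole: "is_pole Z p \<longleftrightarrow> p = 2" for p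
    using at2(1,2) ana[of p] analytic_at_imp_no_pole unfolding Z_def by (cases "p = 2") auto
  have "not_essential Z 2" unfolding Z_def using at2 by (simp add: is_pole_imp_not_essential)
  then have mero2: "Z meromorphic_on {2}"
    using at2(1) hol by (simp add: meromorphic_at_iff isolated_singularity_at_holomorphic[of Z UNIV] Compl_eq_Diff_UNIV)
  have "Z meromorphic_on {p}" for p
    using ana[of p] mero2 analytic_on_imp_meromorphic_on by (cases "p = 2") auto
  then have mero: "Z meromorphic_on UNIV" by (subst meromorphic_on_meromorphic_at) auto
  have ext: "Z p = process_zeta M B t p" if "Re p > 2" for p
  proof -
    have "(p + 1) / 2 \<notin> \<int>\<^sub>\<le>\<^sub>0"
    proof
      assume "(p + 1) / 2 \<in> \<int>\<^sub>\<le>\<^sub>0"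
      then obtain m where "p = - 1 - 2 * of_nat m" by (elim half_Suc_nonpos_Ints_cases)
      then show False using that by simp
    qed
    moreover have "p \<noteq> 2" using that by auto
    ultimately show ?thesis
      using formula process_zeta_eq[OF assms(2) that] by (simp add: zeta_formula_def)
  qed
  show ?thesis
    using process_zeta_converges_iff[OF assms(2)] mero hol ext formula pole at2
    by (intro conjI allI exI[of _ Z]) (auto simp: zeta_formula_def Z_def)
qed

end
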